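(* Let $p$ be a prime and let $G$ be a finite $p$-group of maximal class. Then $G$ is self-similar if and only if $G$ possesses an elementary abelian maximal subgroup over which $G$ splits. If that is the case, then $|G|\le p^{p+1}$, and this bound is sharp (i.e. for every prime $p$ there exists a self-similar $p$-group of maximal class of order $p^{p+1}$).
   Context: The $p$-adic tree $\mathcal{T}$ is the rooted tree whose vertices are the words of the free monoid $X^*$ on a set $X$ with $|X|=p$, where the children of $u\in X^*$ are the words $ux$, $x\in X$. $\operatorname{Aut}\mathcal{T}$ is the group of bijections of $X^*$ preserving incidence (hence fixing the root and preserving levels). For $g\in\operatorname{Aut}\mathcal{T}$ and $u\in X^*$, the section $g_u\in\operatorname{Aut}\mathcal{T}$ is defined by $g(uv)=g(u)g_u(v)$ for all $v\in X^*$. A subgroup $G\le \operatorname{Aut}\mathcal{T}$ is self-similar if $g_u\in G$ for all $g\in G$ and all $u\in X^*$. A finite $p$-group $G$ is called self-similar if it is isomorphic to a self-similar subgroup of $\operatorname{Aut}\mathcal{T}$, where $\mathcal{T}$ is the $p$-adic tree (same prime $p$). A $p$-group of order $p^n$ with $n\ge 2$ is of maximal class if its nilpotency class is $n-1$. $G$ splits over a normal subgroup $M$ if $M$ has a complement in $G$. *)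

theory Defs
  imports "HOL-Algebra.Algebra"
begin

text \<open>The vertices of the tree on an alphabet \<open>A\<close> are the elements of \<open>lists A\<close>.\<close>

definition child_of :: "'x list \<Rightarrow> 'x list \<Rightarrow> bool"
  where "child_of w u \<longleftrightarrow> (\<exists>x. w = u @ [x])"

definition adjacent :: "'x list \<Rightarrow> 'x list \<Rightarrow> bool"
  where "adjacent u w \<longleftrightarrow> child_of w u \<or> child_of u w"

text \<open>As in \<^theory>\<open>HOL-Algebra.Bij\<close>, automorphisms are made extensional on the
  vertex set, so that equality in the group is equality of maps on the tree.\<close>

definition tree_Aut :: "'x set \<Rightarrow> ('x list \<Rightarrow> 'x list) monoid"
  where "tree_Aut A = BijGroup (lists A) \<lparr>carrier :=
    {g \<in> Bij (lists A). \<forall>u \<in> lists A. \<forall>w \<in> lists A. adjacent (g u) (g w) \<longleftrightarrow> adjacent u w}\<rparr>"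

text \<open>\<open>tree_section A g u\<close> is the automorphism \<open>g\<^sub>u\<close> with \<open>g(uv) = g(u) g\<^sub>u(v)\<close>; the lemma
  \<open>tree_section_unique\<close> below shows that the description is proper.\<close>

definition tree_section :: "'x set \<Rightarrow> ('x list \<Rightarrow> 'x list) \<Rightarrow> 'x list \<Rightarrow> ('x list \<Rightarrow> 'x list)"
  where "tree_section A g u =
    (THE h. h \<in> carrier (tree_Aut A) \<and> (\<forall>v \<in> lists A. g (u @ v) = g u @ h v))"

definition self_similar_subgroup :: "'x set \<Rightarrow> ('x list \<Rightarrow> 'x list) set \<Rightarrow> bool"
  where "self_similar_subgroup A H \<longleftrightarrow>
    subgroup H (tree_Aut A) \<and> (\<forall>g \<in> H. \<forall>u \<in> lists A. tree_section A g u \<in> H)"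

definition self_similar :: "nat \<Rightarrow> ('a, 'b) monoid_scheme \<Rightarrow> bool"
  where "self_similar p G \<longleftrightarrow>
    (\<exists>H. self_similar_subgroup {..<p} H \<and> G \<cong> tree_Aut {..<p} \<lparr>carrier := H\<rparr>)"

lemma adjacent_append: "adjacent (u @ v) (u @ w) \<longleftrightarrow> adjacent v w"
  by (simp add: adjacent_def child_of_def)

lemma neighbours:
  assumes "u \<in> lists A"
  shows "{w \<in> lists A. adjacent u w} =
    (\<lambda>x. u @ [x]) ` A \<union> (if u = [] then {} else {butlast u})"
  using assms by (cases u rule: rev_cases) (auto simp: adjacent_def child_of_def)

lemma card_neighbours:
  assumes "u \<in> lists A" "finite A"
  shows "card {w \<in> lists A. adjacent u w} = card A + (if u = [] then 0 else 1)"
proof -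
  have c: "card ((\<lambda>x. u @ [x]) ` A) = card A"
    by (rule card_image) (auto simp: inj_on_def)
  have "butlast u \<notin> (\<lambda>x. u @ [x]) ` A"
  proof
    assume "butlast u \<in> (\<lambda>x. u @ [x]) ` A"
    then obtain x where "butlast u = u @ [x]" by auto
    then have "length (butlast u) = length u + 1" by simp
    then show False by simp
  qed
  then have "card ((\<lambda>x. u @ [x]) ` A \<union> {butlast u}) = card A + 1"
    using assms(2) c by (simp add: card_insert_if)
  then show ?thesis
    by (simp only: neighbours[OF assms(1)] c Un_empty_right add_0_right split: if_split) simp
qed

lemma tree_AutD:
  assumes "g \<in> carrier (tree_Aut A)"
  shows "bij_betw g (lists A) (lists A)"
    and "\<And>u w. u \<in> lists A \<Longrightarrow> w \<in> lists A \<Longrightarrow> adjacent (g u) (g w) \<longleftrightarrow> adjacent u w"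
    and "\<And>u. u \<in> lists A \<Longrightarrow> g u \<in> lists A"
    and "g \<in> extensional (lists A)"
  using assms by (auto simp: tree_Aut_def Bij_def bij_betw_def)

lemma tree_Aut_inv:
  assumes "g \<in> carrier (tree_Aut A)"
  shows "(\<lambda>w \<in> lists A. inv_into (lists A) g w) \<in> carrier (tree_Aut A)"
proof -
  let ?k = "\<lambda>w \<in> lists A. inv_into (lists A) g w"
  note g = tree_AutD[OF assms]
  have "?k \<in> Bij (lists A)"
    using assms by (intro restrict_inv_into_Bij) (auto simp: tree_Aut_def)
  moreover have "adjacent (?k u) (?k w) \<longleftrightarrow> adjacent u w" if "u \<in> lists A" "w \<in> lists A" for u w
  proof -
    have "inv_into (lists A) g u \<in> lists A" "inv_into (lists A) g w \<in> lists A"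
      using g(1) that by (metis bij_betw_imp_surj_on inv_into_into)+
    moreover have "g (inv_into (lists A) g u) = u" "g (inv_into (lists A) g w) = w"
      using g(1) that by (auto simp: bij_betw_inv_into_right)
    ultimately show ?thesis using g(2) that by (metis restrict_apply')
  qed
  ultimately show ?thesis by (simp add: tree_Aut_def)
qed

lemma tree_Aut_root:
  assumes g: "g \<in> carrier (tree_Aut A)" and "finite A"
  shows "g [] = []"
proof -
  note g' = tree_AutD[OF g]
  have "g ` {w \<in> lists A. adjacent [] w} = {w \<in> lists A. adjacent (g []) w}"
  proof (intro equalityI subsetI)
    fix w assume w: "w \<in> {w \<in> lists A. adjacent (g []) w}"
    then have "w \<in> g ` lists A"
      using bij_betw_imp_surj_on[OF g'(1)] by simp
    then obtain v where "v \<in> lists A" "w = g v"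
      by blast
    then show "w \<in> g ` {w \<in> lists A. adjacent [] w}"
      using w g'(2)[of "[]" v] by auto
  qed (use g'(2)[of "[]"] g'(3) in auto)
  moreover have "inj_on g {w \<in> lists A. adjacent [] w}"
    using g'(1) by (auto simp: bij_betw_def inj_on_def)
  ultimately have "card {w \<in> lists A. adjacent (g []) w} = card {w \<in> lists A. adjacent [] w}"
    by (metis card_image)
  moreover have "[] \<in> lists A" "g [] \<in> lists A" using g'(3)[of "[]"] by simp_all
  ultimately show ?thesis
    using card_neighbours[OF _ \<open>finite A\<close>, of "[]"] card_neighbours[OF _ \<open>finite A\<close>, of "g []"]
    by (simp only: simp_thms if_True split: if_splits)
qed

lemma tree_Aut_child:
  assumes g: "g \<in> carrier (tree_Aut A)" and "finite A"
    and "u \<in> lists A" "x \<in> A"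
  shows "child_of (g (u @ [x])) (g u)"
  using assms(3,4)
proof (induction u arbitrary: x rule: rev_induct)
  case Nil
  have "adjacent (g []) (g [x])"
    using tree_AutD(2)[OF g, of "[]" "[x]"] Nil by (auto simp: adjacent_def child_of_def)
  then show ?case using tree_Aut_root[OF g \<open>finite A\<close>]
    by (auto simp: adjacent_def child_of_def)
next
  case (snoc y u)
  note g' = tree_AutD[OF g]
  have l: "u \<in> lists A" "u @ [y] \<in> lists A" "u @ [y, x] \<in> lists A" using snoc.prems by auto
  have "adjacent (g (u @ [y])) (g (u @ [y, x]))"
    using g'(2)[OF l(2,3)] by (auto simp: adjacent_def child_of_def)
  moreover have "child_of (g (u @ [y])) (g u)" using snoc by auto
  moreover have "g (u @ [y, x]) \<noteq> g u"
    using inj_onD[OF bij_betw_imp_inj_on[OF g'(1)] _ l(3,1)] by auto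
  ultimately show ?case by (auto simp: adjacent_def child_of_def)
qed

lemma tree_Aut_prefix:
  assumes g: "g \<in> carrier (tree_Aut A)" and "finite A"
    and "u \<in> lists A" "v \<in> lists A"
  shows "\<exists>w \<in> lists A. length w = length v \<and> g (u @ v) = g u @ w"
  using assms(4)
proof (induction v rule: rev_induct)
  case Nil
  show ?case by auto
next
  case (snoc x v)
  then obtain w where "length w = length v" "g (u @ v) = g u @ w" by auto
  moreover have "child_of (g ((u @ v) @ [x])) (g (u @ v))"
    by (rule tree_Aut_child[OF g \<open>finite A\<close>]) (use snoc.prems assms(3) in auto)
  ultimately obtain z where z: "g (u @ v @ [x]) = g u @ w @ [z]" "length w = length v"
    by (auto simp: child_of_def)
  moreover have "g (u @ v @ [x]) \<in> lists A"
    by (rule tree_AutD(3)[OF g]) (use snoc.prems assms(3) in auto)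
  ultimately show ?case by (intro bexI[of _ "w @ [z]"]) auto
qed

lemma tree_section_unique:
  assumes g: "g \<in> carrier (tree_Aut A)" and A: "finite A" and u: "u \<in> lists A"
  shows "\<exists>!h. h \<in> carrier (tree_Aut A) \<and> (\<forall>v \<in> lists A. g (u @ v) = g u @ h v)"
proof (rule ex_ex1I)
  note g' = tree_AutD[OF g]
  obtain h where h: "\<And>v. v \<in> lists A \<Longrightarrow>
      h v \<in> lists A \<and> length (h v) = length v \<and> g (u @ v) = g u @ h v"
    using tree_Aut_prefix[OF g A u] by metis
  have app: "u @ v \<in> lists A" if "v \<in> lists A" for v using u that by auto
  have "inj_on h (lists A)"
  proof (rule inj_onI)
    fix v w assume vw: "v \<in> lists A" "w \<in> lists A" "h v = h w"
    then have "g (u @ v) = g (u @ w)" using h by simp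
    then have "u @ v = u @ w"
      by (rule inj_onD[OF bij_betw_imp_inj_on[OF g'(1)] _ app[OF vw(1)] app[OF vw(2)]])
    then show "v = w" by simp
  qed
  moreover have "h ` lists A = lists A"
  proof (intro equalityI subsetI)
    fix w assume w: "w \<in> lists A"
    let ?k = "\<lambda>w \<in> lists A. inv_into (lists A) g w"
    have gu: "g u \<in> lists A" "g u @ w \<in> lists A" using g'(3)[OF u] w by auto
    have "?k (g u) = u" using u gu g'(1) by (simp add: bij_betw_inv_into_left)
    then obtain v where v: "v \<in> lists A" "?k (g u @ w) = u @ v"
      using tree_Aut_prefix[OF tree_Aut_inv[OF g] A gu(1) w] by auto
    then have "g (u @ v) = g u @ w"
      using gu g'(1) by (metis bij_betw_inv_into_right restrict_apply')
    then have "h v = w" using h[OF v(1)] by simp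
    then show "w \<in> h ` lists A" using v(1) by auto
  qed (use h in auto)
  ultimately have "restrict h (lists A) \<in> Bij (lists A)"
    by (simp add: Bij_def bij_betw_def inj_on_restrict_eq)
  moreover have "adjacent (h v) (h w) \<longleftrightarrow> adjacent v w" if "v \<in> lists A" "w \<in> lists A" for v w
    using g'(2)[OF app app, of v w] h that by (metis adjacent_append)
  ultimately have "restrict h (lists A) \<in> carrier (tree_Aut A)"
    by (simp add: tree_Aut_def)
  then show "\<exists>h. h \<in> carrier (tree_Aut A) \<and> (\<forall>v \<in> lists A. g (u @ v) = g u @ h v)"
    using h by (intro exI[of _ "restrict h (lists A)"]) auto
next
  fix h k
  assume "h \<in> carrier (tree_Aut A) \<and> (\<forall>v \<in> lists A. g (u @ v) = g u @ h v)"
    and "k \<in> carrier (tree_Aut A) \<and> (\<forall>v \<in> lists A. g (u @ v) = g u @ k v)"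
  then show "h = k"
    by (intro extensionalityI[of h "lists A" k]) (auto dest: tree_AutD(4))
qed

definition commutator_subgroup :: "('a, 'b) monoid_scheme \<Rightarrow> 'a set \<Rightarrow> 'a set \<Rightarrow> 'a set"
  where "commutator_subgroup G H K = generate G
    {inv\<^bsub>G\<^esub> h \<otimes>\<^bsub>G\<^esub> inv\<^bsub>G\<^esub> k \<otimes>\<^bsub>G\<^esub> h \<otimes>\<^bsub>G\<^esub> k | h k. h \<in> H \<and> k \<in> K}"

text \<open>Indexing starts at \<open>0\<close>: \<open>lower_central G i\<close> is the term usually written \<open>\<gamma>\<^sub>i\<^sub>+\<^sub>1(G)\<close>.\<close>

primrec lower_central :: "('a, 'b) monoid_scheme \<Rightarrow> nat \<Rightarrow> 'a set"
  where
    "lower_central G 0 = carrier G"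
  | "lower_central G (Suc i) = commutator_subgroup G (lower_central G i) (carrier G)"

definition has_nilpotency_class :: "('a, 'b) monoid_scheme \<Rightarrow> nat \<Rightarrow> bool"
  where "has_nilpotency_class G c \<longleftrightarrow>
    lower_central G c = {\<one>\<^bsub>G\<^esub>} \<and> (\<forall>i < c. lower_central G i \<noteq> {\<one>\<^bsub>G\<^esub>})"

definition maximal_class :: "nat \<Rightarrow> ('a, 'b) monoid_scheme \<Rightarrow> bool"
  where "maximal_class p G \<longleftrightarrow>
    group G \<and> (\<exists>n \<ge> 2. order G = p ^ n \<and> has_nilpotency_class G (n - 1))"

definition maximal_subgroup :: "'a set \<Rightarrow> ('a, 'b) monoid_scheme \<Rightarrow> bool"
  where "maximal_subgroup M G \<longleftrightarrow> subgroup M G \<and> M \<noteq> carrier G \<and>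
    (\<forall>H. subgroup H G \<and> M \<subseteq> H \<longrightarrow> H = M \<or> H = carrier G)"

definition elementary_abelian :: "nat \<Rightarrow> ('a, 'b) monoid_scheme \<Rightarrow> bool"
  where "elementary_abelian p G \<longleftrightarrow>
    comm_group G \<and> (\<forall>x \<in> carrier G. x [^]\<^bsub>G\<^esub> p = \<one>\<^bsub>G\<^esub>)"

definition splits_over :: "('a, 'b) monoid_scheme \<Rightarrow> 'a set \<Rightarrow> bool"
  where "splits_over G M \<longleftrightarrow>
    M \<lhd> G \<and> (\<exists>K. subgroup K G \<and> M \<inter> K = {\<one>\<^bsub>G\<^esub>} \<and> M <#>\<^bsub>G\<^esub> K = carrier G)"

end

theory Submission
  imports Defs
begin

text \<open>A nontrivial \<open>p\<close>-group \<open>G\<close> is self-similar iff it has a subgroup \<open>H\<close> of index \<open>p\<close> and a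
  homomorphism \<open>\<phi> : H \<rightarrow> G\<close> that is simple, i.e. no nontrivial normal subgroup of \<open>G\<close> inside \<open>H\<close> is
  mapped into itself. Let \<open>G\<close> be of maximal class. If \<open>G = M \<rtimes> \<langle>s\<rangle>\<close> with \<open>M\<close> elementary abelian, then
  all nontrivial normal subgroups inside \<open>M\<close> contain a common element \<open>z\<close>, and any homomorphism
  \<open>M \<rightarrow> \<langle>s\<rangle>\<close> with \<open>z \<mapsto> s\<close> is simple.

  Conversely, let \<open>\<phi> : H \<rightarrow> G\<close> be simple. Comparing \<open>\<phi>(Z(H))\<close> with \<open>Z(G)\<close> and \<open>\<phi>(H')\<close> with \<open>H'\<close>
  shows that \<open>H\<close> is both the first and the last two-step centralizer of \<open>G\<close>, hence by a theorem of
  Blackburn it is equal to all of them. So every \<open>s\<close> outside \<open>H\<close> acts uniserially and has centralizer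
  \<open>\<langle>s\<rangle> Z(G)\<close>. Since \<open>\<phi>(Z(G))\<close> is not contained in \<open>Z(G)\<close> and centralizes \<open>\<phi>(H)\<close>, which is not
  contained in \<open>H\<close>, the group \<open>\<phi>(H)\<close> is elementary abelian and contains an element of order \<open>p\<close> outside
  \<open>H\<close>; and \<open>H\<close> is elementary abelian because \<open>\<phi>\<close> kills \<open>H'\<close> and \<open>H\<^sup>p\<close>. Finally \<open>(s - 1)\<^sup>p = 0\<close> on \<open>H\<close>
  bounds the length of a uniserial action. The bound is attained by \<open>C\<^sub>p \<wr> C\<^sub>p\<close>.\<close>

section \<open>Commutators and the lower central series\<close>

text \<open>The map \<open>\<phi>\<close> gives information only at the two ends of the chain below
  \<open>H\<close>: simplicity can be tested on \<open>P (n - 1)\<close> and on \<open>H'\<close>,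
  which settles the levels \<open>n - 2\<close> and \<open>2\<close>. The centralizer of
  \<open>s\<close>, however, is \<open><s> Z(G)\<close> only if \<open>s\<close> acts uniserially on
  every level in between, and this is what Blackburn's theorem supplies. A least bad level
  \<open>q\<close> must satisfy \<open>3 \<le> q \<le> n - 3\<close>. Commutators of a sequence
  running down the chain, taken modulo \<open>P (q + 3)\<close>, force \<open>p\<close> to divide
  \<open>q / 2\<close>; if \<open>q / 2 \<ge> p\<close>, then p-th powers of commutators carry
  elements to level \<open>q\<close> and transfer good behaviour from level \<open>q - p + 1\<close>
  to level \<open>q\<close>. Hence \<open>q / 2 < p\<close>, and no such \<open>q\<close> exists.
  The link with trees is the stabilizer \<open>H\<close> of a first-level vertex with the section
  there as \<open>\<phi>\<close>. A p-group fixing one of \<open>p\<close> vertices fixes them all,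
  so \<open>H\<close> is normal of index \<open>p\<close>. The exponent in the bound comes from the
  binomial expansion of \<open>(1 + \<delta>)^p\<close>, whose middle terms vanish in exponent
  \<open>p\<close>.\<close>

definition cmt :: "('a, 'b) monoid_scheme \<Rightarrow> 'a \<Rightarrow> 'a \<Rightarrow> 'a"
  where "cmt G x y = inv\<^bsub>G\<^esub> x \<otimes>\<^bsub>G\<^esub> inv\<^bsub>G\<^esub> y \<otimes>\<^bsub>G\<^esub> x \<otimes>\<^bsub>G\<^esub> y"

text \<open>Encodes \<open>[A, B] \<le> N\<close> through elements, so that \<open>A\<close> and
  \<open>B\<close> may be singletons or mere sets of generators.\<close>

definition com_in :: "('a, 'b) monoid_scheme \<Rightarrow> 'a set \<Rightarrow> 'a set \<Rightarrow> 'a set \<Rightarrow> bool"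
  where "com_in G A B N \<longleftrightarrow> (\<forall>a\<in>A. \<forall>b\<in>B. cmt G a b \<in> N)"

text \<open>For normal \<open>N\<close> this is the preimage of the centralizer of
  \<open>B N / N\<close> in \<open>G / N\<close>. Being a subgroup, it reduces a statement
  \<open>com_in\<close> to generators of the left argument.\<close>

definition centr_mod :: "('a, 'b) monoid_scheme \<Rightarrow> 'a set \<Rightarrow> 'a set \<Rightarrow> 'a set"
  where "centr_mod G B N = {x \<in> carrier G. \<forall>b\<in>B. cmt G x b \<in> N}"

context group
begin

lemma inv_mult_cancel [simp]:
  assumes "x \<in> carrier G" "y \<in> carrier G"
  shows "inv x \<otimes> (x \<otimes> y) = y" "x \<otimes> (inv x \<otimes> y) = y"
  using assms by (simp_all add: m_assoc[symmetric])

lemma cmt_closed [simp, intro]: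
  "x \<in> carrier G \<Longrightarrow> y \<in> carrier G \<Longrightarrow> cmt G x y \<in> carrier G"
  by (simp add: cmt_def)

lemma inv_cmt:
  "x \<in> carrier G \<Longrightarrow> y \<in> carrier G \<Longrightarrow> inv (cmt G x y) = cmt G y x"
  by (simp add: cmt_def inv_mult_group m_assoc)

lemma cmt_eq_one_iff:
  assumes "x \<in> carrier G" "y \<in> carrier G"
  shows "cmt G x y = \<one> \<longleftrightarrow> x \<otimes> y = y \<otimes> x"
proof -
  have "y \<otimes> x \<otimes> cmt G x y = x \<otimes> y"
    using assms by (simp add: cmt_def m_assoc)
  moreover have "y \<otimes> x \<otimes> cmt G x y = y \<otimes> x \<otimes> \<one> \<longleftrightarrow> cmt G x y = \<one>"
    using assms Units_l_cancel[of "y \<otimes> x" "cmt G x y" \<one>] by simp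
  ultimately show ?thesis using assms by auto
qed

lemma cmt_self [simp]: "x \<in> carrier G \<Longrightarrow> cmt G x x = \<one>"
  by (simp add: cmt_eq_one_iff)

lemma cmt_one [simp]:
  "x \<in> carrier G \<Longrightarrow> cmt G x \<one> = \<one>" "x \<in> carrier G \<Longrightarrow> cmt G \<one> x = \<one>"
  by (simp_all add: cmt_eq_one_iff)

lemma conj_eq_cmt:
  "x \<in> carrier G \<Longrightarrow> y \<in> carrier G \<Longrightarrow> inv y \<otimes> x \<otimes> y = x \<otimes> cmt G x y"
  by (simp add: cmt_def m_assoc)

lemma cmt_mult_left:
  assumes "x \<in> carrier G" "y \<in> carrier G" "z \<in> carrier G"
  shows "cmt G (x \<otimes> y) z = inv y \<otimes> cmt G x z \<otimes> y \<otimes> cmt G y z"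
  using assms by (simp add: cmt_def m_assoc inv_mult_group)

lemma cmt_mult_right:
  assumes "x \<in> carrier G" "y \<in> carrier G" "z \<in> carrier G"
  shows "cmt G x (y \<otimes> z) = cmt G x z \<otimes> (inv z \<otimes> cmt G x y \<otimes> z)"
  using assms by (simp add: cmt_def m_assoc inv_mult_group)

lemma cmt_inv_left:
  assumes "x \<in> carrier G" "z \<in> carrier G"
  shows "cmt G (inv x) z = x \<otimes> inv (cmt G x z) \<otimes> inv x"
  using assms by (simp add: cmt_def m_assoc inv_mult_group)

lemma conj_cmt:
  assumes "x \<in> carrier G" "y \<in> carrier G" "g \<in> carrier G"
  shows "g \<otimes> cmt G x y \<otimes> inv g = cmt G (g \<otimes> x \<otimes> inv g) (g \<otimes> y \<otimes> inv g)"
  using assms by (simp add: cmt_def m_assoc inv_mult_group)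

lemma Hall_Witt:
  assumes "x \<in> carrier G" "y \<in> carrier G" "z \<in> carrier G"
  shows "(inv y \<otimes> cmt G (cmt G x (inv y)) z \<otimes> y) \<otimes> (inv z \<otimes> cmt G (cmt G y (inv z)) x \<otimes> z)
    \<otimes> (inv x \<otimes> cmt G (cmt G z (inv x)) y \<otimes> x) = \<one>"
  using assms by (simp add: cmt_def m_assoc inv_mult_group)

lemma normal_conj:
  assumes "N \<lhd> G" "x \<in> N" "g \<in> carrier G"
  shows "inv g \<otimes> x \<otimes> g \<in> N" "g \<otimes> x \<otimes> inv g \<in> N"
  using assms normal.inv_op_closed1 normal.inv_op_closed2 by metis+

lemma normal_subset: "N \<lhd> G \<Longrightarrow> N \<subseteq> carrier G"
  by (simp add: normal_imp_subgroup subgroup.subset)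

lemma centr_mod_subgroup:
  assumes N: "N \<lhd> G" and B: "B \<subseteq> carrier G"
  shows "subgroup (centr_mod G B N) G"
proof (rule subgroupI)
  note sub = normal_imp_subgroup[OF N]
  show "centr_mod G B N \<subseteq> carrier G" by (auto simp: centr_mod_def)
  have "\<one> \<in> centr_mod G B N"
    using B sub by (auto simp: centr_mod_def subgroup.one_closed subset_iff)
  then show "centr_mod G B N \<noteq> {}" by auto
  show "inv x \<in> centr_mod G B N" if "x \<in> centr_mod G B N" for x
    using that B N sub normal_conj(2) subgroup.m_inv_closed
    by (fastforce simp: centr_mod_def cmt_inv_left subset_iff)
  show "x \<otimes> y \<in> centr_mod G B N" if "x \<in> centr_mod G B N" "y \<in> centr_mod G B N" for x y
    using that B N sub normal_conj(1) subgroup.m_closed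
    by (fastforce simp: centr_mod_def cmt_mult_left subset_iff)
qed

lemma centr_mod_subset_iff:
  "A \<subseteq> centr_mod G B N \<longleftrightarrow> A \<subseteq> carrier G \<and> com_in G A B N"
  by (auto simp: centr_mod_def com_in_def)

lemma com_in_sym:
  assumes "com_in G A B N" "subgroup N G" "A \<subseteq> carrier G" "B \<subseteq> carrier G"
  shows "com_in G B A N"
  using assms unfolding com_in_def by (metis inv_cmt subgroup.m_inv_closed subsetD)

lemma com_in_mono:
  "com_in G A B N \<Longrightarrow> A' \<subseteq> A \<Longrightarrow> B' \<subseteq> B \<Longrightarrow> N \<subseteq> N' \<Longrightarrow> com_in G A' B' N'"
  unfolding com_in_def by blast

lemma com_in_normal:
  assumes "N \<lhd> G"
  shows "com_in G N (carrier G) N" "com_in G (carrier G) N N"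
proof -
  note sub = normal_imp_subgroup[OF assms]
  show *: "com_in G N (carrier G) N"
    unfolding com_in_def
  proof (intro ballI)
    fix a b assume ab: "a \<in> N" "b \<in> carrier G"
    then have "inv a \<otimes> (inv b \<otimes> a \<otimes> b) \<in> N"
      using assms sub by (intro subgroup.m_closed subgroup.m_inv_closed normal_conj(1))
    then show "cmt G a b \<in> N"
      using ab subgroup.mem_carrier[OF sub] by (simp add: cmt_def m_assoc)
  qed
  show "com_in G (carrier G) N N"
    by (rule com_in_sym[OF * sub]) (use sub in \<open>auto simp: subgroup.subset\<close>)
qed

section \<open>Commutator subgroups and the three subgroups lemma\<close>

lemma commutator_subgroup_alt:
  "commutator_subgroup G A B = generate G {cmt G a b | a b. a \<in> A \<and> b \<in> B}"
  by (simp add: commutator_subgroup_def cmt_def)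

lemma commutator_subgroup_subset_iff:
  assumes "A \<subseteq> carrier G" "B \<subseteq> carrier G" "subgroup N G"
  shows "commutator_subgroup G A B \<subseteq> N \<longleftrightarrow> com_in G A B N"
proof
  assume "commutator_subgroup G A B \<subseteq> N"
  then show "com_in G A B N"
    unfolding commutator_subgroup_alt com_in_def using generate.incl[of _ "{cmt G a b |a b. a \<in> A \<and> b \<in> B}" G] by blast
next
  assume "com_in G A B N"
  then show "commutator_subgroup G A B \<subseteq> N"
    unfolding commutator_subgroup_alt com_in_def
    by (intro generate_subgroup_incl[OF _ assms(3)]) auto
qed

lemma cmt_in_commutator_subgroup:
  "a \<in> A \<Longrightarrow> b \<in> B \<Longrightarrow> cmt G a b \<in> commutator_subgroup G A B"
  unfolding commutator_subgroup_alt by (rule generate.incl) auto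

lemma commutator_subgroup_normal:
  assumes "A \<lhd> G" "B \<lhd> G"
  shows "commutator_subgroup G A B \<lhd> G"
  unfolding commutator_subgroup_alt
proof (rule normal_generateI)
  show "{cmt G a b |a b. a \<in> A \<and> b \<in> B} \<subseteq> carrier G"
    using assms[THEN normal_subset] by auto
  show "g \<otimes> h \<otimes> inv g \<in> {cmt G a b |a b. a \<in> A \<and> b \<in> B}"
    if h: "h \<in> {cmt G a b |a b. a \<in> A \<and> b \<in> B}" and g: "g \<in> carrier G" for h g
  proof -
    obtain a b where ab: "h = cmt G a b" "a \<in> A" "b \<in> B"
      using h by auto
    then have "g \<otimes> h \<otimes> inv g = cmt G (g \<otimes> a \<otimes> inv g) (g \<otimes> b \<otimes> inv g)"
      using g conj_cmt[of a b g] assms[THEN normal_subset] by auto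
    moreover have "g \<otimes> a \<otimes> inv g \<in> A" "g \<otimes> b \<otimes> inv g \<in> B"
      using g ab assms[THEN normal_conj(2)] by auto
    ultimately show ?thesis by blast
  qed
qed

text \<open>In the Hall-Witt identity for \<open>inv a\<close>, \<open>b\<close>, \<open>c\<close>
  two of the three factors lie in \<open>N\<close>, hence so does the third. \<open>D\<close> and
  \<open>E\<close> are arbitrary bounds for \<open>[A, B]\<close> and \<open>[B, C]\<close>.\<close>

lemma three_subgroups:
  assumes N: "N \<lhd> G" and A: "subgroup A G" and B: "subgroup B G" and C: "subgroup C G"
    and "com_in G A B D" "com_in G D C N" "com_in G B C E" "com_in G E A N"
  shows "com_in G (commutator_subgroup G C A) B N"
proof -
  have sub: "A \<subseteq> carrier G" "B \<subseteq> carrier G" "C \<subseteq> carrier G"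
    using A B C by (auto simp: subgroup.subset)
  have "com_in G C A (centr_mod G B N)"
    unfolding com_in_def
  proof (intro ballI)
    fix c a assume ca: "c \<in> C" "a \<in> A"
    have "cmt G (cmt G c a) b \<in> N" if b: "b \<in> B" for b
    proof -
      have mem: "inv b \<in> B" "inv c \<in> C" "inv a \<in> A"
        using A B C ca b by (auto simp: subgroup.m_inv_closed)
      have cl: "a \<in> carrier G" "b \<in> carrier G" "c \<in> carrier G"
        using sub ca b by auto
      let ?u = "inv b \<otimes> cmt G (cmt G (inv a) (inv b)) c \<otimes> b"
      let ?v = "inv c \<otimes> cmt G (cmt G b (inv c)) (inv a) \<otimes> c"
      let ?w = "inv (inv a) \<otimes> cmt G (cmt G c (inv (inv a))) b \<otimes> inv a"
      have "cmt G (cmt G (inv a) (inv b)) c \<in> N" "cmt G (cmt G b (inv c)) (inv a) \<in> N"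
        using assms(5-8) mem ca b by (auto simp: com_in_def)
      then have uv: "?u \<otimes> ?v \<in> N"
        using cl by (intro subgroup.m_closed[OF normal_imp_subgroup[OF N]] normal_conj(1)[OF N])
      have "?u \<otimes> ?v \<otimes> ?w = \<one>"
        using cl by (intro Hall_Witt) auto
      then have "?w = inv (?u \<otimes> ?v)"
        using cl by (metis cmt_closed inv_closed inv_comm inv_equality m_closed)
      then have "?w \<in> N"
        using uv normal_imp_subgroup[OF N] by (simp add: subgroup.m_inv_closed)
      then have "inv a \<otimes> ?w \<otimes> a \<in> N"
        using normal_conj(1)[OF N] cl by blast
      moreover have "inv a \<otimes> ?w \<otimes> a = cmt G (cmt G c a) b"
        using cl by (simp add: m_assoc)
      ultimately show ?thesis by simp
    qed
    then show "cmt G c a \<in> centr_mod G B N"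
      using ca sub by (auto simp: centr_mod_def)
  qed
  then show ?thesis
    using commutator_subgroup_subset_iff[OF sub(3,1) centr_mod_subgroup[OF N sub(2)]]
    by (simp add: centr_mod_subset_iff)
qed

lemma lower_central_normal: "lower_central G i \<lhd> G"
  by (induction i) (auto intro: normal_self commutator_subgroup_normal)

lemma lower_central_subgroup: "subgroup (lower_central G i) G"
  by (simp add: lower_central_normal normal_imp_subgroup)

lemma lower_central_Suc_subset: "lower_central G (Suc i) \<subseteq> lower_central G i"
  using com_in_normal(1)[OF lower_central_normal]
  by (simp add: commutator_subgroup_subset_iff lower_central_subgroup subgroup.subset)

lemma lower_central_antimono: "i \<le> j \<Longrightarrow> lower_central G j \<subseteq> lower_central G i"
  by (rule lift_Suc_antimono_le) (use lower_central_Suc_subset in auto)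

end

lemma (in group_hom) hom_cmt:
  "x \<in> carrier G \<Longrightarrow> y \<in> carrier G \<Longrightarrow> h (cmt G x y) = cmt H (h x) (h y)"
  by (simp add: cmt_def)

lemma (in group_hom) commutator_subgroup_img:
  assumes "A \<subseteq> carrier G" "B \<subseteq> carrier G"
  shows "h ` commutator_subgroup G A B = commutator_subgroup H (h ` A) (h ` B)"
proof -
  have "h ` {cmt G a b |a b. a \<in> A \<and> b \<in> B} = {cmt H a b |a b. a \<in> h ` A \<and> b \<in> h ` B}" (is "?L = ?R")
  proof (intro equalityI subsetI)
    fix x assume "x \<in> ?L"
    then obtain a b where "x = h (cmt G a b)" "a \<in> A" "b \<in> B" by auto
    moreover from this have "x = cmt H (h a) (h b)" using assms hom_cmt by auto
    ultimately show "x \<in> ?R" by blast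
  next
    fix x assume "x \<in> ?R"
    then obtain a b where "x = cmt H (h a) (h b)" and ab: "a \<in> A" "b \<in> B" by auto
    then have "x = h (cmt G a b)" using assms hom_cmt[of a b] by (simp add: subset_iff)
    then show "x \<in> ?L" using ab by blast
  qed
  then show ?thesis
    unfolding G.commutator_subgroup_alt H.commutator_subgroup_alt
    by (subst generate_img[symmetric]) (use assms in auto)
qed

lemma (in group_hom) lower_central_img:
  assumes "h ` carrier G = carrier H"
  shows "h ` lower_central G i = lower_central H i"
  by (induction i) (simp_all add: assms commutator_subgroup_img G.lower_central_subgroup subgroup.subset)

section \<open>Chains of subgroups in groups of maximal class\<close>

context group
begin

lemma card_subgroup_dvd:
  assumes "subgroup A G" "subgroup B G" "A \<subseteq> B"
  shows "card A dvd card B"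
proof -
  interpret B: group "G\<lparr>carrier := B\<rparr>"
    using assms(2) by (rule subgroup_imp_group)
  have "subgroup A (G\<lparr>carrier := B\<rparr>)"
    using assms by (simp add: subgroup_incl)
  then show ?thesis
    using B.lagrange[of A] by (simp add: order_def dvd_def) (metis mult.commute)
qed

text \<open>By Lagrange nothing lies strictly between \<open>A\<close> and \<open>B\<close>, so
  \<open>K \<inter> B\<close>, which is larger than \<open>A\<close>, is all of \<open>B\<close>.
  This turns a claim about \<open>B\<close> into one about \<open>A\<close> and a single further
  element.\<close>

lemma subset_of_prime_index:
  assumes p: "Factorial_Ring.prime (p::nat)" and A: "subgroup A G" and B: "subgroup B G" "finite B"
    and card: "card B = p * card A" and K: "subgroup K G" "A \<subseteq> K"
    and AB: "A \<subseteq> B" and x: "x \<in> B" "x \<notin> A" "x \<in> K"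
  shows "B \<subseteq> K"
proof -
  have sub: "subgroup (K \<inter> B) G"
    using K(1) B(1) by (rule subgroups_Inter_pair)
  obtain k where k: "card (K \<inter> B) = card A * k"
    using card_subgroup_dvd[OF A sub] K AB by (auto simp: dvd_def)
  have "card (K \<inter> B) dvd card B"
    by (rule card_subgroup_dvd[OF sub B(1)]) auto
  moreover have A0: "card A > 0"
    using A B AB by (metis card_gt_0_iff empty_iff finite_subset subgroup.one_closed)
  ultimately have "k dvd p"
    using card k by (simp add: mult.commute)
  then have "k = 1 \<or> k = p"
    using p prime_nat_iff by auto
  moreover have "card A < card (K \<inter> B)"
    using x K AB B by (intro psubset_card_mono) auto
  ultimately have "card (K \<inter> B) = card B"
    using k card by auto
  then have "K \<inter> B = B"
    using B(2) by (intro card_subset_eq) auto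
  then show ?thesis by auto
qed

text \<open>Modulo \<open>[A, G]\<close> the subgroup \<open>A\<close> is central with quotient of
  order \<open>p\<close>, hence cyclic, and a group that is cyclic modulo a central subgroup is
  abelian.\<close>

lemma commutator_subgroup_prime_index:
  assumes p: "Factorial_Ring.prime (p::nat)" and A: "A \<lhd> G" and fin: "finite (carrier G)"
    and card: "order G = p * card A"
  shows "commutator_subgroup G (carrier G) (carrier G) \<subseteq> commutator_subgroup G A (carrier G)"
    (is "_ \<subseteq> ?N")
proof -
  note As = normal_imp_subgroup[OF A]
  note Ac = subgroup.subset[OF As]
  have N: "?N \<lhd> G" using A by (intro commutator_subgroup_normal normal_self)
  have AN: "com_in G A (carrier G) ?N"
    by (auto simp: com_in_def cmt_in_commutator_subgroup)
  have "card A > 0"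
    using As fin Ac by (metis card_gt_0_iff empty_iff finite_subset subgroup.one_closed)
  then have "card A < card (carrier G)"
    using card prime_gt_1_nat[OF p] by (simp add: order_def)
  then obtain s where s: "s \<in> carrier G" "s \<notin> A"
    using Ac by (metis nat_less_le subsetI subset_antisym)
  have top: "carrier G \<subseteq> K" if "subgroup K G" "A \<subseteq> K" "s \<in> K" for K
    by (rule subset_of_prime_index[OF p As subgroup_self fin _ that(1,2) Ac s that(3)])
       (use card in \<open>simp add: order_def\<close>)
  have "carrier G \<subseteq> centr_mod G {s} ?N"
  proof (rule top)
    show "subgroup (centr_mod G {s} ?N) G" using s by (intro centr_mod_subgroup N) auto
    show "A \<subseteq> centr_mod G {s} ?N"
      using Ac AN s by (auto simp: centr_mod_def com_in_def)
    show "s \<in> centr_mod G {s} ?N"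
      using s normal_imp_subgroup[OF N] by (simp add: centr_mod_def subgroup.one_closed)
  qed
  then have "com_in G (carrier G) {s} ?N" by (simp add: centr_mod_subset_iff)
  then have sN: "com_in G {s} (carrier G) ?N"
    by (rule com_in_sym) (use s normal_imp_subgroup[OF N] in auto)
  have "carrier G \<subseteq> centr_mod G (carrier G) ?N"
  proof (rule top)
    show "subgroup (centr_mod G (carrier G) ?N) G" by (intro centr_mod_subgroup N) auto
  qed (use Ac AN sN s in \<open>auto simp: centr_mod_def com_in_def\<close>)
  then have "com_in G (carrier G) (carrier G) ?N" by (simp add: centr_mod_subset_iff)
  then show ?thesis
    using commutator_subgroup_subset_iff normal_imp_subgroup[OF N] by simp
qed

text \<open>The exponents \<open>e i\<close> fall strictly from \<open>n\<close> to \<open>0\<close>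
  in \<open>n - 1\<close> steps, so exactly one step drops by 2 and the others by 1. The first step
  is the large one: a derived subgroup of index \<open>p\<close> would already equal the next
  term.\<close>

lemma card_lower_central:
  assumes p: "Factorial_Ring.prime (p::nat)" and ord: "order G = p ^ n" and n: "n \<ge> 2"
    and cl: "has_nilpotency_class G (n - 1)" and i: "1 \<le> i"
  shows "card (lower_central G i) = p ^ (n - 1 - i)"
proof -
  let ?L = "lower_central G"
  have p1: "p > 1" using p by (rule prime_gt_1_nat)
  have fin: "finite (carrier G)"
    using ord p1 by (metis order_gt_0_iff_finite zero_less_power le_less_trans zero_le)
  have finL: "finite (?L i)" for i
    using fin subgroup.subset[OF lower_central_subgroup] by (rule rev_finite_subset)
  have "\<exists>e. card (?L i) = p ^ e" for i
    using card_subgroup_dvd[OF lower_central_subgroup[of i] subgroup_self] ord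
      subgroup.subset[OF lower_central_subgroup] divides_primepow_nat[OF p] by (auto simp: order_def)
  then obtain e where e: "\<And>i. card (?L i) = p ^ e i" by metis
  have e0: "e 0 = n" using e[of 0] ord p1 by (simp add: order_def)
  have top: "?L (n - 1) = {\<one>}" and nontriv: "\<And>i. i < n - 1 \<Longrightarrow> ?L i \<noteq> {\<one>}"
    using cl by (auto simp: has_nilpotency_class_def)
  have strict: "?L (Suc i) \<subset> ?L i" if "i < n - 1" for i
  proof (rule ccontr)
    assume "\<not> ?thesis"
    then have eq: "?L (Suc i) = ?L i" using lower_central_Suc_subset by blast
    have "?L (i + k) = ?L i" for k
      by (induction k) (use eq in simp_all)
    then have "?L i = {\<one>}" using top that by (metis le_add_diff_inverse less_imp_le_nat)
    then show False using nontriv that by blast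
  qed
  have dec: "e (Suc i) < e i" if "i < n - 1" for i
  proof -
    have "p ^ e (Suc i) < p ^ e i"
      using psubset_card_mono[OF finL strict[OF that]] by (simp only: e)
    then show ?thesis using p1 by simp
  qed
  have lower: "n - 1 - i \<le> e i" if "i \<le> n - 1" for i
    using that
  proof (induction "n - 1 - i" arbitrary: i)
    case 0
    then show ?case by simp
  next
    case (Suc k)
    then have "n - 1 - Suc i \<le> e (Suc i)" by (intro Suc(1)) auto
    moreover have "e (Suc i) < e i" using Suc(2) by (intro dec) simp
    ultimately show ?case by linarith
  qed
  have e1: "e 1 \<le> n - 2"
  proof (cases "n = 2")
    case True
    then have "card (?L 1) = 1" using top by simp
    then have "p ^ e 1 = 1" by (simp only: e)
    then have "e 1 = 0" using p1 by (metis less_irrefl one_less_power gr0I)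
    then show ?thesis by simp
  next
    case False
    show ?thesis
    proof (rule ccontr)
      \<comment> \<open>Index \<open>p\<close> would make \<open>lower_central G 1\<close> equal to
        \<open>lower_central G 2\<close>, against strictness.\<close>
      assume "\<not> ?thesis"
      then have "e 1 = n - 1" using dec[of 0] e0 n by simp
      then have "order G = p * card (?L 1)"
        using e[of 1] ord n by (simp add: power_eq_if)
      then have "?L 1 \<subseteq> ?L 2"
        using commutator_subgroup_prime_index[OF p lower_central_normal[of 1] fin]
        by (simp add: numeral_2_eq_2)
      moreover have "1 < n - 1" using False n by arith
      ultimately show False using strict[of 1] by (auto simp: numeral_2_eq_2)
    qed
  qed
  have upper: "e (Suc i) \<le> n - 1 - Suc i" if "Suc i \<le> n - 1" for i
    using that
  proof (induction i)
    case 0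
    then show ?case using e1 by simp
  next
    case (Suc i)
    then show ?case using dec[of "Suc i"] by simp
  qed
  show ?thesis
  proof (cases "i \<le> n - 1")
    case True
    then obtain j where "i = Suc j" using i by (cases i) auto
    then have "e i = n - 1 - i" using lower[of i] upper[of j] True by simp
    then show ?thesis using e by simp
  next
    case False
    then have "?L i \<subseteq> {\<one>}" using lower_central_antimono[of "n - 1" i] top by simp
    then have "?L i = {\<one>}" using subgroup.one_closed[OF lower_central_subgroup] by blast
    then show ?thesis using False by simp
  qed
qed

end

text \<open>\<open>P 1\<close> is a maximal subgroup and \<open>P i\<close> is \<open>\<gamma>\<^sub>i(G)\<close> for \<open>i \<ge> 2\<close>; \<open>P 0\<close> has no meaning.\<close>

locale pchain = group G for G (structure) +
  fixes p n :: nat and P :: "nat \<Rightarrow> 'a set"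
  assumes prime_p: "Factorial_Ring.prime p"
    and order_G: "order G = p ^ n" and n_pos: "n \<ge> 1"
    and P_normal: "i \<ge> 1 \<Longrightarrow> P i \<lhd> G"
    and P_Suc: "i \<ge> 1 \<Longrightarrow> P (Suc i) = commutator_subgroup G (P i) (carrier G)"
    and card_P: "i \<ge> 1 \<Longrightarrow> card (P i) = p ^ (n - i)"
begin

lemma p_gt_1: "p > 1"
  using prime_p by (rule prime_gt_1_nat)

lemma fin: "finite (carrier G)"
  using order_G p_gt_1 by (metis order_gt_0_iff_finite zero_less_power le_less_trans zero_le)

lemma P_subgroup: "i \<ge> 1 \<Longrightarrow> subgroup (P i) G"
  by (simp add: P_normal normal_imp_subgroup)

lemma P_carrier: "i \<ge> 1 \<Longrightarrow> P i \<subseteq> carrier G"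
  by (simp add: P_subgroup subgroup.subset)

lemma P_in_carrier: "i \<ge> 1 \<Longrightarrow> x \<in> P i \<Longrightarrow> x \<in> carrier G"
  using P_carrier by blast

lemma P_finite: "i \<ge> 1 \<Longrightarrow> finite (P i)"
  using fin P_carrier by (rule rev_finite_subset)

lemma com_in_P_carrier: "i \<ge> 1 \<Longrightarrow> com_in G (P i) (carrier G) (P (Suc i))"
  by (auto simp: com_in_def P_Suc cmt_in_commutator_subgroup)

lemma com_in_carrier_P: "i \<ge> 1 \<Longrightarrow> com_in G (carrier G) (P i) (P (Suc i))"
  by (intro com_in_sym[OF com_in_P_carrier]) (auto simp: P_subgroup P_in_carrier)

lemma cmt_P: "i \<ge> 1 \<Longrightarrow> x \<in> P i \<Longrightarrow> g \<in> carrier G \<Longrightarrow> cmt G x g \<in> P (Suc i)"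
  using com_in_P_carrier by (simp add: com_in_def)

lemma P_Suc_subset: "i \<ge> 1 \<Longrightarrow> P (Suc i) \<subseteq> P i"
  by (simp add: P_Suc commutator_subgroup_subset_iff P_subgroup P_carrier com_in_normal P_normal)

lemma P_antimono:
  assumes "1 \<le> i" "i \<le> j"
  shows "P j \<subseteq> P i"
  using assms(2)
proof (induction rule: dec_induct)
  case (step j)
  then show ?case using P_Suc_subset[of j] assms(1) by auto
qed simp

lemma P_trivial: "i \<ge> n \<Longrightarrow> P i = {\<one>}"
proof -
  assume i: "i \<ge> n"
  then have "i \<ge> 1" using n_pos by simp
  then have "card (P i) = 1" "\<one> \<in> P i"
    using card_P[of i] i subgroup.one_closed[OF P_subgroup[of i]] by auto
  then show ?thesis by (metis card_1_singletonE singletonD)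
qed

text \<open>\<open>P i / P (i + 1)\<close> has order \<open>p\<close>, so \<open>x\<close> together
  with \<open>P (i + 1)\<close> generates \<open>P i\<close>. For \<open>i \<ge> n\<close> both
  terms are trivial and no such \<open>x\<close> exists.\<close>

lemma P_le_if_new:
  assumes "1 \<le> i" "x \<in> P i" "x \<notin> P (Suc i)" "subgroup K G" "P (Suc i) \<subseteq> K" "x \<in> K"
  shows "P i \<subseteq> K"
proof (cases "i < n")
  case True
  then have "card (P i) = p * card (P (Suc i))"
    using assms(1) by (simp add: card_P Suc_diff_Suc flip: power_Suc)
  then show ?thesis
    using assms P_subgroup P_finite P_Suc_subset
    by (intro subset_of_prime_index[OF prime_p, of "P (Suc i)" "P i" K x]) auto
next
  case False
  then show ?thesis using assms subgroup.one_closed[OF P_subgroup] P_trivial by auto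
qed

lemma carrier_if_new:
  assumes "x \<in> carrier G" "x \<notin> P 1" "subgroup K G" "P 1 \<subseteq> K" "x \<in> K"
  shows "K = carrier G"
proof -
  have "card (carrier G) = p * card (P 1)"
    using n_pos order_G card_P[of 1] by (simp add: order_def power_eq_if)
  then have "carrier G \<subseteq> K"
    using assms P_subgroup[of 1] fin P_carrier subgroup_self
    by (intro subset_of_prime_index[OF prime_p, of "P 1" "carrier G" K x]) auto
  then show ?thesis using subgroup.subset[OF assms(3)] by auto
qed

lemma P_new: "1 \<le> i \<Longrightarrow> i < n \<Longrightarrow> \<exists>x \<in> P i. x \<notin> P (Suc i)"
proof -
  assume i: "1 \<le> i" "i < n"
  then have "card (P (Suc i)) < card (P i)"
    using p_gt_1 by (simp add: card_P)
  then show ?thesis by (metis card_mono P_finite i(1) le_SucI not_less subsetI)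
qed

lemma carrier_new: "\<exists>x \<in> carrier G. x \<notin> P 1"
proof -
  have "card (P 1) < card (carrier G)"
    using p_gt_1 n_pos card_P[of 1] order_G by (simp add: order_def)
  then show ?thesis using P_carrier[of 1] by (metis card_mono P_finite le_refl not_less subsetI)
qed

lemma com_in_new:
  assumes "1 \<le> i" "x \<in> P i" "x \<notin> P (Suc i)" "N \<lhd> G" "B \<subseteq> carrier G"
    and "com_in G (P (Suc i)) B N" "com_in G {x} B N"
  shows "com_in G (P i) B N"
proof -
  have "P i \<subseteq> centr_mod G B N"
    using assms centr_mod_subgroup[OF assms(4,5)] P_carrier[of "Suc i"] P_in_carrier
    by (intro P_le_if_new[OF assms(1-3)]) (auto simp: centr_mod_def com_in_def)
  then show ?thesis by (simp add: centr_mod_subset_iff)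
qed

lemma com_in_top:
  assumes "x \<in> carrier G" "x \<notin> P 1" "N \<lhd> G" "B \<subseteq> carrier G"
    and "com_in G (P 1) B N" "com_in G {x} B N"
  shows "com_in G (carrier G) B N"
proof -
  have "centr_mod G B N = carrier G"
    using assms centr_mod_subgroup[OF assms(3,4)] P_carrier[of 1]
    by (intro carrier_if_new[OF assms(1,2)]) (auto simp: centr_mod_def com_in_def)
  then show ?thesis using centr_mod_subset_iff[of "carrier G" B N] by simp
qed

text \<open>\<open>P i\<close> is cyclic modulo \<open>P (i + 1)\<close>, and its generator commutes
  with itself, so only commutators with \<open>P (i + 1)\<close> matter.\<close>

lemma com_in_self:
  assumes "1 \<le> i" "N \<lhd> G" "com_in G (P i) (P (Suc i)) N"
  shows "com_in G (P i) (P i) N"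
proof (cases "i < n")
  case True
  then obtain x where x: "x \<in> P i" "x \<notin> P (Suc i)" using P_new assms by blast
  note Ns = normal_imp_subgroup[OF assms(2)]
  have xc: "x \<in> carrier G" using x assms P_in_carrier by blast
  have 1: "com_in G (P (Suc i)) (P i) N"
    by (rule com_in_sym[OF assms(3) Ns]) (use assms P_in_carrier in auto)
  have "com_in G {x} {x} N" using xc Ns by (simp add: com_in_def subgroup.one_closed)
  moreover have "com_in G (P (Suc i)) {x} N"
    using 1 x by (auto simp: com_in_def)
  ultimately have "com_in G (P i) {x} N"
    using com_in_new[OF assms(1) x assms(2), of "{x}"] xc by simp
  then have "com_in G {x} (P i) N"
    by (rule com_in_sym[OF _ Ns]) (use assms P_in_carrier xc in auto)
  then show ?thesis
    using com_in_new[OF assms(1) x assms(2), of "P i"] 1 assms P_carrier by simp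
next
  case False
  then have "P i = {\<one>}" using P_trivial by simp
  then show ?thesis using normal_imp_subgroup[OF assms(2)]
    by (simp add: com_in_def subgroup.one_closed)
qed

lemma com_in_P1_P1: "com_in G (P 1) (P 1) (P 3)"
proof (rule com_in_self)
  have "com_in G (P 1) (P 2) (P 3)"
    using com_in_carrier_P[of 2] P_carrier[of 1] by (auto simp: com_in_def numeral_3_eq_3)
  then show "com_in G (P 1) (P (Suc 1)) (P 3)" by (simp add: numeral_2_eq_2)
qed (auto intro: P_normal)

lemma not_com_in_P_carrier:
  assumes "1 \<le> i" "i + 2 \<le> n"
  shows "\<not> com_in G (P i) (carrier G) (P (i + 2))"
proof
  assume "com_in G (P i) (carrier G) (P (i + 2))"
  then have "P (Suc i) \<subseteq> P (i + 2)"
    using assms by (simp add: P_Suc[of i] commutator_subgroup_subset_iff P_subgroup P_carrier)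
  then show False using P_new[of "Suc i"] assms by auto
qed

text \<open>An element that is new at level \<open>i\<close> has a commutator that is new at level
  \<open>i + 1\<close>: otherwise \<open>[P i, G]\<close> would lie in \<open>P (i + 2)\<close>. So
  the induction runs from the bottom of the chain upwards, and normal subgroups inside
  \<open>P 1\<close> are terms of the chain.\<close>

lemma normal_contains_P:
  assumes "K \<lhd> G" "x \<in> K" "x \<in> P i" "x \<notin> P (Suc i)" "1 \<le> i"
  shows "P i \<subseteq> K"
  using assms(2-5)
proof (induction "n - i" arbitrary: i x)
  case 0
  then show ?case using P_trivial[of i] P_trivial[of "Suc i"] by simp
next
  case (Suc k)
  have "P (Suc i) \<subseteq> K"
  proof (cases "i + 2 \<le> n")
    case True
    have "\<exists>g \<in> carrier G. cmt G x g \<notin> P (i + 2)"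
    proof (rule ccontr)
      assume "\<not> ?thesis"
      then have "com_in G {x} (carrier G) (P (i + 2))" by (auto simp: com_in_def)
      then have "com_in G (P i) (carrier G) (P (i + 2))"
        using Suc com_in_P_carrier[of "Suc i"]
        by (intro com_in_new[of i x "P (i + 2)"]) (auto intro: P_normal)
      then show False using not_com_in_P_carrier[of i] True Suc by blast
    qed
    then obtain g where g: "g \<in> carrier G" "cmt G x g \<notin> P (i + 2)" by blast
    have "cmt G x g \<in> K"
      using com_in_normal(1)[OF assms(1)] Suc g by (auto simp: com_in_def)
    then show ?thesis
      using Suc(1)[of "Suc i" "cmt G x g"] Suc(2-) g cmt_P by auto
  next
    case False
    then show ?thesis
      using P_trivial[of "Suc i"] subgroup.one_closed[OF normal_imp_subgroup[OF assms(1)]] by simp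
  qed
  then show ?case
    using Suc normal_imp_subgroup[OF assms(1)] by (intro P_le_if_new[of i x K]) auto
qed

lemma level_exists:
  assumes "x \<in> P 1" "x \<noteq> \<one>"
  obtains i where "1 \<le> i" "i < n" "x \<in> P i" "x \<notin> P (Suc i)"
proof -
  let ?S = "{i. 1 \<le> i \<and> i < n \<and> x \<in> P i}"
  have f: "finite ?S" by simp
  have "1 < n"
    using P_trivial[of 1] assms by (cases "1 < n") auto
  then have ne: "1 \<in> ?S" using assms by simp
  let ?m = "Max ?S"
  have m: "?m \<in> ?S" using Max_in[OF f] ne by blast
  have "x \<notin> P (Suc ?m)"
  proof
    assume x: "x \<in> P (Suc ?m)"
    then have "Suc ?m < n" using P_trivial[of "Suc ?m"] assms(2) by (cases "Suc ?m < n") auto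
    then have "Suc ?m \<in> ?S" using x by simp
    then have "Suc ?m \<le> ?m" using f by (rule Max_ge[rotated])
    then show False by simp
  qed
  then show thesis using that m by blast
qed

lemma normal_contains_last:
  assumes "K \<lhd> G" "K \<subseteq> P 1" "K \<noteq> {\<one>}"
  shows "P (n - 1) \<subseteq> K"
proof -
  obtain x where x: "x \<in> K" "x \<noteq> \<one>"
    using assms subgroup.one_closed[OF normal_imp_subgroup[OF assms(1)]] by blast
  obtain i where "1 \<le> i" "i < n" "x \<in> P i" "x \<notin> P (Suc i)"
    by (rule level_exists[of x]) (use x assms(2) in auto)
  then show ?thesis
    using normal_contains_P[OF assms(1) x(1)] P_antimono[of i "n - 1"] by fastforce
qed

lemma pow_p_in_P1:
  assumes "x \<in> carrier G"
  shows "x [^] p \<in> P 1"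
proof -
  interpret N: normal "P 1" G using P_normal by simp
  interpret Q: group "G Mod P 1" by (rule N.factorgroup_is_group)
  have "card (rcosets P 1) * card (P 1) = order G"
    using lagrange[OF P_subgroup[of 1]] by simp
  moreover have "order G = p * card (P 1)"
    using card_P[of 1] order_G n_pos by (simp add: power_eq_if)
  moreover have "card (P 1) > 0"
    using card_P[of 1] p_gt_1 by simp
  ultimately have "order (G Mod P 1) = p"
    by (simp add: order_def FactGroup_def)
  then have "(P 1 #> x) [^]\<^bsub>G Mod P 1\<^esub> p = \<one>\<^bsub>G Mod P 1\<^esub>"
    using Q.pow_order_eq_1[of "P 1 #> x"] assms by (auto simp: carrier_FactGroup)
  then have "P 1 #> (x [^] p) = P 1"
    using N.FactGroup_pow[OF assms, of p] by simp
  then show ?thesis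
    using coset_join1[of "P 1" "x [^] p"] P_subgroup[of 1] assms by simp
qed

end

text \<open>Any normal \<open>H\<close> of index \<open>p\<close> may head the chain, because
  \<open>[H, G]\<close> is the derived subgroup in every case. The freedom is used twice:
  \<open>H\<close> is the domain of \<open>\<phi>\<close> in one direction and the elementary
  abelian subgroup in the other.\<close>

lemma (in group) pchain_of_maximal_class:
  assumes p: "Factorial_Ring.prime (p::nat)" and ord: "order G = p ^ n" and n: "n \<ge> 2"
    and cl: "has_nilpotency_class G (n - 1)" and H: "H \<lhd> G" "card H = p ^ (n - 1)"
  shows "pchain G p n (\<lambda>i. if i \<le> 1 then H else lower_central G (i - 1))"
proof -
  let ?P = "\<lambda>i. if i \<le> 1 then H else lower_central G (i - 1)"
  have normal: "?P i \<lhd> G" for i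
    using H lower_central_normal by simp
  have card: "card (?P i) = p ^ (n - i)" if "i \<ge> 1" for i
    using that H card_lower_central[OF p ord n cl, of "i - 1"] by auto
  have Suc: "?P (Suc i) = commutator_subgroup G (?P i) (carrier G)" if i: "i \<ge> 1" for i
  proof (cases "i = 1")
    case True
    have fin: "finite (carrier G)"
      using ord prime_gt_0_nat[OF p] by (metis order_gt_0_iff_finite zero_less_power)
    have "lower_central G 1 \<subseteq> commutator_subgroup G H (carrier G)"
      using commutator_subgroup_prime_index[OF p H(1) fin] H n ord by (simp add: power_eq_if)
    moreover have "commutator_subgroup G H (carrier G) \<subseteq> lower_central G 1"
      unfolding lower_central.simps One_nat_def commutator_subgroup_alt
      by (rule mono_generate) (use normal_subset[OF H(1)] in auto)
    ultimately show ?thesis using True by auto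
  next
    case False
    then obtain j where "i = Suc (Suc j)" using i by (metis One_nat_def Suc_le_D le_neq_implies_less not_less_eq_eq old.nat.exhaust)
    then show ?thesis by simp
  qed
  show ?thesis
    by (intro pchain.intro pchain_axioms.intro group_axioms p ord normal card Suc) (use n in auto)
qed

section \<open>Powers and commutators modulo a normal subgroup\<close>

context group
begin

lemma conj_nat_pow:
  assumes "x \<in> carrier G" "g \<in> carrier G"
  shows "inv g \<otimes> (x [^] (k::nat)) \<otimes> g = (inv g \<otimes> x \<otimes> g) [^] k"
proof (induction k)
  case (Suc k)
  have "inv g \<otimes> (x [^] Suc k) \<otimes> g = (inv g \<otimes> (x [^] k) \<otimes> g) \<otimes> (inv g \<otimes> x \<otimes> g)"
    using assms by (simp add: m_assoc)
  then show ?case using Suc by simp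
qed (use assms in simp)

lemma rcos_hom: "N \<lhd> G \<Longrightarrow> group_hom G (G Mod N) (\<lambda>x. N #> x)"
  by (simp add: group_hom_def group_hom_axioms_def normal.factorgroup_is_group normal.r_coset_hom_Mod)

lemma rcos_eq_one_iff:
  assumes "N \<lhd> G" "x \<in> carrier G"
  shows "N #> x = \<one>\<^bsub>G Mod N\<^esub> \<longleftrightarrow> x \<in> N"
  using assms coset_join1[of N x] coset_join2[of x N] normal_imp_subgroup[of N] by auto

lemma mem_of_rcos_eq:
  assumes "N \<lhd> G" "subgroup K G" "N \<subseteq> K" "y \<in> K" "x \<in> carrier G" "N #> x = N #> y"
  shows "x \<in> K"
proof -
  have "x \<in> N #> y"
    using assms rcos_self[of x N] normal_imp_subgroup[of N] by auto
  then show ?thesis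
    using assms by (auto simp: r_coset_def subgroup.m_closed subset_iff)
qed

lemma commute_rcos:
  assumes "com_in G A B N" "N \<lhd> G" "a \<in> A" "b \<in> B" "a \<in> carrier G" "b \<in> carrier G"
  shows "(N #> a) \<otimes>\<^bsub>G Mod N\<^esub> (N #> b) = (N #> b) \<otimes>\<^bsub>G Mod N\<^esub> (N #> a)"
proof -
  interpret h: group_hom G "G Mod N" "\<lambda>x. N #> x" using assms by (simp add: rcos_hom)
  have "cmt (G Mod N) (N #> a) (N #> b) = N #> cmt G a b"
    using assms by (simp add: h.hom_cmt)
  also have "\<dots> = \<one>\<^bsub>G Mod N\<^esub>"
    using assms by (subst rcos_eq_one_iff) (auto simp: com_in_def)
  finally show ?thesis
    using assms h.H.cmt_eq_one_iff[of "N #> a" "N #> b"] h.hom_closed by blast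
qed

lemma rcos_pow_mult:
  assumes "com_in G B B N" "N \<lhd> G" "B \<subseteq> carrier G" "x \<in> B" "y \<in> B"
  shows "N #> ((x \<otimes> y) [^] (k::nat)) = N #> ((x [^] k) \<otimes> (y [^] k))"
proof -
  interpret h: group_hom G "G Mod N" "\<lambda>x. N #> x" using assms by (simp add: rcos_hom)
  have c: "x \<in> carrier G" "y \<in> carrier G" using assms by auto
  have "N #> ((x \<otimes> y) [^] k) = ((N #> x) \<otimes>\<^bsub>G Mod N\<^esub> (N #> y)) [^]\<^bsub>G Mod N\<^esub> k"
    using c h.hom_nat_pow h.hom_mult by (metis m_closed)
  also have "\<dots> = ((N #> x) [^]\<^bsub>G Mod N\<^esub> k) \<otimes>\<^bsub>G Mod N\<^esub> ((N #> y) [^]\<^bsub>G Mod N\<^esub> k)"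
    using commute_rcos[OF assms(1,2,4,5) c] c h.hom_closed by (intro h.H.pow_mult_distrib) auto
  also have "\<dots> = N #> ((x [^] k) \<otimes> (y [^] k))"
    using c h.hom_nat_pow h.hom_mult by (metis nat_pow_closed)
  finally show ?thesis .
qed

text \<open>When \<open>B\<close> is abelian modulo \<open>N\<close>, raising to the power
  \<open>k\<close> is a homomorphism modulo \<open>N\<close>. Hence a bound on powers can be checked
  on generators of \<open>B\<close>.\<close>

lemma subgroup_pow_mem:
  assumes "com_in G B B N" "N \<lhd> G" "subgroup B G" "subgroup K G" "N \<subseteq> K"
  shows "subgroup {b \<in> B. b [^] (k::nat) \<in> K} G"
proof (rule subgroupI)
  note Bc = subgroup.subset[OF assms(3)]
  show "{b \<in> B. b [^] k \<in> K} \<subseteq> carrier G" using Bc by auto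
  have "\<one> \<in> {b \<in> B. b [^] k \<in> K}"
    using assms by (simp add: subgroup.one_closed)
  then show "{b \<in> B. b [^] k \<in> K} \<noteq> {}" by blast
  show "inv b \<in> {b \<in> B. b [^] k \<in> K}" if "b \<in> {b \<in> B. b [^] k \<in> K}" for b
    using that assms Bc by (auto simp: nat_pow_inv subgroup.m_inv_closed)
  show "a \<otimes> b \<in> {b \<in> B. b [^] k \<in> K}"
    if "a \<in> {b \<in> B. b [^] k \<in> K}" "b \<in> {b \<in> B. b [^] k \<in> K}" for a b
  proof -
    have "(a \<otimes> b) [^] k \<in> K"
      by (rule mem_of_rcos_eq[OF assms(2,4,5), of "(a [^] k) \<otimes> (b [^] k)"])
         (use that assms Bc rcos_pow_mult[OF assms(1,2) Bc, of a b k] in \<open>auto simp: subgroup.m_closed\<close>)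
    then show ?thesis using that assms(3) by (auto simp: subgroup.m_closed)
  qed
qed

lemma subgroup_pow_closed:
  "subgroup K G \<Longrightarrow> x \<in> K \<Longrightarrow> x [^] (k::nat) \<in> K"
  by (induction k) (auto simp: subgroup.one_closed subgroup.m_closed)

text \<open>By Bezout \<open>x\<close> is itself a power of \<open>x [^] k\<close>.\<close>

lemma mem_of_pow_coprime:
  assumes "coprime k (order G)" "0 < k" "subgroup N G" "x \<in> carrier G" "x [^] (k::nat) \<in> N"
  shows "x \<in> N"
proof -
  obtain l y where l: "k * l = order G * y + 1"
    using bezout_nat[of k "order G"] assms(1,2) by auto
  have "(x [^] k) [^] l = x [^] (order G * y + 1)"
    using assms(4) l by (simp add: nat_pow_pow)
  also have "\<dots> = (x [^] order G) [^] y \<otimes> x"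
    using assms(4) by (simp add: nat_pow_pow nat_pow_mult[symmetric])
  also have "\<dots> = x"
    using assms(4) by (simp add: pow_order_eq_1)
  finally show ?thesis using assms(3,5) subgroup_pow_closed by metis
qed

end

section \<open>Binomial expansion of an endomorphism of an abelian group\<close>

lemma (in comm_group) finprod_atMost_split:
  assumes "2 \<le> (p::nat)" "f \<in> {..p} \<rightarrow> carrier G"
  shows "finprod G f {..p} = f 0 \<otimes> (f p \<otimes> (f 1 \<otimes> finprod G f {2..<p}))"
proof -
  have "{..p} = insert 0 (insert p (insert 1 {2..<p}))" using assms(1) by auto
  moreover have "finprod G f (insert 0 (insert p (insert 1 {2..<p}))) =
      f 0 \<otimes> (f p \<otimes> (f 1 \<otimes> finprod G f {2..<p}))"
    using assms by (subst finprod_insert; (subst finprod_insert)?; (subst finprod_insert)?; force)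
  ultimately show ?thesis by simp
qed

lemma (in comm_group) finprod_mem_subgroup:
  assumes "subgroup K G" "finite I" "\<And>i. i \<in> I \<Longrightarrow> f i \<in> K"
  shows "finprod G f I \<in> K"
  using assms(2,3)
proof (induction rule: finite_induct)
  case (insert i I)
  then show ?case
    using subgroup.mem_carrier[OF assms(1)] subgroup.m_closed[OF assms(1)]
    by (subst finprod_insert) auto
qed (simp add: subgroup.one_closed[OF assms(1)])

text \<open>With \<open>\<delta> = \<sigma> - 1\<close> this is the expansion of \<open>(1 + \<delta>)^k\<close>.\<close>

lemma (in comm_group) funpow_binomial:
  assumes \<sigma>: "\<sigma> \<in> hom G G" and a: "a \<in> carrier G"
  defines "\<delta> \<equiv> \<lambda>x. inv x \<otimes> \<sigma> x"
  shows "(\<sigma> ^^ k) a = finprod G (\<lambda>i. (\<delta> ^^ i) a [^] (k choose i)) {..k}"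
proof -
  have \<sigma>c: "\<And>x. x \<in> carrier G \<Longrightarrow> \<sigma> x \<in> carrier G" using \<sigma> by (auto simp: hom_def)
  have \<delta>c: "(\<delta> ^^ i) a \<in> carrier G" for i by (induction i) (auto simp: \<delta>_def a \<sigma>c)
  have \<delta>cS: "\<delta> ((\<delta> ^^ i) a) \<in> carrier G" for i using \<delta>c[of "Suc i"] by simp
  have swap: "x \<otimes> y \<otimes> z = x \<otimes> z \<otimes> y"
    if "x \<in> carrier G" "y \<in> carrier G" "z \<in> carrier G" for x y z
    using that m_assoc m_comm by metis
  interpret \<sigma>: group_hom G G \<sigma> using \<sigma> by unfold_locales
  have \<sigma>\<delta>: "\<sigma> ((\<delta> ^^ i) a) = (\<delta> ^^ i) a \<otimes> (\<delta> ^^ Suc i) a" for i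
    using \<delta>c[of i] \<sigma>c by (simp add: \<delta>_def)
  have \<sigma>fin: "\<sigma> (finprod G f {..m}) = finprod G (\<lambda>i. \<sigma> (f i)) {..m}"
    if "f \<in> {..m} \<rightarrow> carrier G" for f and m :: nat
    using that
  proof (induction m)
    case (Suc m)
    have "f \<in> {..m} \<rightarrow> carrier G" "f (Suc m) \<in> carrier G" using Suc by auto
    then show ?case using Suc.IH Suc.prems \<sigma>c by (subst (1 2) finprod_Suc) (auto simp: Pi_iff)
  qed (use \<sigma>c in auto)
  show ?thesis
  proof (induction k)
    case 0
    then show ?case using a by simp
  next
    case (Suc k)
    let ?d = "\<lambda>i. (\<delta> ^^ i) a"
    have "(\<sigma> ^^ Suc k) a = finprod G (\<lambda>i. \<sigma> (?d i [^] (k choose i))) {..k}"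
      using \<delta>c \<delta>cS by (simp add: Suc \<sigma>fin)
    also have "\<dots> = finprod G (\<lambda>i. (?d i [^] (k choose i)) \<otimes> (?d (Suc i) [^] (k choose i))) {..k}"
    proof (rule finprod_cong')
      show "\<sigma> (?d i [^] (k choose i)) = (?d i [^] (k choose i)) \<otimes> (?d (Suc i) [^] (k choose i))" for i
        unfolding \<sigma>.hom_nat_pow[OF \<delta>c] \<sigma>\<delta> using \<delta>c \<delta>cS by (intro pow_mult_distrib m_comm) auto
    qed (use \<delta>c \<delta>cS in auto)
    also have "\<dots> = finprod G (\<lambda>i. ?d i [^] (k choose i)) {..k} \<otimes>
        finprod G (\<lambda>i. ?d (Suc i) [^] (k choose i)) {..k}"
      using \<delta>c \<delta>cS by (intro finprod_multf) auto
    also have "finprod G (\<lambda>i. ?d i [^] (k choose i)) {..k} = finprod G (\<lambda>i. ?d i [^] (k choose i)) {..Suc k}"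
      using \<delta>c \<delta>cS by (subst finprod_Suc) (auto simp: binomial_eq_0)
    also have "\<dots> = finprod G (\<lambda>i. ?d (Suc i) [^] (k choose Suc i)) {..k} \<otimes> ?d 0"
      using \<delta>c \<delta>cS a by (subst finprod_Suc2) auto
    also have "finprod G (\<lambda>i. ?d (Suc i) [^] (k choose Suc i)) {..k} \<otimes> ?d 0 \<otimes>
        finprod G (\<lambda>i. ?d (Suc i) [^] (k choose i)) {..k} =
        finprod G (\<lambda>i. ?d (Suc i) [^] (k choose Suc i)) {..k} \<otimes>
        finprod G (\<lambda>i. ?d (Suc i) [^] (k choose i)) {..k} \<otimes> ?d 0"
      using \<delta>c \<delta>cS a by (intro swap finprod_closed) auto
    also have "finprod G (\<lambda>i. ?d (Suc i) [^] (k choose Suc i)) {..k} \<otimes>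
        finprod G (\<lambda>i. ?d (Suc i) [^] (k choose i)) {..k} =
        finprod G (\<lambda>i. ?d (Suc i) [^] (Suc k choose Suc i)) {..k}"
      using \<delta>c \<delta>cS by (subst finprod_multf[symmetric])
        (auto simp: nat_pow_mult add.commute Pi_def simp del: funpow.simps intro!: finprod_cong')
    also have "\<dots> \<otimes> ?d 0 = finprod G (\<lambda>i. ?d i [^] (Suc k choose i)) {..Suc k}"
      using \<delta>c \<delta>cS a by (subst finprod_Suc2) auto
    finally show ?case .
  qed
qed

text \<open>In the expansion of \<open>(1 + \<delta>)^p\<close> applied to \<open>a\<close> the term
  \<open>i = 0\<close> cancels against \<open>a\<close> itself, the terms \<open>i = 1\<close> and
  \<open>i = p\<close> form the claimed product, and all others carry exponents divisible by
  \<open>p\<close>, so they lie in \<open>K\<close> by \<open>mem\<close>.\<close>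

lemma (in comm_group) pow_prime_relation:
  assumes \<sigma>: "\<sigma> \<in> hom G G" and a: "a \<in> carrier G"
  defines "\<delta> \<equiv> \<lambda>x. inv x \<otimes> \<sigma> x"
  assumes p: "Factorial_Ring.prime (p::nat)" and fix_a: "(\<sigma> ^^ p) a = a" and K: "subgroup K G"
    and mem: "\<And>i. 2 \<le> i \<Longrightarrow> i < p \<Longrightarrow> (\<delta> ^^ i) a [^] p \<in> K"
  shows "(\<delta> a [^] p) \<otimes> (\<delta> ^^ p) a \<in> K"
proof -
  have p2: "2 \<le> p" using p by (rule prime_ge_2_nat)
  have \<sigma>c: "\<And>x. x \<in> carrier G \<Longrightarrow> \<sigma> x \<in> carrier G" using \<sigma> by (auto simp: hom_def)
  have \<delta>c: "(\<delta> ^^ i) a \<in> carrier G" for i by (induction i) (auto simp: \<delta>_def a \<sigma>c)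
  define f where "f i = (\<delta> ^^ i) a [^] (p choose i)" for i
  have fc: "f i \<in> carrier G" for i using \<delta>c by (simp add: f_def)
  have "f i \<in> K" if "i \<in> {2..<p}" for i
  proof -
    have "p dvd (p choose i)" using that p by (intro dvd_choose_prime) auto
    then obtain c where "p choose i = p * c" by blast
    then have "f i = ((\<delta> ^^ i) a [^] p) [^] c" using \<delta>c by (simp add: f_def nat_pow_pow)
    then show ?thesis using mem[of i] that K subgroup_pow_closed by simp
  qed
  then have R: "finprod G f {2..<p} \<in> K" using K by (intro finprod_mem_subgroup) auto
  have Rc: "finprod G f {2..<p} \<in> carrier G" using fc by (intro finprod_closed) auto
  have "a = finprod G f {..p}"
    using funpow_binomial[OF \<sigma> a, of p] fix_a by (simp add: f_def[abs_def] \<delta>_def)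
  also have "\<dots> = f 0 \<otimes> (f p \<otimes> (f 1 \<otimes> finprod G f {2..<p}))"
    using p2 fc by (intro finprod_atMost_split) auto
  finally have "a \<otimes> (f p \<otimes> (f 1 \<otimes> finprod G f {2..<p})) = a \<otimes> \<one>"
    using a by (simp add: f_def)
  then have "f p \<otimes> (f 1 \<otimes> finprod G f {2..<p}) = \<one>"
    using a fc Rc Units_l_cancel[of a "f p \<otimes> (f 1 \<otimes> finprod G f {2..<p})" \<one>] by simp
  then have "(f 1 \<otimes> f p) \<otimes> finprod G f {2..<p} = \<one>"
    using fc Rc by (simp add: m_assoc m_comm m_lcomm)
  then have "f 1 \<otimes> f p = inv (finprod G f {2..<p})"
    using fc Rc by (simp add: inv_equality)
  then show ?thesis using R K \<delta>c by (simp add: f_def subgroup.m_inv_closed)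
qed

section \<open>Commutator identities for sequences running down the chain\<close>

context group
begin

text \<open>Conjugation by \<open>s\<close> sends \<open>[x, y]\<close> to
  \<open>[x c, y d]\<close>. Expanding the latter and sorting the factors takes exactly the
  commutation rules assumed; the result is the product rule for the derivation \<open>[-, s]\<close>
  with the extra term \<open>[c, d]\<close>.\<close>

lemma cmt_leibniz:
  assumes c: "x \<in> carrier G" "y \<in> carrier G" "s \<in> carrier G"
  defines "c \<equiv> cmt G x s" and "d \<equiv> cmt G y s"
  assumes 1: "c \<otimes> cmt G x d = cmt G x d \<otimes> c" and 2: "c \<otimes> cmt G x y = cmt G x y \<otimes> c"
    and 3: "d \<otimes> cmt G x y = cmt G x y \<otimes> d" and 4: "d \<otimes> cmt G c y = cmt G c y \<otimes> d"
    and 5: "cmt G x y \<otimes> cmt G x d = cmt G x d \<otimes> cmt G x y"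
  shows "cmt G (cmt G x y) s = cmt G x d \<otimes> cmt G c d \<otimes> cmt G c y"
proof -
  have cc: "c \<in> carrier G" "d \<in> carrier G" using c by (auto simp: c_def d_def)
  have swap: "inv a \<otimes> b \<otimes> a = b" if "a \<otimes> b = b \<otimes> a" "a \<in> carrier G" "b \<in> carrier G" for a b
    using that by (simp add: m_assoc flip: that(1))
  have e1: "cmt G x (y \<otimes> d) = cmt G x d \<otimes> cmt G x y"
    using c cc swap[OF 3] by (simp add: cmt_mult_right)
  have e2: "cmt G c (y \<otimes> d) = cmt G c d \<otimes> cmt G c y"
    using c cc swap[OF 4] by (simp add: cmt_mult_right)
  have e3: "c \<otimes> (cmt G x d \<otimes> cmt G x y) = (cmt G x d \<otimes> cmt G x y) \<otimes> c"
    using c cc 1 2 by (metis m_assoc cmt_closed)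
  have "inv s \<otimes> cmt G x y \<otimes> s = cmt G (inv s \<otimes> x \<otimes> s) (inv s \<otimes> y \<otimes> s)"
    using conj_cmt[of x y "inv s"] c by simp
  also have "\<dots> = cmt G (x \<otimes> c) (y \<otimes> d)"
    using c by (simp add: conj_eq_cmt c_def d_def)
  also have "\<dots> = inv c \<otimes> cmt G x (y \<otimes> d) \<otimes> c \<otimes> cmt G c (y \<otimes> d)"
    using c cc by (simp add: cmt_mult_left)
  also have "\<dots> = (cmt G x d \<otimes> cmt G x y) \<otimes> (cmt G c d \<otimes> cmt G c y)"
    unfolding e1 e2 using c cc swap[OF e3] by simp
  finally have "inv s \<otimes> cmt G x y \<otimes> s = cmt G x y \<otimes> (cmt G x d \<otimes> (cmt G c d \<otimes> cmt G c y))"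
    using c cc by (simp add: m_assoc[symmetric] 5)
  then have "cmt G x y \<otimes> cmt G (cmt G x y) s = cmt G x y \<otimes> (cmt G x d \<otimes> (cmt G c d \<otimes> cmt G c y))"
    using c by (simp add: conj_eq_cmt)
  then show ?thesis
    using c cc Units_l_cancel[of "cmt G x y"] by (simp add: m_assoc)
qed

lemma commute_cmt:
  assumes "u \<otimes> a = a \<otimes> u" "u \<otimes> b = b \<otimes> u" "u \<in> carrier G" "a \<in> carrier G" "b \<in> carrier G"
  shows "u \<otimes> cmt G a b = cmt G a b \<otimes> u"
proof -
  have "subgroup (centr_mod G {u} {\<one>}) G"
    using assms by (intro centr_mod_subgroup one_is_normal) auto
  moreover have "a \<in> centr_mod G {u} {\<one>}" "b \<in> centr_mod G {u} {\<one>}"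
    using assms by (auto simp: centr_mod_def cmt_eq_one_iff)
  ultimately have "cmt G a b \<in> centr_mod G {u} {\<one>}"
    unfolding cmt_def by (intro subgroup.m_closed subgroup.m_inv_closed)
  then show ?thesis using assms by (auto simp: centr_mod_def cmt_eq_one_iff)
qed

text \<open>With \<open>u\<^sub>i = [t\<^sub>i, t\<^bsub>2k+1-i\<^esub>]\<close>, \<open>v\<^sub>i = [t\<^sub>i, t\<^bsub>2k+2-i\<^esub>]\<close> and \<open>w\<^sub>i = [u\<^sub>i, s]\<close> the Leibniz rule
  gives \<open>w\<^sub>i = v\<^sub>i v\<^bsub>i+1\<^esub>\<close> and \<open>w\<^bsub>i+1\<^esub> = w\<^sub>i\<^sup>-\<^sup>1\<close>; since \<open>v\<^bsub>k+1\<^esub> = 1\<close>, this yields \<open>v\<^sub>1 = w\<^sub>1\<^sup>k\<close>.\<close>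

lemma cmt_sequence_pow:
  fixes t :: "nat \<Rightarrow> 'a"
  assumes tc: "\<And>i. 1 \<le> i \<Longrightarrow> t i \<in> carrier G" and s: "s \<in> carrier G"
    and tS: "\<And>i. 1 \<le> i \<Longrightarrow> t (Suc i) = cmt G (t i) s"
    and F1: "\<And>i j. 1 \<le> i \<Longrightarrow> 1 \<le> j \<Longrightarrow> i + j = 2 * k + 3 \<Longrightarrow> cmt G (t i) (t j) = \<one>"
    and F2: "\<And>i j l. 1 \<le> i \<Longrightarrow> 1 \<le> j \<Longrightarrow> i + j \<in> {2 * k, 2 * k + 1, 2 * k + 2} \<Longrightarrow> 1 \<le> l \<Longrightarrow>
      t l \<otimes> cmt G (t i) (t j) = cmt G (t i) (t j) \<otimes> t l"
    and F3: "\<And>i j. 1 \<le> i \<Longrightarrow> 1 \<le> j \<Longrightarrow> i + j = 2 * k + 2 \<Longrightarrow>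
      s \<otimes> cmt G (t i) (t j) = cmt G (t i) (t j) \<otimes> s"
    and F4: "\<And>i j. 1 \<le> i \<Longrightarrow> 1 \<le> j \<Longrightarrow> i + j = 2 * k \<Longrightarrow>
      s \<otimes> cmt G (cmt G (t i) (t j)) s = cmt G (cmt G (t i) (t j)) s \<otimes> s"
    and F5: "cmt G (t 1) (t (2 * k + 1)) = \<one>" and k: "1 \<le> k"
  shows "cmt G (cmt G (t 1) (t (2 * k))) s [^] k = \<one>"
proof -
  define u where "u i = cmt G (t i) (t (2 * k + 1 - i))" for i
  define v where "v i = cmt G (t i) (t (2 * k + 2 - i))" for i
  define w where "w i = cmt G (u i) s" for i
  have uc: "u i \<in> carrier G" if "1 \<le> i" "i \<le> 2 * k" for i using that tc by (simp add: u_def)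
  have vc: "v i \<in> carrier G" if "1 \<le> i" "i \<le> 2 * k + 1" for i using that tc by (simp add: v_def)
  have wc: "w i \<in> carrier G" if "1 \<le> i" "i \<le> 2 * k" for i using that uc s by (simp add: w_def)
  have comm: "cmt G (t i) (t j) \<otimes> cmt G (t i') (t j') = cmt G (t i') (t j') \<otimes> cmt G (t i) (t j)"
    if "1 \<le> i" "1 \<le> j" "1 \<le> i'" "1 \<le> j'" "i + j \<in> {2 * k, 2 * k + 1, 2 * k + 2}" for i j i' j'
    using that tc F2 by (intro commute_cmt) (auto simp del: insert_iff)
  have leibniz: "cmt G (cmt G (t i) (t j)) s =
      cmt G (t i) (t (Suc j)) \<otimes> cmt G (t (Suc i)) (t (Suc j)) \<otimes> cmt G (t (Suc i)) (t j)"
    if ij: "1 \<le> i" "1 \<le> j" "i + j \<in> {2 * k, 2 * k + 1}" for i j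
    using cmt_leibniz[of "t i" "t j" s] ij tc s F2 comm unfolding tS[OF ij(1), symmetric] tS[OF ij(2), symmetric]
    by auto
  have w1: "w i = v i \<otimes> v (Suc i)" if i: "1 \<le> i" "i \<le> 2 * k" for i
  proof -
    have "Suc (2 * k + 1 - i) = 2 * k + 2 - i" "2 * k + 2 - Suc i = 2 * k + 1 - i" using i by auto
    moreover have "cmt G (t (Suc i)) (t (2 * k + 2 - i)) = \<one>" using i by (intro F1) auto
    ultimately show ?thesis
      using leibniz[of i "2 * k + 1 - i"] i vc[of i] by (simp add: w_def u_def v_def)
  qed
  have wt: "t l \<otimes> w i = w i \<otimes> t l" if i: "1 \<le> i" "i \<le> 2 * k" "1 \<le> l" for i l
  proof -
    have "t l \<otimes> v i = v i \<otimes> t l" "t l \<otimes> v (Suc i) = v (Suc i) \<otimes> t l"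
      unfolding v_def using i by (auto intro!: F2)
    then show ?thesis using i vc tc w1 by (metis m_assoc Suc_eq_plus1 add_le_mono1 le_SucI add.commute)
  qed
  \<comment> \<open>The product rule for \<open>[t i, t (2 k - i)]\<close> yields
    \<open>u i\<close>, \<open>v (i + 1)\<close>, \<open>u (i + 1)\<close>. By \<open>F4\<close> and
    \<open>F3\<close> the element \<open>s\<close> commutes with the whole product and with
    \<open>v (i + 1)\<close>, hence with \<open>z = u i \<otimes> u (i + 1)\<close>; so
    \<open>[u (i + 1), s]\<close> is inverse to \<open>[u i, s]\<close>.\<close>
  have w2: "w (Suc i) = inv (w i)" if i: "1 \<le> i" "Suc i \<le> 2 * k" for i
  proof -
    define z where "z = u i \<otimes> u (Suc i)"
    have c: "u i \<in> carrier G" "u (Suc i) \<in> carrier G" "v (Suc i) \<in> carrier G" "w i \<in> carrier G"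
      "z \<in> carrier G"
      using i uc vc wc by (auto simp: z_def)
    have eqs: "Suc (2 * k - i) = 2 * k + 1 - i" "2 * k + 1 - Suc i = 2 * k - i"
      "2 * k + 2 - Suc i = 2 * k + 1 - i" using i by auto
    have uv: "v (Suc i) \<otimes> u (Suc i) = u (Suc i) \<otimes> v (Suc i)"
      unfolding u_def v_def using i by (intro comm) auto
    have "cmt G (cmt G (t i) (t (2 * k - i))) s = u i \<otimes> v (Suc i) \<otimes> u (Suc i)"
      using leibniz[of i "2 * k - i"] i eqs by (simp add: u_def v_def)
    also have "\<dots> = z \<otimes> v (Suc i)" using c uv by (simp add: z_def m_assoc)
    finally have "s \<otimes> (z \<otimes> v (Suc i)) = (z \<otimes> v (Suc i)) \<otimes> s"
      using F4[of i "2 * k - i"] i by simp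
    moreover have "s \<otimes> v (Suc i) = v (Suc i) \<otimes> s"
      unfolding v_def using i by (intro F3) auto
    ultimately have "s \<otimes> z \<otimes> v (Suc i) = z \<otimes> s \<otimes> v (Suc i)"
      using c s by (simp add: m_assoc)
    then have zs: "s \<otimes> z = z \<otimes> s" using c s by simp
    have wu: "w i \<otimes> u i = u i \<otimes> w i"
      unfolding u_def using i c tc wt by (intro commute_cmt) auto
    have "w i \<otimes> u (Suc i) = u (Suc i) \<otimes> w i"
      unfolding u_def using i c tc wt by (intro commute_cmt) auto
    then have wz: "w i \<otimes> z = z \<otimes> w i" using wu c by (simp add: z_def) (metis m_assoc)
    have "u (Suc i) = inv (u i) \<otimes> z" using c by (simp add: z_def)
    then have "w (Suc i) = inv z \<otimes> cmt G (inv (u i)) s \<otimes> z \<otimes> cmt G z s"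
      using c s by (simp add: w_def cmt_mult_left)
    also have "cmt G z s = \<one>" using zs c s by (simp add: cmt_eq_one_iff)
    also have "cmt G (inv (u i)) s = u i \<otimes> inv (w i) \<otimes> inv (u i)"
      using c s by (simp add: cmt_inv_left w_def)
    also have "u i \<otimes> inv (w i) = inv (w i) \<otimes> u i"
      using wu c by (metis inv_solve_left inv_solve_right m_closed inv_closed m_assoc)
    also have "inv z \<otimes> (inv (w i) \<otimes> u i \<otimes> inv (u i)) \<otimes> z \<otimes> \<one> = inv z \<otimes> (inv (w i) \<otimes> z)"
      using c by (simp add: m_assoc)
    also have "inv (w i) \<otimes> z = z \<otimes> inv (w i)"
      using wz c by (metis inv_solve_left inv_solve_right m_closed inv_closed m_assoc)
    finally show ?thesis using c by simp
  qed
  \<comment> \<open>Descent from the middle, where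
    \<open>v (k + 1) = [t (k + 1), t (k + 1)] = 1\<close>, down to \<open>v 1\<close>, which is
    trivial by \<open>F5\<close>.\<close>
  have "v (k + 1 - l) = w (k + 1 - l) [^] l" if "l \<le> k" for l
    using that
  proof (induction l)
    case 0
    then show ?case using tc by (simp add: v_def)
  next
    case (Suc l)
    define i where "i = k - l"
    have i: "1 \<le> i" "Suc i \<le> 2 * k" "k + 1 - l = Suc i" "k + 1 - Suc l = i" using Suc by (auto simp: i_def)
    have c: "v i \<in> carrier G" "v (Suc i) \<in> carrier G" "w i \<in> carrier G" using i vc wc by auto
    have "v (Suc i) = inv (w i) [^] l" using Suc i w2 by simp
    then have "v (Suc i) = inv (w i [^] l)" using c by (simp add: nat_pow_inv)
    then have "v i \<otimes> inv (w i [^] l) = w i" using w1[of i] i by simp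
    then have "v i = w i \<otimes> (w i [^] l)" using c by (metis inv_solve_right' nat_pow_closed inv_closed m_closed inv_inv)
    then show ?case using c i nat_pow_Suc2[of "w i" l] by simp
  qed
  from this[of k] show ?thesis using F5 k by (simp add: v_def w_def u_def)
qed

end

section \<open>Commutators and p-th powers along the chain\<close>

context pchain
begin

lemma com_in_P_sym: "com_in G (P i) (P j) (P r) \<Longrightarrow> 1 \<le> i \<Longrightarrow> 1 \<le> j \<Longrightarrow> 1 \<le> r \<Longrightarrow> com_in G (P j) (P i) (P r)"
  by (erule com_in_sym) (auto simp: P_subgroup P_in_carrier)

text \<open>The three subgroups lemma for \<open>P i\<close>, \<open>G\<close> and
  \<open>P j\<close>, since \<open>P (i + 1) = [P i, G]\<close>. All inductions on the first index
  go through this step; \<open>e\<close> is whatever bound is known for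
  \<open>[P j, P i]\<close>.\<close>

lemma com_in_P_step:
  assumes "1 \<le> i" "1 \<le> j" "1 \<le> e" "1 \<le> r"
    and "com_in G (P (Suc j)) (P i) (P r)" "com_in G (P j) (P i) (P e)" "P (Suc e) \<subseteq> P r"
  shows "com_in G (P (Suc i)) (P j) (P r)"
  unfolding P_Suc[OF assms(1)]
proof (rule three_subgroups)
  show "com_in G (carrier G) (P j) (P (Suc j))" using assms by (simp add: com_in_carrier_P)
  show "com_in G (P e) (carrier G) (P r)"
    using com_in_P_carrier[of e] assms by (auto simp: com_in_def)
qed (use assms in \<open>auto simp: P_normal P_subgroup subgroup_self\<close>)

lemma com_in_P_P:
  assumes "1 \<le> i" "1 \<le> j"
  shows "com_in G (P i) (P j) (P (i + j))"
  using assms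
proof (induction i arbitrary: j rule: dec_induct)
  case base
  then show ?case using com_in_carrier_P[of j] P_carrier[of 1] by (auto simp: com_in_def)
next
  case (step i)
  have "com_in G (P (Suc j)) (P i) (P (Suc i + j))" "com_in G (P j) (P i) (P (i + j))"
    using step com_in_P_sym[OF step(3)[of "Suc j"]] com_in_P_sym[OF step(3)[of j]] by auto
  then show ?case using step by (intro com_in_P_step[of i j "i + j"]) auto
qed

text \<open>Otherwise \<open>s\<close> centralizes \<open>P i / P (i + 2)\<close>. So does
  \<open>P 1\<close>, and together they generate \<open>G\<close>, which contradicts
  \<open>P (i + 1) = [P i, G]\<close>.\<close>

lemma uniserial_step:
  assumes "1 \<le> i" "i + 2 \<le> n" "com_in G (P i) (P 1) (P (i + 2))"
    and "x \<in> P i" "x \<notin> P (Suc i)" "s \<in> carrier G" "s \<notin> P 1"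
  shows "cmt G x s \<notin> P (i + 2)"
proof
  assume "cmt G x s \<in> P (i + 2)"
  then have "com_in G (P i) {s} (P (i + 2))"
    using assms com_in_P_carrier[of "Suc i"]
    by (intro com_in_new[of i x "P (i + 2)"]) (auto intro: P_normal simp: com_in_def)
  then have 1: "com_in G {s} (P i) (P (i + 2))"
    by (rule com_in_sym) (use assms in \<open>auto simp: P_subgroup P_in_carrier\<close>)
  have 2: "com_in G (P 1) (P i) (P (i + 2))"
    using assms by (intro com_in_P_sym[of i]) auto
  have "com_in G (carrier G) (P i) (P (i + 2))"
    using assms 1 2 by (intro com_in_top[of s]) (auto intro: P_normal simp: P_in_carrier)
  then have "com_in G (P i) (carrier G) (P (i + 2))"
    by (rule com_in_sym) (use assms in \<open>auto simp: P_subgroup P_in_carrier\<close>)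
  then show False using not_com_in_P_carrier assms by blast
qed

lemma funpow_cmt_in_P:
  "1 \<le> k \<Longrightarrow> a \<in> P k \<Longrightarrow> s \<in> carrier G \<Longrightarrow> ((\<lambda>x. cmt G x s) ^^ i) a \<in> P (k + i)"
  by (induction i) (auto intro: cmt_P)

text \<open>The relation \<open>[a, s\<^sup>p] = 1\<close>, expanded in the abelian section \<open>P k / N\<close>.\<close>

lemma pow_cmt_relation:
  assumes N: "N \<lhd> G" and k: "1 \<le> k" and ab: "com_in G (P k) (P k) N" and s: "s \<in> carrier G"
    and sp: "com_in G (P k) {s [^] p} N" and K: "subgroup K G" "N \<subseteq> K" and a: "a \<in> P k"
  defines "D \<equiv> \<lambda>x. cmt G x s"
  assumes mem: "\<And>i. 2 \<le> i \<Longrightarrow> i < p \<Longrightarrow> (D ^^ i) a [^] p \<in> K"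
  shows "(D a [^] p) \<otimes> (D ^^ p) a \<in> K"
proof -
  let ?\<pi> = "\<lambda>x. N #> x"
  interpret h: group_hom G "G Mod N" ?\<pi> using N by (rule rcos_hom)
  note [simp del] = h.hom_mult h.hom_inv
  note Nc = normal_subset[OF N]
  define A where "A = ?\<pi> ` P k"
  define Q where "Q = (G Mod N)\<lparr>carrier := A\<rparr>"
  have Pc: "x \<in> carrier G" if "x \<in> P k" for x using that k P_in_carrier by blast
  have A: "subgroup A (G Mod N)"
    unfolding A_def by (rule h.subgroup_img_is_subgroup) (use k P_subgroup in auto)
  have Ag: "group Q" unfolding Q_def by (rule h.H.subgroup_imp_group[OF A])
  interpret Q: comm_group Q
  proof (rule group.group_comm_groupI[OF Ag])
    fix x y assume "x \<in> carrier Q" "y \<in> carrier Q"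
    then show "x \<otimes>\<^bsub>Q\<^esub> y = y \<otimes>\<^bsub>Q\<^esub> x"
      using commute_rcos[OF ab N] Pc by (auto simp: Q_def A_def)
  qed
  define \<sigma> where "\<sigma> y = inv\<^bsub>G Mod N\<^esub> (?\<pi> s) \<otimes>\<^bsub>G Mod N\<^esub> y \<otimes>\<^bsub>G Mod N\<^esub> ?\<pi> s" for y
  define \<delta> where "\<delta> y = inv\<^bsub>Q\<^esub> y \<otimes>\<^bsub>Q\<^esub> \<sigma> y" for y
  have \<sigma>\<pi>: "\<sigma> (?\<pi> x) = ?\<pi> (inv s \<otimes> x \<otimes> s)" if "x \<in> carrier G" for x
    using that s by (simp add: \<sigma>_def h.hom_mult h.hom_inv)
  have conjP: "inv s \<otimes> x \<otimes> s \<in> P k" if "x \<in> P k" for x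
    using that s k normal_conj(1)[OF P_normal] by blast
  have \<sigma>A: "\<sigma> y \<in> A" if "y \<in> A" for y
    using that \<sigma>\<pi> Pc conjP by (auto simp: A_def)
  have \<sigma>: "\<sigma> \<in> hom Q Q"
  proof (rule homI)
    fix x y assume "x \<in> carrier Q" "y \<in> carrier Q"
    then obtain x' y' where xy: "x = ?\<pi> x'" "y = ?\<pi> y'" "x' \<in> carrier G" "y' \<in> carrier G"
      using Pc by (auto simp: Q_def A_def)
    then have "\<sigma> (x \<otimes>\<^bsub>Q\<^esub> y) = \<sigma> (?\<pi> (x' \<otimes> y'))" by (simp add: Q_def h.hom_mult)
    also have "\<dots> = ?\<pi> (inv s \<otimes> (x' \<otimes> y') \<otimes> s)" using xy by (intro \<sigma>\<pi>) auto
    also have "inv s \<otimes> (x' \<otimes> y') \<otimes> s = (inv s \<otimes> x' \<otimes> s) \<otimes> (inv s \<otimes> y' \<otimes> s)"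
      using xy s by (simp add: m_assoc)
    also have "?\<pi> \<dots> = ?\<pi> (inv s \<otimes> x' \<otimes> s) \<otimes>\<^bsub>G Mod N\<^esub> ?\<pi> (inv s \<otimes> y' \<otimes> s)"
      using xy s by (intro h.hom_mult) auto
    also have "\<dots> = \<sigma> x \<otimes>\<^bsub>Q\<^esub> \<sigma> y"
      unfolding xy(1,2) \<sigma>\<pi>[OF xy(3)] \<sigma>\<pi>[OF xy(4)] by (simp add: Q_def)
    finally show "\<sigma> (x \<otimes>\<^bsub>Q\<^esub> y) = \<sigma> x \<otimes>\<^bsub>Q\<^esub> \<sigma> y" .
  qed (use \<sigma>A in \<open>simp add: Q_def\<close>)
  have inv_Q: "inv\<^bsub>Q\<^esub> y = inv\<^bsub>G Mod N\<^esub> y" if "y \<in> A" for y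
    unfolding Q_def using that by (rule h.H.m_inv_consistent[OF A])
  have \<delta>\<pi>: "\<delta> (?\<pi> x) = ?\<pi> (D x)" if "x \<in> P k" for x
  proof -
    have xA: "?\<pi> x \<in> A" using that by (simp add: A_def)
    have "\<delta> (?\<pi> x) = inv\<^bsub>G Mod N\<^esub> (?\<pi> x) \<otimes>\<^bsub>G Mod N\<^esub> ?\<pi> (inv s \<otimes> x \<otimes> s)"
      unfolding \<delta>_def inv_Q[OF xA] \<sigma>\<pi>[OF Pc[OF that]] by (simp add: Q_def)
    also have "\<dots> = ?\<pi> (inv x \<otimes> (inv s \<otimes> x \<otimes> s))"
      using that Pc[OF that] s by (subst h.hom_mult) (auto simp: h.hom_inv)
    finally show ?thesis using that Pc s by (simp add: D_def cmt_def m_assoc)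
  qed
  have DP: "(D ^^ i) a \<in> P k" for i
    using funpow_cmt_in_P[OF k a s, of i] P_antimono[of k "k + i"] k by (auto simp: D_def)
  have \<delta>pow: "(\<delta> ^^ i) (?\<pi> a) = ?\<pi> ((D ^^ i) a)" for i
    by (induction i) (use DP \<delta>\<pi> in simp_all)
  have \<sigma>pow: "(\<sigma> ^^ i) (?\<pi> a) = ?\<pi> (inv (s [^] i) \<otimes> a \<otimes> (s [^] i))" for i
  proof (induction i)
    case (Suc i)
    have "(\<sigma> ^^ Suc i) (?\<pi> a) = ?\<pi> (inv s \<otimes> (inv (s [^] i) \<otimes> a \<otimes> (s [^] i)) \<otimes> s)"
      using Suc \<sigma>\<pi> Pc[OF a] s by simp
    also have "inv s \<otimes> (inv (s [^] i) \<otimes> a \<otimes> (s [^] i)) \<otimes> s = inv (s [^] Suc i) \<otimes> a \<otimes> (s [^] Suc i)"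
      using Pc[OF a] s by (simp add: m_assoc inv_mult_group)
    finally show ?case .
  qed (use Pc[OF a] in simp)
  have "?\<pi> (cmt G a (s [^] p)) = \<one>\<^bsub>G Mod N\<^esub>"
    using sp a N Pc[OF a] s by (subst rcos_eq_one_iff) (auto simp: com_in_def)
  then have "(\<sigma> ^^ p) (?\<pi> a) = ?\<pi> a"
    using \<sigma>pow[of p] Pc[OF a] s by (simp add: conj_eq_cmt h.hom_mult del: one_FactGroup mult_FactGroup)
  \<comment> \<open>\<open>K\<close> may stick out of \<open>P k\<close>, so the target subgroup
    inside \<open>Q\<close> is the image of \<open>K \<inter> P k\<close>.\<close>
  moreover have "subgroup (?\<pi> ` (K \<inter> P k)) Q"
    unfolding Q_def
  proof (rule h.H.subgroup_incl[OF _ A])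
    show "subgroup (?\<pi> ` (K \<inter> P k)) (G Mod N)"
      using K k P_subgroup subgroups_Inter_pair by (intro h.subgroup_img_is_subgroup) auto
  qed (auto simp: A_def)
  moreover have powQ: "y [^]\<^bsub>Q\<^esub> (m::nat) = y [^]\<^bsub>G Mod N\<^esub> m" for y m
    by (simp add: Q_def nat_pow_def)
  moreover have powP: "x [^] (m::nat) \<in> P k" if "x \<in> P k" for x m
    using that k subgroup_pow_closed[OF P_subgroup] by blast
  have "(\<delta> ^^ i) (?\<pi> a) [^]\<^bsub>Q\<^esub> p \<in> ?\<pi> ` (K \<inter> P k)" if "2 \<le> i" "i < p" for i
  proof -
    have "(\<delta> ^^ i) (?\<pi> a) [^]\<^bsub>Q\<^esub> p = ?\<pi> ((D ^^ i) a [^] p)"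
      using DP[of i] Pc by (simp add: \<delta>pow powQ h.hom_nat_pow)
    then show ?thesis using mem[OF that] powP[OF DP] by blast
  qed
  ultimately have "(\<delta> (?\<pi> a) [^]\<^bsub>Q\<^esub> p) \<otimes>\<^bsub>Q\<^esub> (\<delta> ^^ p) (?\<pi> a) \<in> ?\<pi> ` (K \<inter> P k)"
    unfolding \<delta>_def using a
    by (intro Q.pow_prime_relation[OF \<sigma> _ prime_p]) (auto simp: Q_def A_def)
  moreover have "(\<delta> (?\<pi> a) [^]\<^bsub>Q\<^esub> p) \<otimes>\<^bsub>Q\<^esub> (\<delta> ^^ p) (?\<pi> a) = ?\<pi> ((D a [^] p) \<otimes> (D ^^ p) a)"
  proof -
    have c: "D a \<in> carrier G" "(D ^^ p) a \<in> carrier G" using DP[of p] DP[of 1] Pc by auto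
    show ?thesis
      unfolding \<delta>pow \<delta>\<pi>[OF a] powQ h.hom_nat_pow[OF c(1), symmetric]
      using c by (subst h.hom_mult) (auto simp: Q_def)
  qed
  ultimately have "?\<pi> ((D a [^] p) \<otimes> (D ^^ p) a) \<in> ?\<pi> ` (K \<inter> P k)" by simp
  then obtain y where y: "y \<in> K" "?\<pi> ((D a [^] p) \<otimes> (D ^^ p) a) = ?\<pi> y" by blast
  have "D a \<in> carrier G" "(D ^^ p) a \<in> carrier G" using Pc[OF DP[of p]] Pc[OF DP[of 1]] by simp_all
  then show ?thesis
    by (intro mem_of_rcos_eq[OF N K y(1) _ y(2)] m_closed nat_pow_closed)
qed

end

section \<open>Blackburn's theorem\<close>

lemma (in group) subgroup_mult_cancel:
  assumes "subgroup K G" "x \<in> carrier G" "y \<in> carrier G" "x \<otimes> y \<in> K"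
  shows "y \<in> K \<Longrightarrow> x \<in> K" "x \<in> K \<Longrightarrow> y \<in> K"
proof -
  assume "y \<in> K"
  then have "x \<otimes> y \<otimes> inv y \<in> K"
    using assms(1,4) subgroup.m_closed subgroup.m_inv_closed by metis
  moreover have "x \<otimes> y \<otimes> inv y = x" using assms by (simp add: m_assoc)
  ultimately show "x \<in> K" by simp
next
  assume "x \<in> K"
  then have "inv x \<otimes> (x \<otimes> y) \<in> K"
    using assms(1,4) subgroup.m_closed subgroup.m_inv_closed by metis
  moreover have "inv x \<otimes> (x \<otimes> y) = y" using assms by simp
  ultimately show "y \<in> K" by simp
qed

context pchain
begin

text \<open>Modulo \<open>P (j + 1)\<close> the group \<open>P j\<close> is generated by
  \<open>[a, s]\<close> with \<open>a\<close> new at level \<open>j - 1\<close>. The relation for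
  \<open>s [^] p\<close> makes \<open>[a, s] [^] p\<close> inverse to the \<open>p\<close>-fold
  commutator of \<open>a\<close>, at level \<open>j - 1 + p\<close>, up to p-th powers from deeper
  levels, which are known by induction. The bound \<open>k0 < j\<close> keeps \<open>a\<close> in
  the section that is abelian modulo \<open>P r\<close>.\<close>

lemma pow_p_levels:
  assumes k0: "1 \<le> k0" and r: "1 \<le> r" "r \<le> n" and ab: "com_in G (P k0) (P k0) (P r)"
    and s: "s \<in> carrier G" and sp: "com_in G (P k0) {s [^] p} (P r)"
    and uni: "\<And>i x. 1 \<le> i \<Longrightarrow> i + 2 \<le> r \<Longrightarrow> x \<in> P i \<Longrightarrow> x \<notin> P (Suc i) \<Longrightarrow> cmt G x s \<notin> P (i + 2)"
    and j: "k0 < j" and b: "b \<in> P j"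
  shows "b [^] p \<in> P (min (j + p - 1) r)"
  using j b
proof (induction "r - j" arbitrary: j b rule: less_induct)
  case less
  have p2: "2 \<le> p" using prime_p by (rule prime_ge_2_nat)
  let ?K = "P (min (j + p - 1) r)"
  have min1: "1 \<le> min (j + p - 1) r" using r less p2 by simp
  have K: "subgroup ?K G" "P r \<subseteq> ?K"
    by (rule P_subgroup[OF min1], rule P_antimono[OF min1 min.cobounded2])
  show ?case
  proof (cases "r \<le> j")
    case True
    then have "b \<in> P r" using P_antimono[of r j] r less by auto
    then show ?thesis using K subgroup_pow_closed[OF K(1)] by blast
  next
    case False
    define i where "i = j - 1"
    have i: "j = Suc i" "k0 \<le> i" "1 \<le> i" using less(2) k0 by (auto simp: i_def)
    obtain a where a: "a \<in> P i" "a \<notin> P (Suc i)" using P_new[of i] i False r by auto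
    have ac: "a \<in> carrier G" using a i P_in_carrier by blast
    define D where "D = (\<lambda>x. cmt G x s)"
    have Da: "D a \<in> P j" "D a \<notin> P (Suc j)"
      using cmt_P[OF i(3) a(1) s] uni[of i a] a i False by (auto simp: D_def)
    have DP: "(D ^^ l) a \<in> P (i + l)" for l
      unfolding D_def using i a s by (intro funpow_cmt_in_P) auto
    have IH: "c [^] p \<in> P (min (l + p - 1) r)" if "j < l" "c \<in> P l" for l c
      using that less False by (intro less(1)) auto
    have "(D ^^ l) a [^] p \<in> ?K" if "2 \<le> l" for l
    proof -
      have "(D ^^ l) a [^] p \<in> P (min (i + l + p - 1) r)"
        using that i by (intro IH DP) auto
      moreover have "P (min (i + l + p - 1) r) \<subseteq> ?K"
        using that i r p2 by (intro P_antimono) auto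
      ultimately show ?thesis by blast
    qed
    then have rel: "(D a [^] p) \<otimes> (D ^^ p) a \<in> ?K"
      unfolding D_def using a i P_antimono[of k0 i] k0 r s ab sp K
      by (intro pow_cmt_relation[of "P r" k0 s ?K a]) (auto intro: P_normal)
    have "(D ^^ p) a \<in> ?K"
    proof -
      have "P (i + p) \<subseteq> ?K" using i r p2 by (intro P_antimono) auto
      then show ?thesis using DP[of p] by blast
    qed
    moreover have "D a \<in> carrier G" "(D ^^ p) a \<in> carrier G"
      using Da DP[of p] i P_in_carrier by (metis le_add1 le_trans i(3) le_SucI)+
    ultimately have DaK: "D a [^] p \<in> ?K"
      using subgroup_mult_cancel(1)[OF K(1) _ _ rel] by simp
    \<comment> \<open>The elements with p-th power in \<open>?K\<close> form a subgroup containing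
      \<open>P (j + 1)\<close> and the new element \<open>D a\<close>.\<close>
    have "P j \<subseteq> {b \<in> P k0. b [^] p \<in> ?K}"
    proof (rule P_le_if_new[OF _ Da])
      show "1 \<le> j" using i by simp
      show "subgroup {b \<in> P k0. b [^] p \<in> ?K} G"
        using ab r k0 K by (intro subgroup_pow_mem) (auto intro: P_normal P_subgroup)
      have sub: "P j \<subseteq> P k0" "P (Suc j) \<subseteq> P k0" using P_antimono[of k0 j] P_antimono[of k0 "Suc j"] less(2) k0 by auto
      have "P (min (Suc j + p - 1) r) \<subseteq> ?K" using less r p2 by (intro P_antimono) auto
      then show "P (Suc j) \<subseteq> {b \<in> P k0. b [^] p \<in> ?K}" using IH[of "Suc j"] sub by auto
      show "D a \<in> {b \<in> P k0. b [^] p \<in> ?K}" using Da DaK sub by auto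
    qed
    then show ?thesis using less by blast
  qed
qed

end

text \<open>Blackburn's theorem on two-step centralizers, by contradiction: \<open>q\<close> is the least level at which
  \<open>P 1\<close> does not centralize \<open>P q / P (q + 2)\<close>.\<close>

locale exceptional_level = pchain +
  fixes q :: nat
  assumes q3: "3 \<le> q" and qn: "q + 3 \<le> n"
    and below: "1 \<le> j \<Longrightarrow> j < q \<Longrightarrow> com_in G (P j) (P 1) (P (j + 2))"
    and at_q: "\<not> com_in G (P q) (P 1) (P (q + 2))"
begin

text \<open>Below \<open>q\<close> the commutator with \<open>P 1\<close> gains one level more than
  usual, and the three subgroups lemma spreads this gain to every pair of weight at most
  \<open>q\<close>.\<close>

lemma com_in_P_P_Suc:
  assumes "1 \<le> i" "1 \<le> j" "i + j \<le> q"
  shows "com_in G (P i) (P j) (P (Suc (i + j)))"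
  using assms
proof (induction i arbitrary: j rule: dec_induct)
  case base
  then show ?case using com_in_P_sym[OF below[of j]] by simp
next
  case (step i)
  have "com_in G (P (Suc j)) (P i) (P (Suc (Suc i + j)))" "com_in G (P j) (P i) (P (Suc (i + j)))"
    using step com_in_P_sym[OF step(3)[of "Suc j"]] com_in_P_sym[OF step(3)[of j]] by auto
  then show ?case using step by (intro com_in_P_step[of i j "Suc (i + j)"]) auto
qed

text \<open>Failure at \<open>(1, q)\<close> spreads over all pairs of weight \<open>q + 1\<close>:
  if the pair \<open>(i + 1, j)\<close> behaved well, the three subgroups lemma would make
  \<open>(i, j + 1)\<close> behave well too.\<close>

lemma not_com_in_P_P:
  assumes "1 \<le> i" "1 \<le> j" "i + j = q + 1"
  shows "\<not> com_in G (P i) (P j) (P (q + 2))"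
  using assms
proof (induction i arbitrary: j rule: dec_induct)
  case base
  then show ?case using at_q com_in_P_sym[of 1 q "q + 2"] q3 by auto
next
  case (step i)
  show ?case
  proof
    assume c: "com_in G (P (Suc i)) (P j) (P (q + 2))"
    have "com_in G (P (Suc j)) (P i) (P (q + 2))"
      using step c com_in_P_P_Suc[of i j] by (intro com_in_P_step[of j i "q + 1"]) auto
    then show False using step(3)[of "Suc j"] step com_in_P_sym[of "Suc j" i "q + 2"] by simp
  qed
qed

text \<open>For odd \<open>q\<close> the pair \<open>(k, k)\<close> has weight \<open>q + 1\<close>,
  and \<open>P k\<close> is cyclic modulo \<open>P (k + 1)\<close>, so its commutators drop one
  level further.\<close>

lemma q_even: "even q"
proof (rule ccontr)
  assume "odd q"
  then obtain k where k: "q + 1 = k + k" by (metis even_plus_one_iff evenE mult_2)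
  have "com_in G (P k) (P (Suc k)) (P (q + 2))"
    using com_in_P_P[of k "Suc k"] k q3 by (simp add: numeral_2_eq_2)
  then have "com_in G (P k) (P k) (P (q + 2))"
    using k q3 by (intro com_in_self P_normal) auto
  then show False using not_com_in_P_P[of k k] k q3 by simp
qed

text \<open>\<open>P (q + 1)\<close> is generated modulo \<open>P (q + 2)\<close> by a commutator of
  \<open>P 2\<close> with \<open>P (q - 1)\<close>. This splitting of the weight is chosen because
  both factors lie below \<open>q\<close>, so that each of them gains a level when commuted with
  \<open>P 1\<close>.\<close>

lemma com_in_P_Suc_q: "com_in G (P (q + 1)) (P 1) (P (q + 3))"
proof -
  have "\<not> com_in G (P 2) (P (q - 1)) (P (q + 2))"
    using q3 by (intro not_com_in_P_P) simp_all
  then obtain x y where xy: "x \<in> P 2" "y \<in> P (q - 1)" "cmt G x y \<notin> P (q + 2)"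
    unfolding com_in_def by blast
  have u: "cmt G x y \<in> P (q + 1)"
    using com_in_P_P[of 2 "q - 1"] q3 xy by (auto simp: com_in_def)
  have "com_in G (commutator_subgroup G (P 2) (P (q - 1))) (P 1) (P (q + 3))"
  proof (rule three_subgroups)
    show "com_in G (P (q - 1)) (P 1) (P (q + 1))" using below[of "q - 1"] q3 by simp
    show "com_in G (P (q + 1)) (P 2) (P (q + 3))"
      using com_in_P_P[of "q + 1" 2] by (simp add: numeral_3_eq_3)
    show "com_in G (P 1) (P 2) (P 4)" using com_in_P_sym[OF below[of 2]] q3 by simp
    show "com_in G (P 4) (P (q - 1)) (P (q + 3))" using com_in_P_P[of 4 "q - 1"] q3 by (simp add: add.commute)
  qed (use q3 in \<open>auto simp: P_normal P_subgroup\<close>)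
  moreover have "cmt G x y \<in> commutator_subgroup G (P 2) (P (q - 1))"
    using xy by (intro cmt_in_commutator_subgroup)
  ultimately have "com_in G {cmt G x y} (P 1) (P (q + 3))" by (simp add: com_in_def)
  moreover have "com_in G (P (Suc (q + 1))) (P 1) (P (q + 3))"
    using com_in_P_P[of "q + 2" 1] by (simp add: numeral_3_eq_3)
  ultimately show ?thesis
    using u xy by (intro com_in_new[of "q + 1" "cmt G x y"]) (auto simp: P_normal P_carrier)
qed

text \<open>The power relation for commutator sequences, read modulo \<open>P (q + 3)\<close> with
  \<open>k = q / 2\<close>, kills the \<open>k\<close>-th power of
  \<open>w = [[a 1, a q], s]\<close>. But \<open>w\<close> is nontrivial there and \<open>G\<close>
  is a p-group.\<close>

lemma prime_dvd_half: "p dvd q div 2"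
proof (rule ccontr)
  assume ndvd: "\<not> p dvd q div 2"
  obtain k where k: "q = 2 * k" using q_even by blast
  have k2: "2 \<le> k" using k q3 by simp
  let ?N = "P (q + 3)"
  have N: "?N \<lhd> G" by (simp add: P_normal)
  interpret h: group_hom G "G Mod ?N" "\<lambda>x. ?N #> x" using N by (rule rcos_hom)
  obtain s where s: "s \<in> carrier G" "s \<notin> P 1" using carrier_new by blast
  obtain s1 where s1: "s1 \<in> P 1" "s1 \<notin> P 2" using P_new[of 1] qn by (auto simp: numeral_2_eq_2)
  define a where "a i = ((\<lambda>x. cmt G x s) ^^ (i - 1)) s1" for i
  have a1: "a 1 = s1" by (simp add: a_def)
  have aS: "a (Suc i) = cmt G (a i) s" if "1 \<le> i" for i
    using that by (cases i) (auto simp: a_def)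
  have aP: "a i \<in> P i" if "1 \<le> i" for i
    using funpow_cmt_in_P[of 1 s1 s "i - 1"] that s1 s by (simp add: a_def)
  have ac: "a i \<in> carrier G" if "1 \<le> i" for i
    using aP[OF that] P_in_carrier[OF that] by blast
  have anew: "a i \<notin> P (Suc i)" if "1 \<le> i" "i \<le> q" for i
    using that
  proof (induction i rule: dec_induct)
    case base
    then show ?case using s1 a1 by (simp add: numeral_2_eq_2)
  next
    case (step i)
    then show ?case
      using uniserial_step[of i "a i" s] below[of i] aP[of i] aS[of i] s qn by simp
  qed
  define u where "u = cmt G (a 1) (a q)"
  have uP: "u \<in> P (q + 1)"
    using com_in_P_P[of 1 q] aP[of 1] aP[of q] q3 by (auto simp: com_in_def u_def)
  \<comment> \<open>\<open>a 1\<close> and \<open>a q\<close> generate their levels modulo the next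
    ones, so triviality of their commutator modulo \<open>P (q + 2)\<close> would pass to
    \<open>[P q, P 1]\<close>.\<close>
  have unew: "u \<notin> P (q + 2)"
  proof
    assume "u \<in> P (q + 2)"
    then have "com_in G {a 1} {a q} (P (q + 2))" by (simp add: com_in_def u_def)
    moreover have "com_in G (P (Suc 1)) {a q} (P (q + 2))"
      using com_in_P_P[of 2 q] aP[of q] q3 by (auto simp: com_in_def numeral_2_eq_2)
    ultimately have "com_in G (P 1) {a q} (P (q + 2))"
      using aP[of 1] anew[of 1] ac[of q] q3 by (intro com_in_new[of 1 "a 1"]) (auto intro: P_normal)
    then have "com_in G {a q} (P 1) (P (q + 2))"
      by (rule com_in_sym) (use ac[of q] q3 P_carrier[of 1] P_subgroup[of "q + 2"] in simp_all)
    moreover have "com_in G (P (Suc q)) (P 1) (P (q + 2))"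
      using com_in_P_P[of "Suc q" 1] by simp
    ultimately have "com_in G (P q) (P 1) (P (q + 2))"
      using aP[of q] anew[of q] q3 by (intro com_in_new[of q "a q"]) (auto simp: P_normal P_carrier)
    then show False using at_q by blast
  qed
  define w where "w = cmt G u s"
  have wc: "w \<in> carrier G" using uP s P_in_carrier[of "q + 1" u] by (simp add: w_def)
  have wnew: "w \<notin> ?N"
    using uniserial_step[of "q + 1" u s] com_in_P_Suc_q qn uP unew s by (simp add: w_def numeral_3_eq_3)
  define t where "t i = ?N #> a i" for i
  have comm: "(?N #> x) \<otimes>\<^bsub>G Mod ?N\<^esub> (?N #> y) = (?N #> y) \<otimes>\<^bsub>G Mod ?N\<^esub> (?N #> x)"
    if "cmt G x y \<in> ?N" "x \<in> carrier G" "y \<in> carrier G" for x y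
    using commute_rcos[of "{x}" "{y}" ?N x y] that N by (simp add: com_in_def)
  have tt: "cmt (G Mod ?N) (t i) (t j) = ?N #> cmt G (a i) (a j)" if "1 \<le> i" "1 \<le> j" for i j
    using that ac by (simp add: t_def h.hom_cmt)
  have aaP: "cmt G (a i) (a j) \<in> P r" if "1 \<le> i" "1 \<le> j" "r \<le> i + j" "1 \<le> r" for i j r
    using com_in_P_P[OF that(1,2)] aP that P_antimono[OF that(4,3)] by (auto simp: com_in_def)
  have aaP': "cmt G (a i) (a j) \<in> P (q + 1)" if "1 \<le> i" "1 \<le> j" "i + j = q" for i j
    using com_in_P_P_Suc[OF that(1,2)] aP that by (auto simp: com_in_def)
  have aac: "cmt G (a i) (a j) \<in> carrier G" if "1 \<le> i" "1 \<le> j" for i j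
    using that ac by simp
  have "cmt (G Mod ?N) (cmt (G Mod ?N) (t 1) (t (2 * k))) (?N #> s) [^]\<^bsub>G Mod ?N\<^esub> k = \<one>\<^bsub>G Mod ?N\<^esub>"
  proof (rule h.H.cmt_sequence_pow)
    show "t i \<in> carrier (G Mod ?N)" if "1 \<le> i" for i
      using that ac h.hom_closed by (simp add: t_def)
    show "?N #> s \<in> carrier (G Mod ?N)" using s h.hom_closed by blast
    show "t (Suc i) = cmt (G Mod ?N) (t i) (?N #> s)" if "1 \<le> i" for i
      using that ac s aS by (simp add: t_def h.hom_cmt)
    show "cmt (G Mod ?N) (t i) (t j) = \<one>\<^bsub>G Mod ?N\<^esub>" if "1 \<le> i" "1 \<le> j" "i + j = 2 * k + 3" for i j
      unfolding tt[OF that(1,2)] using that k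
      by (subst rcos_eq_one_iff[OF N]) (auto intro: aaP aac)
    show "t l \<otimes>\<^bsub>G Mod ?N\<^esub> cmt (G Mod ?N) (t i) (t j) = cmt (G Mod ?N) (t i) (t j) \<otimes>\<^bsub>G Mod ?N\<^esub> t l"
      if ij: "1 \<le> i" "1 \<le> j" "i + j \<in> {2 * k, 2 * k + 1, 2 * k + 2}" "1 \<le> l" for i j l
    proof -
      \<comment> \<open>Weight \<open>q\<close> would only give \<open>P q\<close>; the extra level
        comes from minimality of \<open>q\<close>. On \<open>P (q + 1)\<close> the action of
        \<open>P 1\<close> is trivial modulo \<open>P (q + 3)\<close>.\<close>
      have "cmt G (a i) (a j) \<in> P (q + 1)"
        using aaP[of i j "q + 1"] aaP'[of i j] ij k by auto
      moreover have "a l \<in> P 1" using aP[OF ij(4)] P_antimono[of 1 l] ij by auto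
      ultimately have "cmt G (cmt G (a i) (a j)) (a l) \<in> ?N"
        using com_in_P_Suc_q by (auto simp: com_in_def)
      then show ?thesis
        unfolding tt[OF ij(1,2)] using comm ij ac aac by (simp add: t_def)
    qed
    show "(?N #> s) \<otimes>\<^bsub>G Mod ?N\<^esub> cmt (G Mod ?N) (t i) (t j) = cmt (G Mod ?N) (t i) (t j) \<otimes>\<^bsub>G Mod ?N\<^esub> (?N #> s)"
      if ij: "1 \<le> i" "1 \<le> j" "i + j = 2 * k + 2" for i j
    proof -
      have "cmt G (cmt G (a i) (a j)) s \<in> P (Suc (q + 2))"
        using aaP[of i j "q + 2"] ij k s by (intro cmt_P) auto
      then show ?thesis
        unfolding tt[OF ij(1,2)] using comm[of "cmt G (a i) (a j)" s] ij s aac by (simp add: numeral_3_eq_3)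
    qed
    show "(?N #> s) \<otimes>\<^bsub>G Mod ?N\<^esub> cmt (G Mod ?N) (cmt (G Mod ?N) (t i) (t j)) (?N #> s) =
        cmt (G Mod ?N) (cmt (G Mod ?N) (t i) (t j)) (?N #> s) \<otimes>\<^bsub>G Mod ?N\<^esub> (?N #> s)"
      if ij: "1 \<le> i" "1 \<le> j" "i + j = 2 * k" for i j
    proof -
      have "cmt G (cmt G (cmt G (a i) (a j)) s) s \<in> P (Suc (Suc (q + 1)))"
        using aaP'[of i j] ij k s by (intro cmt_P) auto
      moreover have "cmt (G Mod ?N) (cmt (G Mod ?N) (t i) (t j)) (?N #> s) = ?N #> cmt G (cmt G (a i) (a j)) s"
        unfolding tt[OF ij(1,2)] using ij s aac by (simp add: h.hom_cmt)
      ultimately show ?thesis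
        using comm[of "cmt G (cmt G (a i) (a j)) s" s] ij s aac by (simp add: numeral_3_eq_3)
    qed
    show "cmt (G Mod ?N) (t 1) (t (2 * k + 1)) = \<one>\<^bsub>G Mod ?N\<^esub>"
    proof -
      have "cmt G (a (q + 1)) (a 1) \<in> ?N"
        using com_in_P_Suc_q aP[of "q + 1"] aP[of 1] by (auto simp: com_in_def)
      then have "inv (cmt G (a (q + 1)) (a 1)) \<in> ?N"
        using normal_imp_subgroup[OF N] by (simp add: subgroup.m_inv_closed)
      then have "cmt G (a 1) (a (q + 1)) \<in> ?N" using ac by (simp add: inv_cmt)
      then show ?thesis
        using tt[of 1 "q + 1"] k rcos_eq_one_iff[OF N aac[of 1 "q + 1"]] by simp
    qed
    show "1 \<le> k" using k2 by simp
  qed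
  moreover have "cmt (G Mod ?N) (cmt (G Mod ?N) (t 1) (t (2 * k))) (?N #> s) = ?N #> w"
    using tt[of 1 q] q3 s aac[of 1 q] by (simp add: k[symmetric] h.hom_cmt w_def u_def)
  ultimately have "?N #> (w [^] k) = \<one>\<^bsub>G Mod ?N\<^esub>"
    using h.hom_nat_pow[OF wc, of k] by simp
  then have "w [^] k \<in> ?N" using rcos_eq_one_iff[OF N] wc by simp
  moreover have "coprime p k" using prime_imp_coprime[OF prime_p] ndvd k by simp
  then have "coprime k (order G)" by (simp add: order_G coprime_commute)
  ultimately have "w \<in> ?N"
    using k2 wc P_subgroup[of "q + 3"] by (intro mem_of_pow_coprime[of k ?N w]) auto
  then show False using wnew by blast
qed

text \<open>If \<open>p \<le> q / 2\<close>, the lower half of the chain down to \<open>q\<close> is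
  abelian enough for the power relation: with \<open>a\<close> new at level \<open>q - p\<close> and
  \<open>t = [a, s]\<close>, the element \<open>t [^] p\<close> is new at level \<open>q\<close>.
  Commuting with \<open>P 1\<close> costs \<open>t\<close> an extra level, and taking p-th powers
  preserves this, so \<open>P 1\<close> centralizes \<open>P q / P (q + 2)\<close> after
  all.\<close>

lemma half_less_prime: "q div 2 < p"
proof (rule ccontr)
  assume "\<not> ?thesis"
  then have pk: "p \<le> q div 2" by simp
  obtain k where k: "q = 2 * k" using q_even by blast
  have pk: "p \<le> k" and k2: "2 \<le> k" using pk k q3 by auto
  have p2: "2 \<le> p" using prime_p by (rule prime_ge_2_nat)
  define L where "L = centr_mod G (P q) (P (q + 2))"
  have L: "subgroup L G" unfolding L_def using q3 by (intro centr_mod_subgroup P_normal P_carrier) auto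
  have "L \<noteq> carrier G"
  proof
    assume "L = carrier G"
    then have "com_in G (carrier G) (P q) (P (q + 2))"
      using centr_mod_subset_iff[of "carrier G" "P q" "P (q + 2)"] by (simp add: L_def)
    then have "com_in G (P q) (carrier G) (P (q + 2))"
      by (rule com_in_sym) (use q3 P_carrier[of q] P_subgroup[of "q + 2"] in simp_all)
    then show False using not_com_in_P_carrier[of q] q3 qn by simp
  qed
  \<comment> \<open>A group is not the union of two proper subgroups. Avoiding \<open>L\<close>
    makes \<open>s\<close> act uniserially at the exceptional level \<open>q\<close> as
    well.\<close>
  have "\<exists>s \<in> carrier G. s \<notin> P 1 \<and> s \<notin> L"
  proof (rule ccontr)
    assume un: "\<not> ?thesis"
    obtain x where x: "x \<in> carrier G" "x \<notin> P 1" using carrier_new by blast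
    obtain y where y: "y \<in> carrier G" "y \<notin> L"
      using \<open>L \<noteq> carrier G\<close> subgroup.subset[OF L] by blast
    have xL: "x \<in> L" and yP: "y \<in> P 1" using un x y by auto
    have "x \<otimes> y \<in> P 1 \<or> x \<otimes> y \<in> L" using un x y by auto
    then show False
    proof
      assume "x \<otimes> y \<in> P 1"
      then show False using subgroup_mult_cancel(1)[OF P_subgroup[of 1] x(1) y(1)] x yP by simp
    next
      assume "x \<otimes> y \<in> L"
      then show False using subgroup_mult_cancel(2)[OF L x(1) y(1)] y xL by simp
    qed
  qed
  then obtain s where s: "s \<in> carrier G" "s \<notin> P 1" "s \<notin> L" by blast
  have uni: "cmt G x s \<notin> P (i + 2)" if "1 \<le> i" "i \<le> q" "x \<in> P i" "x \<notin> P (Suc i)" for i x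
  proof (cases "i < q")
    case True
    then show ?thesis using that s below[of i] qn by (intro uniserial_step) auto
  next
    case False
    then have i: "i = q" using that by simp
    show ?thesis
    proof
      assume "cmt G x s \<in> P (i + 2)"
      then have "com_in G (P q) {s} (P (q + 2))"
        using that s com_in_P_carrier[of "Suc q"] i
        by (intro com_in_new[of q x "P (q + 2)"]) (auto intro: P_normal simp: com_in_def)
      then have "com_in G {s} (P q) (P (q + 2))"
        by (rule com_in_sym) (use s q3 P_carrier[of q] P_subgroup[of "q + 2"] in simp_all)
      then show False using s by (simp add: L_def centr_mod_def com_in_def)
    qed
  qed
  \<comment> \<open>\<open>s [^] p\<close> lies in \<open>P 1\<close> and commutes with
    \<open>s\<close>, which is impossible for an element whose level is at most
    \<open>q\<close>.\<close>
  have sp: "s [^] p \<in> P (q + 1)"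
  proof (rule ccontr)
    assume no: "s [^] p \<notin> P (q + 1)"
    then have "s [^] p \<noteq> \<one>" using subgroup.one_closed[OF P_subgroup[of "q + 1"]] by auto
    then obtain i where i: "1 \<le> i" "i < n" "s [^] p \<in> P i" "s [^] p \<notin> P (Suc i)"
      using level_exists[OF pow_p_in_P1[OF s(1)]] by blast
    have "i \<le> q" using no i P_antimono[of "q + 1" i] by (cases "i \<le> q") auto
    then have "cmt G (s [^] p) s \<notin> P (i + 2)" using i by (intro uni) auto
    moreover have "cmt G (s [^] p) s = \<one>"
      using s nat_pow_Suc2[of s p] by (simp add: cmt_eq_one_iff)
    ultimately show False using subgroup.one_closed[OF P_subgroup[of "i + 2"]] by simp
  qed
  have sp': "com_in G (P j) {s [^] p} (P r)" if "1 \<le> j" "r \<le> q + 2" "1 \<le> r" for j r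
  proof -
    have "com_in G (P j) (P (q + 1)) (P (j + (q + 1)))" using that by (intro com_in_P_P) auto
    moreover have "P (j + (q + 1)) \<subseteq> P r" using that by (intro P_antimono) auto
    ultimately show ?thesis using sp by (auto simp: com_in_def)
  qed
  have ab1: "com_in G (P (k + 1)) (P (k + 1)) (P (q + 2))"
    using com_in_P_P[of "k + 1" "k + 1"] k by (simp add: mult_2)
  have ab2: "com_in G (P k) (P k) (P (q + 1))"
    using com_in_P_P_Suc[of k k] k k2 by (simp add: mult_2)
  \<comment> \<open>Since \<open>p \<le> k\<close> and \<open>q = 2 k\<close>, level
    \<open>e\<close> lies in the half \<open>P k\<close> that is abelian modulo
    \<open>P (q + 1)\<close>, and \<open>p\<close> commutations with \<open>s\<close> lead from
    \<open>e\<close> exactly to \<open>q\<close>.\<close>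
  define e where "e = q - p"
  have e: "k \<le> e" "e + p = q" "e + 1 < q" using pk k k2 p2 by (auto simp: e_def)
  obtain a where a: "a \<in> P e" "a \<notin> P (Suc e)" using P_new[of e] e k2 qn by auto
  define D where "D = (\<lambda>x. cmt G x s)"
  have DP: "(D ^^ l) a \<in> P (e + l)" for l
    unfolding D_def using e k2 a s by (intro funpow_cmt_in_P) auto
  have Dnew: "(D ^^ l) a \<notin> P (Suc (e + l))" if "l \<le> p" for l
    using that
  proof (induction l)
    case (Suc l)
    then show ?case using uni[of "e + l" "(D ^^ l) a"] DP[of l] e k2 by (simp add: D_def)
  qed (use a in simp)
  define t where "t = D a"
  have tP: "t \<in> P (e + 1)" using DP[of 1] by (simp add: t_def)
  have tc: "t \<in> carrier G" using tP P_in_carrier[of "e + 1"] by simp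
  have "(D ^^ l) a [^] p \<in> P (q + 1)" if "2 \<le> l" for l
  proof -
    have "(D ^^ l) a [^] p \<in> P (min (e + l + p - 1) (q + 1))"
      using that e k2 qn s ab2 sp' DP uni by (intro pow_p_levels[of k "q + 1" s]) auto
    moreover have "min (e + l + p - 1) (q + 1) = q + 1" using e that by auto
    ultimately show ?thesis by simp
  qed
  then have rel: "(D a [^] p) \<otimes> (D ^^ p) a \<in> P (q + 1)"
    unfolding D_def using e k2 s ab2 sp' a P_antimono[of k e]
    by (intro pow_cmt_relation[of "P (q + 1)" k s "P (q + 1)" a]) (auto intro: P_normal P_subgroup)
  have Dp: "(D ^^ p) a \<in> P q" "(D ^^ p) a \<notin> P (q + 1)"
    using DP[of p] Dnew[of p] e by auto
  have Dpc: "(D ^^ p) a \<in> carrier G" using Dp P_in_carrier[of q] q3 by simp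
  have tpnew: "t [^] p \<notin> P (q + 1)"
    using subgroup_mult_cancel(2)[OF P_subgroup[of "q + 1"] _ Dpc rel] Dp tc by (auto simp: t_def)
  have tpq: "t [^] p \<in> P q"
    using subgroup_mult_cancel(1)[OF P_subgroup[of q] _ Dpc] rel P_antimono[of q "q + 1"] q3 Dp tc
    by (auto simp: t_def)
  let ?N = "P (q + 2)"
  have N: "?N \<lhd> G" by (simp add: P_normal)
  \<comment> \<open>Conjugating \<open>t [^] p\<close> by \<open>h\<close> gives
    \<open>(t \<otimes> c) [^] p\<close> with \<open>c = [t, h]\<close>, so
    \<open>[t [^] p, h]\<close> agrees with \<open>c [^] p\<close> modulo \<open>?N\<close>; and
    \<open>c\<close> lies at level \<open>e + 3\<close>, one deeper than the generic bound.\<close>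
  have "cmt G (t [^] p) h \<in> ?N" if h: "h \<in> P 1" for h
  proof -
    have hc: "h \<in> carrier G" using h P_in_carrier[of 1] by simp
    define c where "c = cmt G t h"
    have cP: "c \<in> P (e + 3)"
      using below[of "e + 1"] e tP h by (auto simp: com_in_def c_def numeral_3_eq_3)
    have cc: "c \<in> carrier G" using tc hc by (simp add: c_def)
    have "c [^] p \<in> P (min (e + 3 + p - 1) (q + 2))"
      using e k2 qn s ab1 sp' cP uni by (intro pow_p_levels[of "k + 1" "q + 2" s]) auto
    moreover have "min (e + 3 + p - 1) (q + 2) = q + 2" using e by auto
    ultimately have cp: "c [^] p \<in> ?N" by simp
    have "t \<in> P (k + 1)" "c \<in> P (k + 1)"
      using tP cP e P_antimono[of "k + 1" "e + 1"] P_antimono[of "k + 1" "e + 3"] by auto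
    then have "?N #> ((t \<otimes> c) [^] p) = ?N #> ((t [^] p) \<otimes> (c [^] p))"
      using P_carrier[of "k + 1"] by (intro rcos_pow_mult[OF ab1 N]) simp_all
    moreover have "(t \<otimes> c) [^] p = (t [^] p) \<otimes> cmt G (t [^] p) h"
      using conj_nat_pow[OF tc hc, of p] tc hc by (simp add: conj_eq_cmt c_def)
    ultimately have eq: "?N #> ((t [^] p) \<otimes> cmt G (t [^] p) h) = ?N #> ((t [^] p) \<otimes> (c [^] p))" by simp
    interpret h: group_hom G "G Mod ?N" "\<lambda>x. ?N #> x" using N by (rule rcos_hom)
    have m: "?N #> (t [^] p) \<in> carrier (G Mod ?N)" "?N #> cmt G (t [^] p) h \<in> carrier (G Mod ?N)"
      "?N #> (c [^] p) \<in> carrier (G Mod ?N)"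
      by (intro h.hom_closed cmt_closed nat_pow_closed tc hc cc)+
    have "(?N #> (t [^] p)) \<otimes>\<^bsub>G Mod ?N\<^esub> (?N #> cmt G (t [^] p) h) =
        (?N #> (t [^] p)) \<otimes>\<^bsub>G Mod ?N\<^esub> (?N #> (c [^] p))"
      using eq tc hc cc h.hom_mult[of "t [^] p" "cmt G (t [^] p) h"] h.hom_mult[of "t [^] p" "c [^] p"] by simp
    then have "?N #> cmt G (t [^] p) h = ?N #> (c [^] p)"
      using h.H.Units_l_cancel[OF _ m(2,3)] m(1) unfolding h.H.Units_eq by blast
    then show ?thesis
      by (intro mem_of_rcos_eq[OF N normal_imp_subgroup[OF N] _ cp]) (use tc hc in auto)
  qed
  then have "com_in G {t [^] p} (P 1) ?N" by (simp add: com_in_def)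
  moreover have "com_in G (P (Suc q)) (P 1) ?N" using com_in_P_P[of "Suc q" 1] by simp
  ultimately have "com_in G (P q) (P 1) ?N"
    using tpq tpnew q3 N by (intro com_in_new[of q "t [^] p"]) (auto simp: P_carrier)
  then show False using at_q by blast
qed

lemma exceptional_level_False: False
  using dvd_imp_le[OF prime_dvd_half] half_less_prime q3 by simp

end

text \<open>The least failing level would be an \<open>exceptional_level\<close>: it is not 1
  because \<open>[P 1, P 1] \<le> P 3\<close>, and the two hypotheses exclude 2 and
  \<open>n - 2\<close>.\<close>

lemma (in pchain) com_in_P_P1:
  assumes 2: "com_in G (P 2) (P 1) (P 4)" and last: "com_in G (P (n - 2)) (P 1) {\<one>}"
    and i: "1 \<le> i" "i + 2 \<le> n"
  shows "com_in G (P i) (P 1) (P (i + 2))"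
proof (rule ccontr)
  assume no: "\<not> ?thesis"
  define q where "q = (LEAST j. 1 \<le> j \<and> \<not> com_in G (P j) (P 1) (P (j + 2)))"
  have q: "1 \<le> q" "\<not> com_in G (P q) (P 1) (P (q + 2))"
    using LeastI[of "\<lambda>j. 1 \<le> j \<and> \<not> com_in G (P j) (P 1) (P (j + 2))" i] no i by (auto simp: q_def)
  have below: "com_in G (P j) (P 1) (P (j + 2))" if "1 \<le> j" "j < q" for j
    using not_less_Least[of j "\<lambda>j. 1 \<le> j \<and> \<not> com_in G (P j) (P 1) (P (j + 2))"] that by (auto simp: q_def)
  have "q \<le> i" using below i no by (metis not_le)
  moreover have "q \<noteq> 1" using q(2) com_in_P1_P1 by (auto simp: numeral_3_eq_3)
  moreover have "q \<noteq> 2" using q(2) 2 by auto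
  moreover have "q \<noteq> n - 2"
  proof
    assume qn: "q = n - 2"
    then have "P (q + 2) = {\<one>}" using i by (intro P_trivial) simp
    then show False using q last qn by simp
  qed
  ultimately have "exceptional_level G p n P q"
    using q below i by (intro exceptional_level.intro exceptional_level_axioms.intro pchain_axioms) auto
  then show False by (rule exceptional_level.exceptional_level_False)
qed

section \<open>Self-similarity and simple virtual endomorphisms\<close>

definition simple_endo :: "('a, 'b) monoid_scheme \<Rightarrow> 'a set \<Rightarrow> ('a \<Rightarrow> 'a) \<Rightarrow> bool"
  where "simple_endo G H \<phi> \<longleftrightarrow> \<phi> \<in> hom (G\<lparr>carrier := H\<rparr>) G \<and>
    (\<forall>K. K \<lhd> G \<and> K \<subseteq> H \<and> \<phi> ` K \<subseteq> K \<longrightarrow> K = {\<one>\<^bsub>G\<^esub>})"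

lemma tree_Aut_mult:
  assumes "g \<in> carrier (tree_Aut A)" "h \<in> carrier (tree_Aut A)"
  shows "g \<otimes>\<^bsub>tree_Aut A\<^esub> h = compose (lists A) g h"
  using assms by (simp add: tree_Aut_def BijGroup_def)

lemma tree_Aut_one: "\<one>\<^bsub>tree_Aut A\<^esub> = (\<lambda>x\<in>lists A. x)"
  by (simp add: tree_Aut_def BijGroup_def)

lemma subgroup_tree_Aut: "subgroup (carrier (tree_Aut A)) (BijGroup (lists A))"
proof (rule group.subgroupI[OF group_BijGroup])
  let ?B = "BijGroup (lists A)"
  have sub: "g \<in> Bij (lists A)" if "g \<in> carrier (tree_Aut A)" for g
    using that by (simp add: tree_Aut_def)
  then show "carrier (tree_Aut A) \<subseteq> carrier ?B" by (auto simp: BijGroup_def)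
  have "(\<lambda>x\<in>lists A. x) \<in> carrier (tree_Aut A)"
    by (simp add: tree_Aut_def id_Bij)
  then show "carrier (tree_Aut A) \<noteq> {}" by blast
  show "inv\<^bsub>?B\<^esub> g \<in> carrier (tree_Aut A)" if "g \<in> carrier (tree_Aut A)" for g
    using tree_Aut_inv[OF that] sub[OF that] by (simp add: inv_BijGroup)
  show "g \<otimes>\<^bsub>?B\<^esub> h \<in> carrier (tree_Aut A)"
    if "g \<in> carrier (tree_Aut A)" "h \<in> carrier (tree_Aut A)" for g h
  proof -
    have "compose (lists A) g h \<in> Bij (lists A)" using that sub by (intro compose_Bij)
    moreover have "adjacent (compose (lists A) g h u) (compose (lists A) g h w) \<longleftrightarrow> adjacent u w"
      if "u \<in> lists A" "w \<in> lists A" for u w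
      using tree_AutD(2,3)[OF \<open>h \<in> _\<close>] tree_AutD(2)[OF \<open>g \<in> _\<close>] that by (simp add: compose_eq)
    ultimately have "compose (lists A) g h \<in> carrier (tree_Aut A)" by (simp add: tree_Aut_def)
    then show ?thesis using sub that by (simp add: BijGroup_def)
  qed
qed

lemma group_tree_Aut: "group (tree_Aut A)"
  using group.subgroup_imp_group[OF group_BijGroup subgroup_tree_Aut]
  by (simp add: tree_Aut_def)

lemma tree_section_props:
  assumes "g \<in> carrier (tree_Aut A)" "finite A" "u \<in> lists A"
  shows "tree_section A g u \<in> carrier (tree_Aut A)"
    "\<And>v. v \<in> lists A \<Longrightarrow> g (u @ v) = g u @ tree_section A g u v"
  using theI'[OF tree_section_unique[OF assms]] unfolding tree_section_def by auto

text \<open>Actions occur here as plain functions; restricting them to \<open>E\<close> makes them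
  extensional, as elements of \<open>BijGroup E\<close> have to be.\<close>

lemma (in group) orbit_stabilizer_card:
  fixes a :: "'a \<Rightarrow> 'c \<Rightarrow> 'c"
  assumes closed: "\<And>g x. g \<in> carrier G \<Longrightarrow> x \<in> E \<Longrightarrow> a g x \<in> E"
    and one: "\<And>x. x \<in> E \<Longrightarrow> a \<one> x = x"
    and mult: "\<And>g h x. g \<in> carrier G \<Longrightarrow> h \<in> carrier G \<Longrightarrow> x \<in> E \<Longrightarrow> a (g \<otimes> h) x = a g (a h x)"
    and x: "x \<in> E"
  shows "card ((\<lambda>g. a g x) ` carrier G) * card {g \<in> carrier G. a g x = x} = order G"
proof -
  let ?\<phi> = "\<lambda>g. restrict (a g) E"
  have inv: "a (inv g) (a g y) = y" "a g (a (inv g) y) = y" if "g \<in> carrier G" "y \<in> E" for g y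
    using that one mult[of "inv g" g y] mult[of g "inv g" y] by auto
  have bij: "?\<phi> g \<in> Bij E" if "g \<in> carrier G" for g
  proof -
    have "bij_betw (a g) E E"
      by (rule bij_betw_byWitness[of _ "a (inv g)"]) (use that inv closed in auto)
    then show ?thesis by (simp add: Bij_def bij_betw_restrict_eq)
  qed
  have hom: "?\<phi> \<in> hom G (BijGroup E)"
  proof (rule homI)
    fix g h assume gh: "g \<in> carrier G" "h \<in> carrier G"
    have "?\<phi> (g \<otimes> h) = compose E (?\<phi> g) (?\<phi> h)"
      by (rule ext) (use gh closed mult in \<open>auto simp: compose_def restrict_def\<close>)
    then show "?\<phi> (g \<otimes> h) = ?\<phi> g \<otimes>\<^bsub>BijGroup E\<^esub> ?\<phi> h"
      using gh bij by (simp add: BijGroup_def)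
  qed (use bij in \<open>simp add: BijGroup_def\<close>)
  interpret group_action G E ?\<phi>
    by (intro group_action.intro group_hom.intro group_hom_axioms.intro is_group group_BijGroup hom)
  have "orbit G ?\<phi> x = (\<lambda>g. a g x) ` carrier G" using x by (auto simp: orbit_def)
  moreover have "stabilizer G ?\<phi> x = {g \<in> carrier G. a g x = x}" using x by (auto simp: stabilizer_def)
  ultimately show ?thesis using orbit_stabilizer_theorem[OF x] by simp
qed

text \<open>The induced action of \<open>G\<close> on the tree and the sections: \<open>\<alpha> g\<close> is the permutation of the first
  level and \<open>\<sigma> g i\<close> the section at the vertex \<open>i\<close>.\<close>

lemma self_similar_imp_sections:
  fixes G :: "('a, 'b) monoid_scheme" (structure)
  assumes G: "group G" and ss: "self_similar p G"
  obtains \<theta> :: "'a \<Rightarrow> nat list \<Rightarrow> nat list" and \<alpha> :: "'a \<Rightarrow> nat \<Rightarrow> nat" and \<sigma> :: "'a \<Rightarrow> nat \<Rightarrow> 'a"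
  where "\<And>g h w. g \<in> carrier G \<Longrightarrow> h \<in> carrier G \<Longrightarrow> w \<in> lists {..<p} \<Longrightarrow> \<theta> (g \<otimes> h) w = \<theta> g (\<theta> h w)"
    and "\<And>g h. g \<in> carrier G \<Longrightarrow> h \<in> carrier G \<Longrightarrow> (\<forall>w \<in> lists {..<p}. \<theta> g w = \<theta> h w) \<Longrightarrow> g = h"
    and "\<And>w. w \<in> lists {..<p} \<Longrightarrow> \<theta> \<one> w = w"
    and "\<And>g. g \<in> carrier G \<Longrightarrow> \<theta> g [] = []"
    and "\<And>g w. g \<in> carrier G \<Longrightarrow> w \<in> lists {..<p} \<Longrightarrow> \<theta> g w \<in> lists {..<p}"
    and "\<And>g i w. g \<in> carrier G \<Longrightarrow> i < p \<Longrightarrow> w \<in> lists {..<p} \<Longrightarrow> \<theta> g (i # w) = \<alpha> g i # \<theta> (\<sigma> g i) w"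
    and "\<And>g i. g \<in> carrier G \<Longrightarrow> i < p \<Longrightarrow> \<alpha> g i < p"
    and "\<And>g i. g \<in> carrier G \<Longrightarrow> i < p \<Longrightarrow> \<sigma> g i \<in> carrier G"
proof -
  interpret group G by (rule G)
  let ?A = "{..<p}" and ?T = "tree_Aut {..<p}"
  obtain S where S: "self_similar_subgroup ?A S" and iso: "G \<cong> ?T\<lparr>carrier := S\<rparr>"
    using ss by (auto simp: self_similar_def)
  then obtain \<theta> where \<theta>: "\<theta> \<in> iso G (?T\<lparr>carrier := S\<rparr>)" by (auto simp: is_iso_def)
  have Ssub: "S \<subseteq> carrier ?T"
    using S by (auto simp: self_similar_subgroup_def subgroup.subset)
  have bij: "bij_betw \<theta> (carrier G) S" using \<theta> by (simp add: iso_def)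
  have \<theta>T: "\<theta> g \<in> carrier ?T" "\<theta> g \<in> S" if "g \<in> carrier G" for g
    using bij that Ssub by (auto simp: bij_betw_def)
  have mult: "\<theta> (g \<otimes> h) = compose (lists ?A) (\<theta> g) (\<theta> h)" if "g \<in> carrier G" "h \<in> carrier G" for g h
    using \<theta> that \<theta>T tree_Aut_mult[of "\<theta> g" ?A "\<theta> h"] by (auto simp: iso_def hom_def)
  define \<alpha> where "\<alpha> g i = hd (\<theta> g [i])" for g i
  define \<sigma> where "\<sigma> g i = inv_into (carrier G) \<theta> (tree_section ?A (\<theta> g) [i])" for g i
  have sec: "tree_section ?A (\<theta> g) [i] \<in> S" if "g \<in> carrier G" "i < p" for g i
    using S \<theta>T[OF that(1)] that by (auto simp: self_similar_subgroup_def)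
  have \<sigma>c: "\<sigma> g i \<in> carrier G" and \<theta>\<sigma>: "\<theta> (\<sigma> g i) = tree_section ?A (\<theta> g) [i]"
    if "g \<in> carrier G" "i < p" for g i
    using sec[OF that] bij by (auto simp: \<sigma>_def bij_betw_def inv_into_into f_inv_into_f)
  have one: "\<exists>j. j < p \<and> \<theta> g [i] = [j]" if g: "g \<in> carrier G" and i: "i < p" for g i
  proof -
    obtain w where "w \<in> lists ?A" "length w = 1" "\<theta> g ([] @ [i]) = \<theta> g [] @ w"
      using tree_Aut_prefix[OF \<theta>T(1)[OF g], of "[]" "[i]"] i by auto
    moreover have "\<theta> g [] = []" using tree_Aut_root[OF \<theta>T(1)[OF g]] by simp
    ultimately show ?thesis by (cases w) auto
  qed
  show thesis
  proof (rule that[of \<theta> \<alpha> \<sigma>])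
    show "\<theta> (g \<otimes> h) w = \<theta> g (\<theta> h w)" if "g \<in> carrier G" "h \<in> carrier G" "w \<in> lists {..<p}" for g h w
      using that mult by (simp add: compose_def)
    show "g = h" if "g \<in> carrier G" "h \<in> carrier G" "\<forall>w \<in> lists {..<p}. \<theta> g w = \<theta> h w" for g h
    proof -
      have "\<theta> g = \<theta> h"
        using that(3) tree_AutD(4)[OF \<theta>T(1)[OF that(1)]] tree_AutD(4)[OF \<theta>T(1)[OF that(2)]]
        by (intro extensionalityI[of "\<theta> g" "lists ?A"]) auto
      then show ?thesis using bij that by (auto simp: bij_betw_def inj_on_def)
    qed
    show "\<theta> \<one> w = w" if w: "w \<in> lists {..<p}" for w
    proof -
      have "\<theta> \<one> (\<theta> \<one> w) = \<theta> \<one> w" using mult[of \<one> \<one>] w by (simp add: compose_def) (metis restrict_apply')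
      moreover have "\<theta> \<one> w \<in> lists ?A" by (rule tree_AutD(3)[OF \<theta>T(1)[OF one_closed] w])
      ultimately show ?thesis
        using inj_onD[OF bij_betw_imp_inj_on[OF tree_AutD(1)[OF \<theta>T(1)[OF one_closed]]]] w by blast
    qed
    show "\<theta> g [] = []" if "g \<in> carrier G" for g using tree_Aut_root[OF \<theta>T(1)[OF that]] by simp
    show "\<theta> g w \<in> lists {..<p}" if "g \<in> carrier G" "w \<in> lists {..<p}" for g w
      using tree_AutD(3)[OF \<theta>T(1)[OF that(1)] that(2)] .
    show "\<theta> g (i # w) = \<alpha> g i # \<theta> (\<sigma> g i) w" if "g \<in> carrier G" "i < p" "w \<in> lists {..<p}" for g i w
    proof -
      have "\<theta> g ([i] @ w) = \<theta> g [i] @ tree_section ?A (\<theta> g) [i] w"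
        using that by (intro tree_section_props(2) \<theta>T) auto
      then show ?thesis using one[OF that(1,2)] \<theta>\<sigma>[OF that(1,2)] by (auto simp: \<alpha>_def)
    qed
    show "\<alpha> g i < p" if "g \<in> carrier G" "i < p" for g i using one[OF that] by (auto simp: \<alpha>_def)
    show "\<sigma> g i \<in> carrier G" if "g \<in> carrier G" "i < p" for g i using \<sigma>c[OF that] .
  qed
qed

lemma prime_power_le_prime:
  assumes "Factorial_Ring.prime (p::nat)" "m dvd p ^ n" "m \<le> p"
  shows "m = 1 \<or> m = p"
proof -
  obtain j where j: "m = p ^ j" using assms divides_primepow_nat by blast
  have p1: "p > 1" using assms(1) by (rule prime_gt_1_nat)
  then have "j \<le> 1" using assms(3) j by (metis power_one_right power_increasing_iff)
  then show ?thesis using j by (cases j) auto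
qed

text \<open>\<open>H\<close> is the stabilizer of the vertex \<open>0\<close> and
  \<open>\<phi>\<close> the section there. As \<open>G\<close> is a p-group, \<open>H\<close> fixes
  the whole first level and \<open>G\<close> permutes that level transitively. Transitivity and
  normality turn invariance of \<open>K\<close> under \<open>\<phi>\<close> into invariance under
  all sections, so \<open>K\<close> acts trivially on the tree.\<close>

lemma simple_endo_of_self_similar:
  fixes G :: "('a, 'b) monoid_scheme" (structure)
  assumes G: "group G" and p: "Factorial_Ring.prime (p::nat)" and ord: "order G = p ^ n" and n: "n \<ge> 1"
    and ss: "self_similar p G"
  obtains H \<phi> where "H \<lhd> G" "order G = p * card H" "simple_endo G H \<phi>"
proof -
  interpret group G by (rule G)
  let ?A = "{..<p}"
  obtain \<theta> \<alpha> \<sigma> where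
    mult: "\<And>g h w. g \<in> carrier G \<Longrightarrow> h \<in> carrier G \<Longrightarrow> w \<in> lists ?A \<Longrightarrow> \<theta> (g \<otimes> h) w = \<theta> g (\<theta> h w)"
    and inj: "\<And>g h. g \<in> carrier G \<Longrightarrow> h \<in> carrier G \<Longrightarrow> (\<forall>w \<in> lists ?A. \<theta> g w = \<theta> h w) \<Longrightarrow> g = h"
    and \<theta>one: "\<And>w. w \<in> lists ?A \<Longrightarrow> \<theta> \<one> w = w"
    and nil: "\<And>g. g \<in> carrier G \<Longrightarrow> \<theta> g [] = []"
    and \<theta>l: "\<And>g w. g \<in> carrier G \<Longrightarrow> w \<in> lists ?A \<Longrightarrow> \<theta> g w \<in> lists ?A"
    and cons: "\<And>g i w. g \<in> carrier G \<Longrightarrow> i < p \<Longrightarrow> w \<in> lists ?A \<Longrightarrow> \<theta> g (i # w) = \<alpha> g i # \<theta> (\<sigma> g i) w"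
    and \<alpha>p: "\<And>g i. g \<in> carrier G \<Longrightarrow> i < p \<Longrightarrow> \<alpha> g i < p"
    and \<sigma>c: "\<And>g i. g \<in> carrier G \<Longrightarrow> i < p \<Longrightarrow> \<sigma> g i \<in> carrier G"
    by (rule self_similar_imp_sections[OF G ss]) (rule that; assumption)
  have p1: "p > 1" using p by (rule prime_gt_1_nat)
  have fin: "finite (carrier G)"
    using ord p1 by (metis order_gt_0_iff_finite zero_less_power le_less_trans zero_le)
  have mult1: "\<alpha> (g \<otimes> h) i # \<theta> (\<sigma> (g \<otimes> h) i) w = \<alpha> g (\<alpha> h i) # \<theta> (\<sigma> g (\<alpha> h i) \<otimes> \<sigma> h i) w"
    if "g \<in> carrier G" "h \<in> carrier G" "i < p" "w \<in> lists ?A" for g h i w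
    using that mult[of g h "i # w"] \<alpha>p \<sigma>c \<theta>l by (simp add: cons mult)
  have \<alpha>mult: "\<alpha> (g \<otimes> h) i = \<alpha> g (\<alpha> h i)" if "g \<in> carrier G" "h \<in> carrier G" "i < p" for g h i
    using mult1[OF that, of "[]"] by simp
  have \<sigma>mult: "\<sigma> (g \<otimes> h) i = \<sigma> g (\<alpha> h i) \<otimes> \<sigma> h i" if "g \<in> carrier G" "h \<in> carrier G" "i < p" for g h i
    using that \<alpha>p \<sigma>c mult1[OF that] by (intro inj) auto
  have one_eq: "\<alpha> \<one> i = i" "\<sigma> \<one> i = \<one>" if i: "i < p" for i
  proof -
    have "\<alpha> \<one> i # \<theta> (\<sigma> \<one> i) w = i # w" if "w \<in> lists ?A" for w
      using cons[of \<one> i w] \<theta>one[of "i # w"] that i by simp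
    then have "\<alpha> \<one> i = i" "\<And>w. w \<in> lists ?A \<Longrightarrow> \<theta> (\<sigma> \<one> i) w = w" by auto
    then show "\<alpha> \<one> i = i" "\<sigma> \<one> i = \<one>" using inj[of "\<sigma> \<one> i" \<one>] \<sigma>c[of \<one> i] i \<theta>one by auto
  qed
  have \<alpha>inv: "\<alpha> (inv g) (\<alpha> g i) = i" "\<alpha> g (\<alpha> (inv g) i) = i" if "g \<in> carrier G" "i < p" for g i
    using \<alpha>mult[of "inv g" g i] \<alpha>mult[of g "inv g" i] that one_eq(1)[of i] by auto
  \<comment> \<open>The orbits of \<open>U\<close> on the other \<open>p - 1\<close> vertices have
    p-power size below \<open>p\<close>, so they are points.\<close>
  have fix_all: "\<alpha> g i = i" if U: "subgroup U G" "\<And>g. g \<in> U \<Longrightarrow> \<alpha> g 0 = 0" and g: "g \<in> U" and i: "i < p" for U g i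
  proof (cases "i = 0")
    case False
    interpret U: group "G\<lparr>carrier := U\<rparr>" using U(1) by (rule subgroup_imp_group)
    have Uc: "g \<in> carrier G" if "g \<in> U" for g using that U(1) by (rule subgroup.mem_carrier[rotated])
    have closed: "\<alpha> g j \<in> {1..<p}" if "g \<in> U" "j \<in> {1..<p}" for g j
    proof -
      have "\<alpha> g j \<noteq> 0"
      proof
        assume "\<alpha> g j = 0"
        moreover have "\<alpha> (inv g) 0 = 0" using U(2)[of "inv g"] that U(1) by (simp add: subgroup.m_inv_closed)
        ultimately show False using \<alpha>inv(1)[of g j] that Uc by auto
      qed
      then show ?thesis using \<alpha>p[of g j] that Uc by auto
    qed
    let ?O = "(\<lambda>g. \<alpha> g i) ` U"
    have "card ?O * card {g \<in> U. \<alpha> g i = i} = order (G\<lparr>carrier := U\<rparr>)"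
    proof -
      have "\<alpha> (g \<otimes> h) j = \<alpha> g (\<alpha> h j)" if "g \<in> U" "h \<in> U" "j < p" for g h j
        using that by (intro \<alpha>mult Uc)
      then have "card ((\<lambda>g. \<alpha> g i) ` carrier (G\<lparr>carrier := U\<rparr>)) *
          card {g \<in> carrier (G\<lparr>carrier := U\<rparr>). \<alpha> g i = i} = order (G\<lparr>carrier := U\<rparr>)"
        using closed i False one_eq(1)
        by (intro U.orbit_stabilizer_card[where E = "{1..<p}"]) simp_all
      then show ?thesis by simp
    qed
    then have "card ?O dvd card U"
      using dvd_triv_left[of "card ?O" "card {g \<in> U. \<alpha> g i = i}"] by (simp add: order_def)
    also have "card U dvd p ^ n"
      using card_subgroup_dvd[OF U(1) subgroup_self] subgroup.subset[OF U(1)] ord by (simp add: order_def)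
    finally have "card ?O dvd p ^ n" .
    moreover have "card ?O \<le> card {1..<p}"
      using closed i False by (intro card_mono) auto
    moreover have "card {1..<p} < p" using p1 by simp
    ultimately have "card ?O = 1" using prime_power_le_prime[OF p, of "card ?O" n] by linarith
    moreover have "\<alpha> g i \<in> ?O" "\<alpha> \<one> i \<in> ?O" using g U(1) by (auto simp: subgroup.one_closed)
    ultimately show ?thesis using one_eq(1)[OF i] by (metis card_1_singletonE singletonD)
  qed (use U g in simp)
  define H where "H = {g \<in> carrier G. \<alpha> g 0 = 0}"
  have H: "subgroup H G"
  proof (rule subgroupI)
    show "H \<noteq> {}" using one_eq(1)[of 0] p1 by (auto simp: H_def)
    show "inv g \<in> H" if "g \<in> H" for g using that \<alpha>inv(1)[of g 0] p1 by (simp add: H_def)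
    show "g \<otimes> h \<in> H" if "g \<in> H" "h \<in> H" for g h using that \<alpha>mult[of g h 0] p1 by (simp add: H_def)
  qed (auto simp: H_def)
  have Hfix: "\<alpha> h i = i" if "h \<in> H" "i < p" for h i
    by (rule fix_all[OF H _ that]) (simp add: H_def)
  have Hc: "h \<in> carrier G" if "h \<in> H" for h using that by (simp add: H_def)
  have Hn: "H \<lhd> G"
    unfolding normal_inv_iff
  proof (intro conjI ballI H)
    fix g h assume gh: "g \<in> carrier G" "h \<in> H"
    have p0: "0 < p" using p1 by simp
    have hc: "h \<in> carrier G" using gh Hc by blast
    have j: "\<alpha> (inv g) 0 < p" using gh p0 by (intro \<alpha>p) auto
    have "\<alpha> (g \<otimes> h \<otimes> inv g) 0 = \<alpha> (g \<otimes> h) (\<alpha> (inv g) 0)"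
      using gh hc p0 by (intro \<alpha>mult) auto
    also have "\<dots> = \<alpha> g (\<alpha> h (\<alpha> (inv g) 0))" by (rule \<alpha>mult[OF gh(1) hc j])
    also have "\<dots> = \<alpha> g (\<alpha> (inv g) 0)" using Hfix[OF gh(2) j] by simp
    also have "\<dots> = 0" by (rule \<alpha>inv(2)[OF gh(1) p0])
    finally show "g \<otimes> h \<otimes> inv g \<in> H" using gh(1) hc by (simp add: H_def)
  qed
  let ?O = "(\<lambda>g. \<alpha> g 0) ` carrier G"
  have card_O: "card ?O * card H = order G"
    using orbit_stabilizer_card[of ?A \<alpha> 0] \<alpha>p one_eq \<alpha>mult p1 by (simp add: H_def)
  have Osub: "?O \<subseteq> ?A" using \<alpha>p p1 by auto
  then have "card ?O \<le> p" using card_mono[of ?A ?O] by simp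
  moreover have "card ?O dvd p ^ n" using dvd_triv_left[of "card ?O" "card H"] card_O ord by simp
  ultimately have "card ?O = 1 \<or> card ?O = p" by (intro prime_power_le_prime[OF p])
  \<comment> \<open>If \<open>G\<close> fixed the vertex \<open>0\<close> it would fix the first
    level and, its sections being again in \<open>G\<close>, the whole tree; then \<open>G\<close>
    would be trivial, against \<open>n \<ge> 1\<close>.\<close>
  moreover have "card ?O \<noteq> 1"
  proof
    assume "card ?O = 1"
    moreover have "0 \<in> ?O" using one_eq(1)[of 0] p1 by (metis image_eqI one_closed gr0I not_one_less_zero)
    ultimately have "?O = {0}" by (metis card_1_singletonE singletonD)
    then have "carrier G = H" by (auto simp: H_def)
    then have triv: "\<theta> g w = w" if "g \<in> carrier G" "w \<in> lists ?A" for g w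
      using that(2,1)
    proof (induction w arbitrary: g)
      case (Cons i w)
      then show ?case using cons[of g i w] Hfix[of g i] \<sigma>c by auto
    qed (use nil in simp)
    have "g = \<one>" if "g \<in> carrier G" for g using inj[of g \<one>] that triv by simp
    then have "carrier G = {\<one>}" by auto
    then have "p ^ n = 1" using ord by (simp add: order_def)
    then show False using p1 n by simp
  qed
  ultimately have card_Op: "card ?O = p" by simp
  then have O: "?O = ?A" using Osub by (intro card_subset_eq) auto
  define \<phi> where "\<phi> g = \<sigma> g 0" for g
  show thesis
  proof (rule that[OF Hn])
    show "order G = p * card H" using card_O card_Op by simp
    show "simple_endo G H \<phi>"
      unfolding simple_endo_def
    proof (intro conjI allI impI)
      show "\<phi> \<in> hom (G\<lparr>carrier := H\<rparr>) G"
        using \<sigma>mult \<sigma>c Hc Hfix p1 by (intro homI) (auto simp: \<phi>_def)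
      fix K assume K: "K \<lhd> G \<and> K \<subseteq> H \<and> \<phi> ` K \<subseteq> K"
      \<comment> \<open>For \<open>g\<close> moving \<open>0\<close> to \<open>i\<close>, the
        section of \<open>k\<close> at \<open>i\<close> is the conjugate by
        \<open>\<sigma> g 0\<close> of the section at \<open>0\<close> of
        \<open>inv g \<otimes> k \<otimes> g\<close>.\<close>
      have \<sigma>K: "\<sigma> k i \<in> K" if k: "k \<in> K" and i: "i < p" for k i
      proof -
        have "i \<in> ?O" using O i by auto
        then obtain g where g: "g \<in> carrier G" "\<alpha> g 0 = i" by auto
        have gi: "\<alpha> (inv g) i = 0" using \<alpha>inv(1)[of g 0] g p1 by simp
        define k' where "k' = inv g \<otimes> k \<otimes> g"
        have k': "k' \<in> K" using normal_conj(1)[of K k g] K k g by (simp add: k'_def)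
        have kc: "k \<in> carrier G" "k' \<in> carrier G" using k k' K Hc by auto
        have "k = g \<otimes> (k' \<otimes> inv g)" using g kc by (simp add: k'_def m_assoc)
        then have "\<sigma> k i = \<sigma> g (\<alpha> (k' \<otimes> inv g) i) \<otimes> (\<sigma> k' (\<alpha> (inv g) i) \<otimes> \<sigma> (inv g) i)"
          using g kc i \<sigma>mult[of g "k' \<otimes> inv g" i] \<sigma>mult[of k' "inv g" i] by simp
        also have "\<alpha> (k' \<otimes> inv g) i = 0"
          using g kc i gi \<alpha>mult Hfix[of k' 0] k' K p1 by auto
        finally have 1: "\<sigma> k i = \<sigma> g 0 \<otimes> (\<phi> k' \<otimes> \<sigma> (inv g) i)" using gi by (simp add: \<phi>_def)
        have c: "\<sigma> g 0 \<in> carrier G" "\<sigma> (inv g) i \<in> carrier G" using \<sigma>c g i p1 by auto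
        have "\<sigma> g 0 \<otimes> \<sigma> (inv g) i = \<one>"
          using \<sigma>mult[of g "inv g" i] g i gi one_eq(2)[of i] by simp
        then have "\<sigma> (inv g) i = inv (\<sigma> g 0)" using c by (metis inv_equality inv_comm)
        moreover have "\<phi> k' \<in> K" using K k' by auto
        ultimately show ?thesis
          unfolding 1 using normal_conj(2)[of K "\<phi> k'" "\<sigma> g 0"] K c by (simp add: m_assoc subset_iff Hc)
      qed
      have "\<theta> k w = w" if "k \<in> K" "w \<in> lists ?A" for k w
        using that(2,1)
      proof (induction w arbitrary: k)
        case (Cons i w)
        then show ?case using cons[of k i w] Hfix[of k i] \<sigma>K[of k i] K Hc by auto
      qed (use nil K Hc in auto)
      then have "k = \<one>" if "k \<in> K" for k using inj[of k \<one>] that \<theta>one K Hc by auto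
      then show "K = {\<one>}" using K normal_imp_subgroup[of K] subgroup.one_closed[of K] by blast
    qed
  qed
qed

section \<open>From a simple virtual endomorphism to a tree action\<close>

text \<open>The vertex \<open>i\<close> of the first level stands for the coset
  \<open>s^i H\<close>. With powers of \<open>s\<close> as transversal the vertex \<open>0\<close>
  has representative \<open>\<one>\<close>, so its stabilizer is \<open>H\<close> and its section is
  \<open>\<phi>\<close>.\<close>

locale virtual_endo = group G for G (structure) +
  fixes H :: "'a set" and \<phi> :: "'a \<Rightarrow> 'a" and s :: 'a and p :: nat
  assumes H: "subgroup H G" and s: "s \<in> carrier G" and p_pos: "0 < p"
    and transversal: "g \<in> carrier G \<Longrightarrow> \<exists>!i. i < p \<and> inv (s [^] i) \<otimes> g \<in> H"
    and simple: "simple_endo G H \<phi>"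
begin

definition idx :: "'a \<Rightarrow> nat"
  where "idx g = (THE i. i < p \<and> inv (s [^] i) \<otimes> g \<in> H)"

text \<open>Writing \<open>g s^i = s^j h\<close> with \<open>h\<close> in \<open>H\<close>, the
  element \<open>g\<close> moves the vertex \<open>i\<close> to \<open>j\<close>, and its section
  there is \<open>\<phi> h\<close>.\<close>

definition sec :: "'a \<Rightarrow> nat \<Rightarrow> 'a"
  where "sec g i = \<phi> (inv (s [^] idx (g \<otimes> (s [^] i))) \<otimes> (g \<otimes> (s [^] i)))"

text \<open>The word comes first because the recursion is on it; the group element is replaced by
  its section at each letter.\<close>

primrec act :: "nat list \<Rightarrow> 'a \<Rightarrow> nat list"
  where
    "act [] g = []"
  | "act (i # w) g = idx (g \<otimes> (s [^] i)) # act w (sec g i)"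

primrec sec_word :: "nat list \<Rightarrow> 'a \<Rightarrow> 'a"
  where
    "sec_word [] g = g"
  | "sec_word (i # w) g = sec_word w (sec g i)"

lemma Hc: "h \<in> H \<Longrightarrow> h \<in> carrier G"
  using H by (rule subgroup.mem_carrier)

lemma idx: "g \<in> carrier G \<Longrightarrow> idx g < p" "g \<in> carrier G \<Longrightarrow> inv (s [^] idx g) \<otimes> g \<in> H"
  using theI'[OF transversal] unfolding idx_def by blast+

lemma idx_eq: "g \<in> carrier G \<Longrightarrow> i < p \<Longrightarrow> inv (s [^] i) \<otimes> g \<in> H \<Longrightarrow> idx g = i"
  using transversal idx by metis

lemma idx_pow: "i < p \<Longrightarrow> idx (s [^] i) = i"
  using s H by (intro idx_eq) (auto simp: subgroup.one_closed)

lemma idx_mult: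
  assumes "g \<in> carrier G" "h \<in> H"
  shows "idx (g \<otimes> h) = idx g"
proof (rule idx_eq)
  have "inv (s [^] idx g) \<otimes> g \<otimes> h \<in> H"
    by (rule subgroup.m_closed[OF H idx(2)[OF assms(1)] assms(2)])
  then show "inv (s [^] idx g) \<otimes> (g \<otimes> h) \<in> H" using assms Hc s by (simp add: m_assoc)
qed (use assms Hc idx in auto)

lemma \<phi>_mult: "x \<in> H \<Longrightarrow> y \<in> H \<Longrightarrow> \<phi> (x \<otimes> y) = \<phi> x \<otimes> \<phi> y"
  and \<phi>_closed: "x \<in> H \<Longrightarrow> \<phi> x \<in> carrier G"
  using simple by (auto simp: simple_endo_def hom_def)

lemma \<phi>_one: "\<phi> \<one> = \<one>"
proof -
  have "\<one> \<in> H" using H by (rule subgroup.one_closed)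
  then have "\<phi> \<one> \<otimes> \<phi> \<one> = \<phi> \<one>" "\<phi> \<one> \<in> carrier G" using \<phi>_mult[of \<one> \<one>] \<phi>_closed by auto
  then show ?thesis by simp
qed

lemma sec_closed: "g \<in> carrier G \<Longrightarrow> sec g i \<in> carrier G"
  unfolding sec_def using s by (intro \<phi>_closed idx(2)) auto

text \<open>With \<open>h s^i = s^j r\<close> and \<open>r\<close> in \<open>H\<close>, one has
  \<open>g h s^i = (g s^j) r\<close>: the coset ignores \<open>r\<close> and \<open>\<phi>\<close>
  is multiplicative on \<open>H\<close>. This is the cocycle rule for sections.\<close>

lemma idx_mult_pow:
  assumes "g \<in> carrier G" "h \<in> carrier G"
  shows "idx (g \<otimes> h \<otimes> (s [^] i)) = idx (g \<otimes> (s [^] idx (h \<otimes> (s [^] i))))" (is ?A)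
    and "sec (g \<otimes> h) i = sec g (idx (h \<otimes> (s [^] i))) \<otimes> sec h i" (is ?B)
proof -
  define j where "j = idx (h \<otimes> (s [^] i))"
  define r where "r = inv (s [^] j) \<otimes> (h \<otimes> (s [^] i))"
  have r: "r \<in> H" unfolding r_def j_def using assms s by (intro idx(2)) auto
  have eq: "g \<otimes> h \<otimes> (s [^] i) = (g \<otimes> (s [^] j)) \<otimes> r"
    using assms s by (simp add: r_def m_assoc)
  show A: ?A unfolding eq using assms s r by (subst idx_mult) (auto simp: j_def)
  define k where "k = idx (g \<otimes> (s [^] j))"
  have "inv (s [^] k) \<otimes> (g \<otimes> (s [^] j)) \<in> H"
    unfolding k_def using assms s by (intro idx(2)) auto
  then have "\<phi> (inv (s [^] k) \<otimes> (g \<otimes> (s [^] j)) \<otimes> r) = \<phi> (inv (s [^] k) \<otimes> (g \<otimes> (s [^] j))) \<otimes> \<phi> r"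
    using r by (rule \<phi>_mult)
  moreover have "inv (s [^] k) \<otimes> (g \<otimes> (s [^] j)) \<otimes> r = inv (s [^] k) \<otimes> ((g \<otimes> (s [^] j)) \<otimes> r)"
    using assms s Hc[OF r] by (simp add: m_assoc)
  moreover have "idx (g \<otimes> h \<otimes> (s [^] i)) = k" using A by (simp add: j_def k_def)
  ultimately have "sec (g \<otimes> h) i = \<phi> (inv (s [^] k) \<otimes> (g \<otimes> (s [^] j))) \<otimes> \<phi> r"
    by (simp add: sec_def eq)
  then show ?B by (simp add: sec_def j_def k_def r_def)
qed

lemma act_mult:
  "g \<in> carrier G \<Longrightarrow> h \<in> carrier G \<Longrightarrow> act w (g \<otimes> h) = act (act w h) g"
proof (induction w arbitrary: g h)
  case (Cons i w)
  then show ?case by (simp add: idx_mult_pow sec_closed)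
qed simp

lemma sec_one: "i < p \<Longrightarrow> sec \<one> i = \<one>"
  using s by (simp add: sec_def idx_pow \<phi>_one)

lemma act_one: "w \<in> lists {..<p} \<Longrightarrow> act w \<one> = w"
  using s by (induction w) (auto simp: sec_one idx_pow)

lemma act_lists: "g \<in> carrier G \<Longrightarrow> act w g \<in> lists {..<p}"
  by (induction w arbitrary: g) (use s in \<open>auto simp: sec_closed intro!: idx(1)\<close>)

lemma act_append: "g \<in> carrier G \<Longrightarrow> act (u @ v) g = act u g @ act v (sec_word u g)"
  by (induction u arbitrary: g) (auto simp: sec_closed)

lemma sec_word_closed: "g \<in> carrier G \<Longrightarrow> sec_word u g \<in> carrier G"
  by (induction u arbitrary: g) (auto simp: sec_closed)

lemma act_inv:
  assumes "g \<in> carrier G" "w \<in> lists {..<p}"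
  shows "act (act w g) (inv g) = w" "act (act w (inv g)) g = w"
  using act_mult[of "inv g" g w] act_mult[of g "inv g" w] assms by (auto simp: act_one)

lemma adjacent_act_imp:
  assumes "g \<in> carrier G" "adjacent u w"
  shows "adjacent (act u g) (act w g)"
proof -
  have "child_of (act w g) (act u g)" if "child_of w u" for u w
    using that assms(1) by (auto simp: child_of_def act_append)
  then show ?thesis using assms(2) by (auto simp: adjacent_def)
qed

definition tree_map :: "'a \<Rightarrow> nat list \<Rightarrow> nat list"
  where "tree_map g = (\<lambda>w\<in>lists {..<p}. act w g)"

lemma tree_map_Aut: "g \<in> carrier G \<Longrightarrow> tree_map g \<in> carrier (tree_Aut {..<p})"
proof -
  assume g: "g \<in> carrier G"
  have "bij_betw (\<lambda>w. act w g) (lists {..<p}) (lists {..<p})"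
  proof (rule bij_betw_byWitness[of _ "\<lambda>w. act w (inv g)"])
    show "(\<lambda>w. act w g) ` lists {..<p} \<subseteq> lists {..<p}"
      "(\<lambda>w. act w (inv g)) ` lists {..<p} \<subseteq> lists {..<p}"
      using g act_lists inv_closed by blast+
  qed (use act_inv[OF g] in blast)+
  then have "tree_map g \<in> Bij (lists {..<p})"
    by (simp add: Bij_def bij_betw_restrict_eq tree_map_def)
  moreover have "adjacent (act u g) (act w g) \<longleftrightarrow> adjacent u w"
    if "u \<in> lists {..<p}" "w \<in> lists {..<p}" for u w
    using adjacent_act_imp[OF g, of u w] adjacent_act_imp[of "inv g" "act u g" "act w g"] that g
    by (auto simp: act_inv)
  ultimately show ?thesis by (simp add: tree_Aut_def tree_map_def)
qed

lemma tree_map_hom: "tree_map \<in> hom G (tree_Aut {..<p})"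
proof (rule homI)
  fix g h assume gh: "g \<in> carrier G" "h \<in> carrier G"
  have "tree_map (g \<otimes> h) = compose (lists {..<p}) (tree_map g) (tree_map h)"
    using gh act_lists by (auto simp: tree_map_def compose_def act_mult fun_eq_iff restrict_def)
  then show "tree_map (g \<otimes> h) = tree_map g \<otimes>\<^bsub>tree_Aut {..<p}\<^esub> tree_map h"
    using gh by (simp add: tree_Aut_mult tree_map_Aut)
qed (rule tree_map_Aut)

text \<open>The kernel is normal, lies in \<open>H\<close> since it fixes the vertex
  \<open>0\<close>, and is mapped into itself by \<open>\<phi>\<close> since it fixes all words
  \<open>0 # w\<close>; simplicity makes it trivial.\<close>

lemma tree_map_inj: "inj_on tree_map (carrier G)"
proof -
  interpret T: group "tree_Aut {..<p}" by (rule group_tree_Aut)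
  interpret h: group_hom G "tree_Aut {..<p}" tree_map
    using tree_map_hom by unfold_locales
  let ?K = "kernel G (tree_Aut {..<p}) tree_map"
  have K: "?K = {g \<in> carrier G. \<forall>w \<in> lists {..<p}. act w g = w}"
    by (auto simp: kernel_def tree_map_def tree_Aut_one fun_eq_iff restrict_def)
  have idx0: "idx g = 0" if "g \<in> ?K" for g
  proof -
    have "[0] \<in> lists {..<p}" using p_pos by simp
    then have "act [0] g = [0]" using that unfolding K by blast
    then show ?thesis using that by (simp add: kernel_def)
  qed
  have KH: "?K \<subseteq> H"
  proof
    fix g assume g: "g \<in> ?K"
    then have "g \<in> carrier G" by (simp add: kernel_def)
    then show "g \<in> H" using idx(2)[of g] idx0[OF g] by simp
  qed
  have "\<phi> ` ?K \<subseteq> ?K"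
  proof
    fix y assume "y \<in> \<phi> ` ?K"
    then obtain g where g: "g \<in> ?K" "y = \<phi> g" by blast
    then have gc: "g \<in> carrier G" by (simp add: kernel_def)
    have sec: "sec g 0 = \<phi> g" using gc idx0[OF g(1)] by (simp add: sec_def)
    have "act w (\<phi> g) = w" if "w \<in> lists {..<p}" for w
    proof -
      have "0 # w \<in> lists {..<p}" using that p_pos by simp
      then have "act (0 # w) g = 0 # w" using g(1) unfolding K by blast
      then show ?thesis using sec by simp
    qed
    then show "y \<in> ?K" using g KH \<phi>_closed unfolding K by auto
  qed
  then have "?K = {\<one>}"
    using simple h.normal_kernel KH unfolding simple_endo_def by blast
  then show ?thesis by (rule h.trivial_ker_imp_inj)
qed

text \<open>By uniqueness of sections the section of \<open>tree_map g\<close> at \<open>u\<close>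
  is \<open>tree_map (sec_word u g)\<close>.\<close>

lemma self_similar: "self_similar p G"
proof -
  let ?T = "tree_Aut {..<p}" and ?S = "tree_map ` carrier G"
  interpret T: group ?T by (rule group_tree_Aut)
  interpret h: group_hom G ?T tree_map using tree_map_hom by unfold_locales
  have "tree_section {..<p} (tree_map g) u \<in> ?S" if g: "g \<in> carrier G" and u: "u \<in> lists {..<p}" for g u
  proof -
    have "tree_map (sec_word u g) \<in> carrier ?T \<and>
        (\<forall>v\<in>lists {..<p}. tree_map g (u @ v) = tree_map g u @ tree_map (sec_word u g) v)"
    proof (intro conjI ballI)
      show "tree_map (sec_word u g) \<in> carrier ?T" using g by (intro tree_map_Aut sec_word_closed)
      fix v assume v: "v \<in> lists {..<p}"
      have "u @ v \<in> lists {..<p}" using u v by simp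
      then show "tree_map g (u @ v) = tree_map g u @ tree_map (sec_word u g) v"
        using g u v by (simp add: tree_map_def act_append del: append_in_lists_conv)
    qed
    then have "tree_section {..<p} (tree_map g) u = tree_map (sec_word u g)"
      unfolding tree_section_def
      using tree_section_unique[OF tree_map_Aut[OF g] _ u] by (intro the1_equality) auto
    then show ?thesis using sec_word_closed[OF g] by auto
  qed
  then have "self_similar_subgroup {..<p} ?S"
    unfolding self_similar_subgroup_def using h.img_is_subgroup by auto
  moreover have "tree_map \<in> iso G (?T\<lparr>carrier := ?S\<rparr>)"
    using tree_map_inj h.homh by (auto simp: iso_def hom_def bij_betw_def)
  ultimately show ?thesis by (auto simp: self_similar_def is_iso_def)
qed

end

section \<open>The splitting criterion\<close>

context group
begin

text \<open>Lets cyclic subgroups be written with natural exponents throughout.\<close>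

lemma inv_pow_eq_pow:
  assumes "finite (carrier G)" "x \<in> carrier G"
  shows "inv (x [^] (a::nat)) = x [^] (a * (order G - 1))"
proof (rule inv_equality)
  have "order G > 0" using assms by (simp add: order_gt_0_iff_finite)
  then have "a * (order G - 1) + a = order G * a" by (simp add: algebra_simps flip: Suc_diff_1)
  then have "x [^] (a * (order G - 1)) \<otimes> (x [^] a) = (x [^] order G) [^] a"
    using assms by (simp add: nat_pow_mult nat_pow_pow)
  then show "x [^] (a * (order G - 1)) \<otimes> (x [^] a) = \<one>"
    using assms by (simp add: pow_order_eq_1)
qed (use assms in auto)

lemma subgroup_pow_mult_normal:
  assumes fin: "finite (carrier G)" and N: "N \<lhd> G" and s: "s \<in> carrier G"
  shows "subgroup {(s [^] (a::nat)) \<otimes> y | a y. y \<in> N} G" (is "subgroup ?M G")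
proof (rule subgroupI)
  note Ns = normal_imp_subgroup[OF N]
  have Nc: "y \<in> carrier G" if "y \<in> N" for y using that Ns by (rule subgroup.mem_carrier[rotated])
  show "?M \<subseteq> carrier G" using s Nc by auto
  show "?M \<noteq> {}" using subgroup.one_closed[OF Ns] by blast
  show "inv x \<in> ?M" if x: "x \<in> ?M" for x
  proof -
    obtain a y where ay: "x = (s [^] (a::nat)) \<otimes> y" "y \<in> N" using x by blast
    then have "inv x = inv (s [^] a) \<otimes> ((s [^] a) \<otimes> inv y \<otimes> inv (s [^] a))"
      using s Nc by (simp add: inv_mult_group m_assoc)
    moreover have "(s [^] a) \<otimes> inv y \<otimes> inv (s [^] a) \<in> N"
      using ay s Ns by (intro normal_conj(2)[OF N] subgroup.m_inv_closed) auto
    ultimately show ?thesis using inv_pow_eq_pow[OF fin s, of a] by auto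
  qed
  show "x \<otimes> x' \<in> ?M" if x: "x \<in> ?M" "x' \<in> ?M" for x x'
  proof -
    obtain a y b z where ay: "x = (s [^] (a::nat)) \<otimes> y" "y \<in> N" "x' = (s [^] (b::nat)) \<otimes> z" "z \<in> N"
      using x by blast
    have "s [^] (a + b) = (s [^] a) \<otimes> (s [^] b)" using s by (simp add: nat_pow_mult)
    then have "x \<otimes> x' = (s [^] (a + b)) \<otimes> ((inv (s [^] b) \<otimes> y \<otimes> (s [^] b)) \<otimes> z)"
      using s ay Nc by (simp add: m_assoc)
    moreover have "(inv (s [^] b) \<otimes> y \<otimes> (s [^] b)) \<otimes> z \<in> N"
      using subgroup.m_closed[OF Ns normal_conj(1)[OF N ay(2)] ay(4)] s by simp
    ultimately show ?thesis by blast
  qed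
qed

end

context pchain
begin

lemma coprime_order: "\<not> p dvd k \<Longrightarrow> coprime k (order G)"
  using prime_imp_coprime[OF prime_p, of k] by (simp add: order_G coprime_commute)

lemma pow_coset_decomp:
  assumes s: "s \<in> carrier G" "s \<notin> P 1" and x: "x \<in> carrier G"
  obtains a y where "a < p" "y \<in> P 1" "x = (s [^] (a::nat)) \<otimes> y"
proof -
  let ?M = "{(s [^] (a::nat)) \<otimes> y | a y. y \<in> P 1}"
  have "?M = carrier G"
  proof (rule carrier_if_new[OF s])
    show "subgroup ?M G" using fin s P_normal[of 1] by (intro subgroup_pow_mult_normal) auto
    show "P 1 \<subseteq> ?M"
    proof
      fix y assume "y \<in> P 1"
      moreover from this have "y = (s [^] (0::nat)) \<otimes> y" using P_in_carrier[of 1 y] by simp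
      ultimately show "y \<in> ?M" by blast
    qed
    have "s = (s [^] (1::nat)) \<otimes> \<one>" using s by simp
    then show "s \<in> ?M" using subgroup.one_closed[OF P_subgroup[of 1]] by blast
  qed
  then obtain b y where by_: "x = (s [^] (b::nat)) \<otimes> y" "y \<in> P 1" using x by blast
  have "s [^] b = s [^] (b mod p + p * (b div p))" by simp
  also have "\<dots> = (s [^] (b mod p)) \<otimes> ((s [^] p) [^] (b div p))"
    using s by (simp only: nat_pow_mult[symmetric] nat_pow_pow)
  finally have "x = (s [^] (b mod p)) \<otimes> (((s [^] p) [^] (b div p)) \<otimes> y)"
    using by_ s P_in_carrier[of 1 y] by (simp add: m_assoc)
  moreover have "((s [^] p) [^] (b div p)) \<otimes> y \<in> P 1"
    using subgroup.m_closed[OF P_subgroup[of 1] subgroup_pow_closed[OF P_subgroup[of 1] pow_p_in_P1[OF s(1)]] by_(2)]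
    by simp
  moreover have "b mod p < p" using p_gt_1 by simp
  ultimately show thesis using that by blast
qed

lemma pow_in_P1D:
  assumes "s \<in> carrier G" "s \<notin> P 1" "s [^] (k::nat) \<in> P 1"
  shows "p dvd k"
proof (rule ccontr)
  assume k: "\<not> p dvd k"
  then have "0 < k" by (metis dvd_0_right gr0I)
  then show False using mem_of_pow_coprime[OF coprime_order[OF k] _ P_subgroup[of 1]] assms by simp
qed

lemma transversal:
  assumes s: "s \<in> carrier G" "s \<notin> P 1" and g: "g \<in> carrier G"
  shows "\<exists>!i. i < p \<and> inv (s [^] (i::nat)) \<otimes> g \<in> P 1"
proof -
  obtain a y where ay: "a < p" "y \<in> P 1" "g = (s [^] a) \<otimes> y" using pow_coset_decomp[OF s g] by blast
  have le: "i = j" if "i \<le> j" "j < p" "inv (s [^] i) \<otimes> g \<in> P 1" "inv (s [^] j) \<otimes> g \<in> P 1" for i j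
  proof -
    have sj: "s [^] j = (s [^] i) \<otimes> (s [^] (j - i))"
      using s that nat_pow_mult[of s i "j - i"] by simp
    have "inv (s [^] i) \<otimes> g \<otimes> inv (inv (s [^] j) \<otimes> g) \<in> P 1"
      using subgroup.m_closed[OF P_subgroup[of 1] that(3) subgroup.m_inv_closed[OF P_subgroup[of 1] that(4)]] by simp
    moreover have "inv (s [^] i) \<otimes> g \<otimes> inv (inv (s [^] j) \<otimes> g) = s [^] (j - i)"
      using s g by (simp add: inv_mult_group m_assoc sj)
    ultimately have "s [^] (j - i) \<in> P 1" by simp
    then have "p dvd j - i" by (rule pow_in_P1D[OF s])
    moreover have "j - i < p" using that by simp
    ultimately show ?thesis using that by (metis diff_is_0_eq dvd_imp_le le_antisym not_less gr0I)
  qed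
  have "inv (s [^] a) \<otimes> g \<in> P 1" using ay s P_in_carrier[of 1 y] by simp
  then show ?thesis using ay(1) le by (metis nat_le_linear)
qed

lemma maximal_subgroup_P1: "maximal_subgroup (P 1) G"
  unfolding maximal_subgroup_def
proof (intro conjI allI impI)
  show "P 1 \<noteq> carrier G" using carrier_new by blast
  fix K assume K: "subgroup K G \<and> P 1 \<subseteq> K"
  show "K = P 1 \<or> K = carrier G"
  proof (cases "K \<subseteq> P 1")
    case False
    then obtain x where "x \<in> K" "x \<notin> P 1" by blast
    then show ?thesis using carrier_if_new[of x K] K subgroup.mem_carrier[of K G x] by simp
  qed (use K in auto)
qed (simp add: P_subgroup)

lemma splits_over_P1:
  assumes s: "s \<in> carrier G" "s \<notin> P 1" "s [^] p = \<one>"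
  shows "splits_over G (P 1)"
  unfolding splits_over_def
proof (intro conjI exI)
  let ?K = "range (\<lambda>a::nat. s [^] a)"
  show "P 1 \<lhd> G" by (simp add: P_normal)
  show "subgroup ?K G"
  proof (rule subgroupI)
    show "inv x \<in> ?K" if "x \<in> ?K" for x using that inv_pow_eq_pow[OF fin s(1)] by auto
    show "x \<otimes> y \<in> ?K" if "x \<in> ?K" "y \<in> ?K" for x y using that s by (auto simp: nat_pow_mult)
  qed (use s in auto)
  show "P 1 \<inter> ?K = {\<one>}"
  proof
    show "P 1 \<inter> ?K \<subseteq> {\<one>}"
    proof
      fix x assume "x \<in> P 1 \<inter> ?K"
      then obtain a :: nat where a: "x = s [^] a" "s [^] a \<in> P 1" by auto
      then obtain b where "a = p * b" using pow_in_P1D[OF s(1,2)] by (meson dvdE)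
      then have "x = (s [^] p) [^] b" using a(1) nat_pow_pow[OF s(1), of p b] by simp
      then show "x \<in> {\<one>}" using s by simp
    qed
    have "\<one> = s [^] (0::nat)" by simp
    then have "\<one> \<in> ?K" by (rule range_eqI)
    then show "{\<one>} \<subseteq> P 1 \<inter> ?K" using subgroup.one_closed[OF P_subgroup[of 1]] by simp
  qed
  show "P 1 <#> ?K = carrier G"
  proof
    show "P 1 <#> ?K \<subseteq> carrier G" using s P_in_carrier[of 1] by (auto simp: set_mult_def)
    show "carrier G \<subseteq> P 1 <#> ?K"
    proof
      fix x assume x: "x \<in> carrier G"
      obtain a y where ay: "y \<in> P 1" "x = (s [^] (a::nat)) \<otimes> y"
        using pow_coset_decomp[OF s(1,2) x] by blast
      then have "x = ((s [^] a) \<otimes> y \<otimes> inv (s [^] a)) \<otimes> (s [^] a)"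
        using s P_in_carrier[of 1 y] by (simp add: m_assoc)
      moreover have "(s [^] a) \<otimes> y \<otimes> inv (s [^] a) \<in> P 1"
        using normal_conj(2)[OF P_normal[of 1]] ay s by simp
      ultimately show "x \<in> P 1 <#> ?K" unfolding set_mult_def by blast
    qed
  qed
qed

lemma elementary_abelian_P1:
  assumes "com_in G (P 1) (P 1) {\<one>}" "\<And>x. x \<in> P 1 \<Longrightarrow> x [^] p = \<one>"
  shows "elementary_abelian p (G\<lparr>carrier := P 1\<rparr>)"
  unfolding elementary_abelian_def
proof (intro conjI ballI)
  show "comm_group (G\<lparr>carrier := P 1\<rparr>)"
  proof (rule group.group_comm_groupI[OF subgroup_imp_group[OF P_subgroup]])
    fix x y assume "x \<in> carrier (G\<lparr>carrier := P 1\<rparr>)" "y \<in> carrier (G\<lparr>carrier := P 1\<rparr>)"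
    then show "x \<otimes>\<^bsub>G\<lparr>carrier := P 1\<rparr>\<^esub> y = y \<otimes>\<^bsub>G\<lparr>carrier := P 1\<rparr>\<^esub> x"
      using assms(1) P_in_carrier[of 1] by (simp add: com_in_def cmt_eq_one_iff)
  qed simp
  show "x [^]\<^bsub>G\<lparr>carrier := P 1\<rparr>\<^esub> p = \<one>\<^bsub>G\<lparr>carrier := P 1\<rparr>\<^esub>"
    if "x \<in> carrier (G\<lparr>carrier := P 1\<rparr>)" for x
    using that assms(2) nat_pow_consistent[of x p "P 1"] by simp
qed

lemma level_bound:
  assumes ab: "com_in G (P 1) (P 1) {\<one>}" and exp: "\<And>x. x \<in> P 1 \<Longrightarrow> x [^] p = \<one>" and n2: "2 \<le> n"
  shows "n \<le> p + 1"
proof (rule ccontr)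
  assume no: "\<not> n \<le> p + 1"
  obtain s where s: "s \<in> carrier G" "s \<notin> P 1" using carrier_new by blast
  obtain a where a: "a \<in> P 1" "a \<notin> P (Suc 1)" using P_new[of 1] n2 by auto
  define D where "D = (\<lambda>x. cmt G x s)"
  have DP: "(D ^^ l) a \<in> P (1 + l)" for l
    unfolding D_def using a s by (intro funpow_cmt_in_P) auto
  have com: "com_in G (P i) (P 1) (P (i + 2))" if "1 \<le> i" for i
    using ab P_antimono[of 1 i] that subgroup.one_closed[OF P_subgroup[of "i + 2"]]
    by (auto simp: com_in_def)
  \<comment> \<open>If \<open>n \<ge> p + 2\<close>, then \<open>p\<close> commutations with
    \<open>s\<close> lead from level 1 to level \<open>p + 1 < n\<close> without becoming trivial,
    whereas the power relation in exponent \<open>p\<close> makes the result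
    \<open>\<one>\<close>.\<close>
  have Dnew: "(D ^^ l) a \<notin> P (Suc (1 + l))" if "l \<le> p" for l
    using that
  proof (induction l)
    case (Suc l)
    then have "cmt G ((D ^^ l) a) s \<notin> P (1 + l + 2)"
      using no DP[of l] s com by (intro uniserial_step) auto
    then show ?case by (simp add: D_def)
  qed (use a in simp)
  have DP1: "(D ^^ l) a \<in> P 1" for l using DP[of l] P_antimono[of 1 "1 + l"] by auto
  have 1: "subgroup {\<one>} G" by (rule triv_subgroup)
  have "com_in G (P 1) {s [^] p} {\<one>}"
    using ab pow_p_in_P1[OF s(1)] by (auto simp: com_in_def)
  then have "(D a [^] p) \<otimes> (D ^^ p) a \<in> {\<one>}"
    unfolding D_def using ab s a exp DP1 1
    by (intro pow_cmt_relation[OF one_is_normal]) (auto simp: D_def)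
  then have "(D ^^ p) a = \<one>"
    using exp[OF DP1[of 1]] DP1[of p] P_in_carrier[of 1] by simp
  then show False using Dnew[of p] subgroup.one_closed[OF P_subgroup[of "Suc (1 + p)"]] by simp
qed

end

text \<open>Take a subgroup maximal with respect to avoiding \<open>z\<close>.\<close>

lemma (in group) complement_of_element:
  assumes p: "Factorial_Ring.prime (p::nat)" and M: "subgroup M G" "finite M"
    and comm: "\<And>x y. x \<in> M \<Longrightarrow> y \<in> M \<Longrightarrow> x \<otimes> y = y \<otimes> x"
    and exp: "\<And>x. x \<in> M \<Longrightarrow> x [^] p = \<one>" and z: "z \<in> M" "z \<noteq> \<one>"
  obtains C where "subgroup C G" "C \<subseteq> M" "z \<notin> C" "\<And>x. x \<in> M \<Longrightarrow> \<exists>k::nat. \<exists>c\<in>C. x = c \<otimes> (z [^] k)"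
proof -
  let ?S = "{C. subgroup C G \<and> C \<subseteq> M \<and> z \<notin> C}"
  have Mc: "x \<in> carrier G" if "x \<in> M" for x using that M(1) by (rule subgroup.mem_carrier[rotated])
  have finS: "finite ?S" by (rule finite_subset[of _ "Pow M"]) (use M in auto)
  have "{\<one>} \<in> ?S" using z subgroup.one_closed[OF M(1)] triv_subgroup by simp
  then have "?S \<noteq> {}" by (rule ex_in_conv[THEN iffD1, OF exI])
  then have "\<exists>C \<in> ?S. \<forall>D \<in> ?S. C \<subseteq> D \<longrightarrow> C = D" by (rule finite_has_maximal[OF finS])
  then obtain C where C: "C \<in> ?S" and C_max: "\<forall>D \<in> ?S. C \<subseteq> D \<longrightarrow> C = D" by (rule bexE)
  have max: "C = D" if "subgroup D G" "D \<subseteq> M" "z \<notin> D" "C \<subseteq> D" for D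
    using C_max that by simp
  have Cs: "subgroup C G" and CM: "C \<subseteq> M" and zC: "z \<notin> C" using C by auto
  have p0: "0 < p" using prime_gt_0_nat[OF p] .
  have "\<exists>k::nat. \<exists>c\<in>C. x = c \<otimes> (z [^] k)" if x: "x \<in> M" for x
  proof (cases "x \<in> C")
    case True
    then have "x = x \<otimes> (z [^] (0::nat))" using Mc x by simp
    then show ?thesis using True by blast
  next
    case False
    \<comment> \<open>\<open>C\<close> enlarged by \<open>x\<close> must contain \<open>z\<close> by
      maximality, say \<open>z = c \<otimes> (x [^] k)\<close>. As \<open>z\<close> is not in
      \<open>C\<close>, \<open>p\<close> does not divide \<open>k\<close>, and inverting
      \<open>k\<close> modulo \<open>p\<close> expresses \<open>x\<close> through \<open>C\<close>
      and \<open>z\<close>.\<close>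
    let ?D = "{c \<otimes> (x [^] (k::nat)) | c k. c \<in> C}"
    have xk: "x [^] (k::nat) \<in> M" for k using x M subgroup_pow_closed by blast
    have xc: "x \<in> carrier G" using Mc x .
    have Cc: "c \<in> carrier G" if "c \<in> C" for c using that CM Mc by blast
    have Ds: "subgroup ?D G"
    proof (rule subgroupI)
      show "?D \<subseteq> carrier G" using xc Cc by auto
      show "?D \<noteq> {}" using subgroup.one_closed[OF Cs] by blast
      show "inv y \<in> ?D" if y: "y \<in> ?D" for y
      proof -
        obtain c k where ck: "y = c \<otimes> (x [^] (k::nat))" "c \<in> C" using y by blast
        have "x [^] (k * (p - 1)) \<otimes> (x [^] k) = x [^] (p * k)"
          using xc p0 by (simp add: nat_pow_mult algebra_simps flip: Suc_diff_1)
        also have "\<dots> = \<one>" using exp[OF x] xc by (simp add: nat_pow_pow[symmetric])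
        finally have "inv (x [^] k) = x [^] (k * (p - 1))" using xc by (intro inv_equality) auto
        moreover have "inv y = inv (x [^] k) \<otimes> inv c" using ck xc Cc by (simp add: inv_mult_group)
        moreover have ic: "inv c \<in> C" using ck Cs by (simp add: subgroup.m_inv_closed)
        moreover have "(x [^] (k * (p - 1))) \<otimes> inv c = inv c \<otimes> (x [^] (k * (p - 1)))"
          using xk ic CM by (intro comm) auto
        ultimately have "inv y = inv c \<otimes> (x [^] (k * (p - 1)))" by simp
        then show ?thesis using ic by blast
      qed
      show "y \<otimes> y' \<in> ?D" if y: "y \<in> ?D" "y' \<in> ?D" for y y'
      proof -
        obtain c k d l where ck: "y = c \<otimes> (x [^] (k::nat))" "c \<in> C" "y' = d \<otimes> (x [^] (l::nat))" "d \<in> C"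
          using y by blast
        have "y \<otimes> y' = c \<otimes> ((x [^] k) \<otimes> d) \<otimes> (x [^] l)" using ck xc Cc by (simp add: m_assoc)
        also have "(x [^] k) \<otimes> d = d \<otimes> (x [^] k)" using comm xk ck CM by blast
        also have "c \<otimes> (d \<otimes> (x [^] k)) \<otimes> (x [^] l) = (c \<otimes> d) \<otimes> (x [^] (k + l))"
          using ck xc Cc by (simp add: m_assoc nat_pow_mult[symmetric])
        finally show ?thesis using subgroup.m_closed[OF Cs ck(2,4)] by blast
      qed
    qed
    have DM: "?D \<subseteq> M" using CM xk subgroup.m_closed[OF M(1)] by auto
    have CD: "C \<subseteq> ?D"
    proof
      fix c assume c: "c \<in> C"
      then have "c = c \<otimes> (x [^] (0::nat))" using Cc by simp
      then show "c \<in> ?D" using c by blast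
    qed
    have xD: "x \<in> ?D"
    proof -
      have "x = \<one> \<otimes> (x [^] (1::nat))" using xc by simp
      then show ?thesis using subgroup.one_closed[OF Cs] by blast
    qed
    have "z \<in> ?D"
    proof (rule ccontr)
      assume "z \<notin> ?D"
      then have "C = ?D" by (rule max[OF Ds DM _ CD])
      then have "?D \<subseteq> C" by (rule equalityD2)
      then show False using xD False by (meson subsetD)
    qed
    then obtain c k where ck: "z = c \<otimes> (x [^] (k::nat))" "c \<in> C" by blast
    have "\<not> p dvd k"
    proof
      assume "p dvd k"
      then obtain j where "k = p * j" by blast
      then have "x [^] k = \<one>" using exp[OF x] xc by (simp add: nat_pow_pow[symmetric])
      then show False using ck zC Cc by simp
    qed
    then have "coprime k p" using prime_imp_coprime[OF p] by (simp add: coprime_commute)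
    moreover have "k \<noteq> 0" using \<open>\<not> p dvd k\<close> by (metis dvd_0_right)
    ultimately obtain l j where l: "k * l = p * j + 1" using bezout_nat[of k p] by auto
    have "z [^] l = (c [^] l) \<otimes> ((x [^] k) [^] l)"
      unfolding ck(1) using comm[of c "x [^] k"] ck xk CM Cc xc by (intro pow_mult_distrib) auto
    also have "(x [^] k) [^] l = (x [^] p) [^] j \<otimes> x"
      using xc l by (simp add: nat_pow_pow nat_pow_mult[symmetric])
    also have "\<dots> = x" using exp[OF x] xc by simp
    finally have "x = inv (c [^] l) \<otimes> (z [^] l)" using ck(2) Cc xc by simp
    moreover have "inv (c [^] l) \<in> C" using ck(2) Cs subgroup_pow_closed by (simp add: subgroup.m_inv_closed)
    ultimately show ?thesis by blast
  qed
  then show thesis using that Cs CM zC by blast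
qed

text \<open>\<open>z\<close> generates \<open>P (n - 1)\<close> and \<open>\<phi>\<close> is the
  homomorphism that kills the complement \<open>C\<close> and sends \<open>z\<close> to
  \<open>s\<close>. A nontrivial normal subgroup inside \<open>P 1\<close> contains
  \<open>z\<close>, but its image \<open>s\<close> is outside \<open>P 1\<close>.\<close>

lemma (in pchain) self_similar_of_split:
  assumes ab: "com_in G (P 1) (P 1) {\<one>}" and exp: "\<And>x. x \<in> P 1 \<Longrightarrow> x [^] p = \<one>" and n2: "2 \<le> n"
    and s: "s \<in> carrier G" "s \<notin> P 1" "s [^] p = \<one>"
  shows "self_similar p G"
proof -
  have nn: "1 \<le> n - 1" "n - 1 < n" using n2 by auto
  then obtain z where z: "z \<in> P (n - 1)" "z \<notin> P (Suc (n - 1))" using P_new[OF nn] by blast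
  have z1: "z \<noteq> \<one>" using z subgroup.one_closed[OF P_subgroup[of "Suc (n - 1)"]] by auto
  have zP: "z \<in> P 1" using z P_antimono[OF order_refl nn(1)] by blast
  have comm: "x \<otimes> y = y \<otimes> x" if "x \<in> P 1" "y \<in> P 1" for x y
    using ab that P_in_carrier[of 1] by (auto simp: com_in_def cmt_eq_one_iff)
  obtain C where C: "subgroup C G" "C \<subseteq> P 1" "z \<notin> C"
    and ex: "\<And>x. x \<in> P 1 \<Longrightarrow> \<exists>k::nat. \<exists>c\<in>C. x = c \<otimes> (z [^] k)"
    using complement_of_element[OF prime_p P_subgroup P_finite comm exp zP z1] by blast
  have Pc: "x \<in> carrier G" if "x \<in> P 1" for x using that P_in_carrier[of 1] by simp
  have Cc: "c \<in> carrier G" if "c \<in> C" for c using that C Pc by blast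
  have zc: "z \<in> carrier G" using zP Pc by blast
  \<comment> \<open>The exponent of \<open>z\<close> is determined only modulo \<open>p\<close>,
    which suffices because \<open>s [^] p = \<one>\<close>.\<close>
  have wd: "s [^] k = s [^] l" if "c \<otimes> (z [^] (k::nat)) = d \<otimes> (z [^] (l::nat))" "c \<in> C" "d \<in> C" "k \<le> l" for c d k l
  proof -
    have "z [^] l = (z [^] (l - k)) \<otimes> (z [^] k)"
      using that zc by (simp add: nat_pow_mult)
    then have "c \<otimes> (z [^] k) = (d \<otimes> (z [^] (l - k))) \<otimes> (z [^] k)"
      using that zc Cc by (simp add: m_assoc)
    then have "c = d \<otimes> (z [^] (l - k))" using that zc Cc by simp
    then have "z [^] (l - k) \<in> C"
      using subgroup_mult_cancel(2)[OF C(1), of d "z [^] (l - k)"] that zc Cc by simp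
    then have "p dvd l - k"
      using mem_of_pow_coprime[OF coprime_order, of "l - k" C z] C zc by (metis dvd_0_right gr0I)
    moreover have kl: "k \<le> l" using that by simp
    ultimately obtain j where "l = p * j + k" using kl by (metis dvd_def le_add_diff_inverse2)
    then have "s [^] l = ((s [^] p) [^] j) \<otimes> (s [^] k)"
      using s(1) by (simp add: nat_pow_pow nat_pow_mult[symmetric])
    then show ?thesis using s by simp
  qed
  define \<phi> where "\<phi> x = s [^] (SOME k::nat. \<exists>c\<in>C. x = c \<otimes> (z [^] k))" for x
  have \<phi>: "\<phi> (c \<otimes> (z [^] k)) = s [^] k" if c: "c \<in> C" for c and k :: nat
  proof -
    let ?k = "SOME j::nat. \<exists>d\<in>C. c \<otimes> (z [^] k) = d \<otimes> (z [^] j)"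
    have "\<exists>d\<in>C. c \<otimes> (z [^] k) = d \<otimes> (z [^] ?k)"
      by (rule someI[of "\<lambda>j. \<exists>d\<in>C. c \<otimes> (z [^] k) = d \<otimes> (z [^] j)" k]) (use c in blast)
    then obtain d where d: "d \<in> C" "c \<otimes> (z [^] k) = d \<otimes> (z [^] ?k)" by (rule bexE)
    have "s [^] k = s [^] ?k"
    proof (cases "k \<le> ?k")
      case True
      then show ?thesis by (rule wd[OF d(2) c d(1)])
    next
      case False
      then have "?k \<le> k" unfolding not_le by (rule less_imp_le)
      then show ?thesis by (rule wd[OF d(2)[symmetric] d(1) c, symmetric])
    qed
    then show ?thesis unfolding \<phi>_def by (rule sym)
  qed
  have hom: "\<phi> \<in> hom (G\<lparr>carrier := P 1\<rparr>) G"
  proof (rule homI)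
    fix x y assume "x \<in> carrier (G\<lparr>carrier := P 1\<rparr>)" "y \<in> carrier (G\<lparr>carrier := P 1\<rparr>)"
    then have xy: "x \<in> P 1" "y \<in> P 1" by auto
    obtain c k d l where ck: "x = c \<otimes> (z [^] (k::nat))" "c \<in> C" "y = d \<otimes> (z [^] (l::nat))" "d \<in> C"
      using ex[OF xy(1)] ex[OF xy(2)] by blast
    have zk: "z [^] k \<in> P 1" using zP subgroup_pow_closed[OF P_subgroup[of 1]] by simp
    have "x \<otimes> y = c \<otimes> ((z [^] k) \<otimes> d) \<otimes> (z [^] l)" using ck zc Cc by (simp add: m_assoc)
    also have "(z [^] k) \<otimes> d = d \<otimes> (z [^] k)" using comm zk ck C by blast
    also have "c \<otimes> (d \<otimes> (z [^] k)) \<otimes> (z [^] l) = (c \<otimes> d) \<otimes> (z [^] (k + l))"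
      using ck zc Cc by (simp add: m_assoc nat_pow_mult[symmetric])
    finally have "\<phi> (x \<otimes> y) = s [^] (k + l)" using \<phi> subgroup.m_closed[OF C(1) ck(2,4)] by simp
    also have "\<dots> = \<phi> x \<otimes> \<phi> y" using \<phi> ck s by (simp add: nat_pow_mult)
    finally show "\<phi> (x \<otimes>\<^bsub>G\<lparr>carrier := P 1\<rparr>\<^esub> y) = \<phi> x \<otimes> \<phi> y" by simp
  qed (use s in \<open>simp add: \<phi>_def\<close>)
  have "simple_endo G (P 1) \<phi>"
    unfolding simple_endo_def
  proof (intro conjI hom allI impI)
    fix K assume K: "K \<lhd> G \<and> K \<subseteq> P 1 \<and> \<phi> ` K \<subseteq> K"
    show "K = {\<one>}"
    proof (rule ccontr)
      assume "K \<noteq> {\<one>}"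
      then have "z \<in> K" using normal_contains_last[of K] K z by blast
      moreover have "\<phi> z = s" using \<phi>[of \<one> 1] subgroup.one_closed[OF C(1)] zc s by simp
      ultimately show False using K s by auto
    qed
  qed
  then have "virtual_endo G (P 1) \<phi> s p"
    using s p_gt_1 transversal[OF s(1,2)]
    by (intro virtual_endo.intro virtual_endo_axioms.intro) (auto intro: P_subgroup)
  then show ?thesis by (rule virtual_endo.self_similar)
qed

section \<open>Simple virtual endomorphisms of groups of maximal class\<close>

locale simple_pchain = pchain +
  fixes \<phi>
  assumes simple: "simple_endo G (P 1) \<phi>" and n2: "2 \<le> n"
begin

abbreviation F where "F \<equiv> \<phi> ` P 1"

lemma P1_c: "x \<in> P 1 \<Longrightarrow> x \<in> carrier G"
  using P_in_carrier[of 1] by simp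

lemma P1_closed: "\<one> \<in> P 1" "x \<in> P 1 \<Longrightarrow> inv x \<in> P 1" "x \<in> P 1 \<Longrightarrow> y \<in> P 1 \<Longrightarrow> x \<otimes> y \<in> P 1"
  using P_subgroup[of 1] by (simp_all add: subgroup.one_closed subgroup.m_inv_closed subgroup.m_closed)

lemmas P1_closed_simps = P1_closed P1_closed[simplified]

lemma P1_cmt: "x \<in> P 1 \<Longrightarrow> y \<in> P 1 \<Longrightarrow> cmt G x y \<in> P 1"
  unfolding cmt_def by (intro P1_closed)

sublocale \<phi>: group_hom "G\<lparr>carrier := P 1\<rparr>" G \<phi>
  using simple subgroup_imp_group[OF P_subgroup[of 1]]
  by (simp add: group_hom_def group_hom_axioms_def simple_endo_def)

lemma \<phi>_mult: "x \<in> P 1 \<Longrightarrow> y \<in> P 1 \<Longrightarrow> \<phi> (x \<otimes> y) = \<phi> x \<otimes> \<phi> y"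
  using \<phi>.hom_mult[of x y] by simp

lemma \<phi>_c: "x \<in> P 1 \<Longrightarrow> \<phi> x \<in> carrier G"
  using \<phi>.hom_closed[of x] by simp

lemma \<phi>_one: "\<phi> \<one> = \<one>"
  using \<phi>.hom_one by simp

lemma \<phi>_inv: "x \<in> P 1 \<Longrightarrow> \<phi> (inv x) = inv (\<phi> x)"
  using \<phi>.hom_inv[of x] m_inv_consistent[OF P_subgroup[of 1], of x] by simp

lemma \<phi>_cmt: "x \<in> P 1 \<Longrightarrow> y \<in> P 1 \<Longrightarrow> \<phi> (cmt G x y) = cmt G (\<phi> x) (\<phi> y)"
  by (simp add: cmt_def \<phi>_mult \<phi>_inv P1_closed_simps)

lemma \<phi>_pow: "x \<in> P 1 \<Longrightarrow> \<phi> (x [^] (k::nat)) = \<phi> x [^] k"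
  by (induction k) (auto simp: \<phi>_one \<phi>_mult subgroup_pow_closed[OF P_subgroup[of 1], simplified])

lemma F_subgroup: "subgroup F G"
  using \<phi>.img_is_subgroup by simp

lemma invariant_trivial: "K \<lhd> G \<Longrightarrow> K \<subseteq> P 1 \<Longrightarrow> \<phi> ` K \<subseteq> K \<Longrightarrow> K = {\<one>}"
  using simple by (auto simp: simple_endo_def)

lemma F_new: obtains x where "x \<in> P 1" "\<phi> x \<notin> P 1"
proof (rule ccontr)
  assume "\<not> thesis"
  then have "F \<subseteq> P 1" using that by blast
  then have "P 1 = {\<one>}" using invariant_trivial[of "P 1"] P_normal by simp
  then show False using P_new[of 1] n2 subgroup.one_closed[OF P_subgroup[of 2]] by (auto simp: numeral_2_eq_2)
qed

text \<open>Simplicity tested on the last nontrivial term of the chain, a central subgroup of order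
  \<open>p\<close>.\<close>

lemma P_last_new: "\<exists>z \<in> P (n - 1). \<phi> z \<notin> P (n - 1)"
proof (rule ccontr)
  have nn: "1 \<le> n - 1" "n - 1 < n" using n2 by auto
  assume "\<not> ?thesis"
  then have "\<phi> ` P (n - 1) \<subseteq> P (n - 1)" by blast
  then have "P (n - 1) = {\<one>}"
    using invariant_trivial[OF P_normal[OF nn(1)] P_antimono[OF order_refl nn(1)]] by blast
  then show False using P_new[OF nn] subgroup.one_closed[OF P_subgroup[of "Suc (n - 1)"]] by auto
qed

lemma P_last_central: "z \<in> P (n - 1) \<Longrightarrow> g \<in> carrier G \<Longrightarrow> cmt G z g = \<one>"
  using cmt_P[of "n - 1" z g] P_trivial[of "Suc (n - 1)"] n2 by auto

text \<open>A central element outside \<open>P 1\<close> would let all of \<open>G\<close>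
  centralize \<open>P 1 / P 3\<close>, and one at a level \<open>i \<le> n - 2\<close> would put
  \<open>[P i, G]\<close> into \<open>P (i + 2)\<close>.\<close>

lemma central_in_P_last:
  assumes n3: "3 \<le> n" and x: "x \<in> carrier G" "\<And>g. g \<in> carrier G \<Longrightarrow> cmt G x g = \<one>"
  shows "x \<in> P (n - 1)"
proof -
  have one: "\<one> \<in> P i" if "1 \<le> i" for i using subgroup.one_closed[OF P_subgroup[OF that]] .
  have x1: "x \<in> P 1"
  proof (rule ccontr)
    assume "x \<notin> P 1"
    then have "com_in G (carrier G) (P 1) (P 3)"
      using x com_in_P1_P1 one[of 3] P_carrier[of 1] P1_c
      by (intro com_in_top[of x]) (auto simp: com_in_def intro: P_normal)
    then have "com_in G (P 1) (carrier G) (P 3)"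
      by (rule com_in_sym) (use P_subgroup[of 3] P_carrier[of 1] in auto)
    then show False using not_com_in_P_carrier[of 1] n3 by (simp add: numeral_3_eq_3)
  qed
  show ?thesis
  proof (rule ccontr)
    assume no: "x \<notin> P (n - 1)"
    then have "x \<noteq> \<one>" using one[of "n - 1"] n2 by auto
    then obtain i where i: "1 \<le> i" "i < n" "x \<in> P i" "x \<notin> P (Suc i)"
      using level_exists[OF x1] by blast
    have "i \<noteq> n - 1" using i no by blast
    then have i2: "i + 2 \<le> n" using i by simp
    have "com_in G {x} (carrier G) (P (i + 2))" using x one[of "i + 2"] by (simp add: com_in_def)
    then have "com_in G (P i) (carrier G) (P (i + 2))"
      using i com_in_P_carrier[of "Suc i"] by (intro com_in_new[of i x]) (auto intro: P_normal)
    then show False using not_com_in_P_carrier[OF i(1) i2] by blast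
  qed
qed

text \<open>If \<open>P 1\<close> did not centralize \<open>P (n - 2)\<close>, its centre would be \<open>P (n - 1)\<close>; then \<open>\<phi>\<close> would be
  injective, so that \<open>F\<close> would be a maximal subgroup with centre \<open>\<phi> (P (n - 1))\<close>.\<close>

lemma com_in_P_last2:
  assumes n3: "3 \<le> n"
  shows "com_in G (P (n - 2)) (P 1) {\<one>}"
proof (rule ccontr)
  assume no: "\<not> ?thesis"
  have nn: "1 \<le> n - 1" "n - 1 < n" "1 \<le> n - 2" using n3 by auto
  let ?Z = "P 1 \<inter> centr_mod G (P 1) {\<one>}"
  have Z_normal: "?Z \<lhd> G"
    unfolding normal_inv_iff
  proof (intro conjI ballI)
    show "subgroup ?Z G"
      using subgroups_Inter_pair[OF P_subgroup[of 1] centr_mod_subgroup[OF one_is_normal P_carrier[of 1]]] by simp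
    fix g x assume g: "g \<in> carrier G" and x: "x \<in> ?Z"
    have xc: "x \<in> carrier G" using x P1_c by blast
    have "cmt G (g \<otimes> x \<otimes> inv g) h = \<one>" if h: "h \<in> P 1" for h
    proof -
      have hc: "h \<in> carrier G" using h P1_c by blast
      have "inv g \<otimes> h \<otimes> g \<in> P 1" using normal_conj(1)[OF P_normal[of 1]] h g by simp
      then have "cmt G x (inv g \<otimes> h \<otimes> g) = \<one>" using x by (auto simp: centr_mod_def)
      then have "g \<otimes> cmt G x (inv g \<otimes> h \<otimes> g) \<otimes> inv g = \<one>" using g by simp
      moreover have "g \<otimes> (inv g \<otimes> h \<otimes> g) \<otimes> inv g = h" using g hc by (simp add: m_assoc)
      ultimately show ?thesis using conj_cmt[of x "inv g \<otimes> h \<otimes> g" g] xc hc g by simp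
    qed
    then show "g \<otimes> x \<otimes> inv g \<in> ?Z"
      using x xc g normal_conj(2)[OF P_normal[of 1], of x g] by (auto simp: centr_mod_def)
  qed
  \<comment> \<open>The centre of \<open>P 1\<close> is normal in \<open>G\<close>; if it reached
    above \<open>P (n - 1)\<close> it would contain \<open>P (n - 2)\<close>, against the
    assumption.\<close>
  have Z_last: "x \<in> P (n - 1)" if x: "x \<in> P 1" "\<And>h. h \<in> P 1 \<Longrightarrow> cmt G x h = \<one>" for x
  proof (rule ccontr)
    assume x_no: "x \<notin> P (n - 1)"
    then have "x \<noteq> \<one>" using subgroup.one_closed[OF P_subgroup[OF nn(1)]] by auto
    then obtain i where i: "1 \<le> i" "i < n" "x \<in> P i" "x \<notin> P (Suc i)"
      using level_exists[OF x(1)] by blast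
    have "i \<noteq> n - 1" using i x_no by blast
    then have "P (n - 2) \<subseteq> P i" using i by (intro P_antimono) auto
    also have "P i \<subseteq> ?Z"
      using x P1_c by (intro normal_contains_P[OF Z_normal _ i(3,4,1)]) (auto simp: centr_mod_def)
    finally show False using no by (auto simp: com_in_def centr_mod_def)
  qed
  \<comment> \<open>Take a kernel element at the deepest possible level: its commutators with
    \<open>P 1\<close> are deeper and in the kernel, hence trivial. So it lies in
    \<open>P (n - 1)\<close> and generates it, and then \<open>\<phi>\<close> kills
    \<open>P (n - 1)\<close>.\<close>
  have ker: "x = \<one>" if x: "x \<in> P 1" "\<phi> x = \<one>" for x
  proof (rule ccontr)
    assume x1: "x \<noteq> \<one>"
    let ?Q = "\<lambda>i. 1 \<le> i \<and> i < n \<and> (\<exists>y \<in> P i. y \<noteq> \<one> \<and> \<phi> y = \<one>)"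
    have "?Q 1" using x x1 n2 by auto
    then obtain i where i: "?Q i" and i_max: "\<And>j. ?Q j \<Longrightarrow> j \<le> i"
      using GreatestI_nat[of ?Q 1 n] Greatest_le_nat[of ?Q _ n] by (metis (no_types, lifting) less_imp_le)
    then obtain y where y: "y \<in> P i" "y \<noteq> \<one>" "\<phi> y = \<one>" by blast
    have yP1: "y \<in> P 1" using y i P_antimono[of 1 i] by auto
    have "cmt G y h = \<one>" if h: "h \<in> P 1" for h
    proof (rule ccontr)
      assume c1: "cmt G y h \<noteq> \<one>"
      have c: "cmt G y h \<in> P (Suc i)" using i y h P1_c by (intro cmt_P) auto
      have "\<phi> (cmt G y h) = \<one>" using \<phi>_cmt[OF yP1 h] y \<phi>_c[OF h] by simp
      moreover have "Suc i < n" using c c1 P_trivial[of "Suc i"] by (cases "Suc i < n") auto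
      ultimately have "?Q (Suc i)" using c c1 i by auto
      then show False using i_max[of "Suc i"] by simp
    qed
    then have "y \<in> P (n - 1)" using Z_last[OF yP1] by blast
    moreover have triv: "P (Suc (n - 1)) = {\<one>}" using P_trivial[of "Suc (n - 1)"] by simp
    moreover have "subgroup {x \<in> P 1. \<phi> x = \<one>} G"
    proof (rule subgroupI)
      show "{x \<in> P 1. \<phi> x = \<one>} \<noteq> {}" using P1_closed(1) \<phi>_one by blast
    qed (auto simp: P1_c P1_closed_simps \<phi>_inv \<phi>_mult)
    ultimately have "P (n - 1) \<subseteq> {x \<in> P 1. \<phi> x = \<one>}"
      using y yP1 P1_closed(1) \<phi>_one by (intro P_le_if_new[of "n - 1" y]) (use nn in auto)
    then have "\<forall>z \<in> P (n - 1). \<phi> z = \<one>" by blast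
    then show False using P_last_new subgroup.one_closed[OF P_subgroup[OF nn(1)]] by auto
  qed
  have inj: "inj_on \<phi> (P 1)"
  proof (rule inj_onI)
    fix x y assume xy: "x \<in> P 1" "y \<in> P 1" "\<phi> x = \<phi> y"
    then have "\<phi> (x \<otimes> inv y) = \<one>" using \<phi>_c by (simp add: \<phi>_mult \<phi>_inv P1_closed_simps)
    then have "x \<otimes> inv y = \<one>" using ker[of "x \<otimes> inv y"] xy P1_closed by simp
    then show "x = y" using xy P1_c by (metis inv_equality inv_inv inv_closed)
  qed
  have cardF: "card F = card (P 1)" using inj by (rule card_image)
  have Z1: "P (n - 1) \<subseteq> P 1" using P_antimono[OF order_refl nn(1)] .
  obtain z where z: "z \<in> P (n - 1)" "\<phi> z \<notin> P (n - 1)" using P_last_new by blast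
  have zF: "cmt G (\<phi> x) f = \<one>" if x: "x \<in> P (n - 1)" and f: "f \<in> F" for x f
  proof -
    obtain h where h: "h \<in> P 1" "f = \<phi> h" using f by blast
    then show ?thesis using \<phi>_cmt[of x h] P_last_central[of x h] x Z1 P1_c \<phi>_one by auto
  qed
  show False
  proof (cases "P (n - 1) \<subseteq> F")
    \<comment> \<open>By injectivity the preimages of central elements are central in
      \<open>P 1\<close>, so \<open>\<phi>\<close> permutes \<open>P (n - 1)\<close>.\<close>
    case True
    have "P (n - 1) \<subseteq> \<phi> ` P (n - 1)"
    proof
      fix y assume y: "y \<in> P (n - 1)"
      then obtain x where x: "x \<in> P 1" "y = \<phi> x" using True by blast
      have "cmt G x h = \<one>" if h: "h \<in> P 1" for h
        using ker[OF P1_cmt[OF x(1) h]] \<phi>_cmt[OF x(1) h] P_last_central[OF y \<phi>_c[OF h]] x by simp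
      then show "y \<in> \<phi> ` P (n - 1)" using Z_last x by blast
    qed
    moreover have "card (\<phi> ` P (n - 1)) \<le> card (P (n - 1))"
      using P_finite[OF nn(1)] by (rule card_image_le)
    ultimately have "P (n - 1) = \<phi> ` P (n - 1)"
      using P_finite[OF nn(1)] by (intro card_seteq) auto
    then show False using z by blast
  next
    \<comment> \<open>\<open>F\<close> has index \<open>p\<close>, so it generates \<open>G\<close>
      together with any central \<open>y\<close> outside it. Hence \<open>\<phi> z\<close>, which
      commutes with both, is central in \<open>G\<close> and lies in
      \<open>P (n - 1)\<close>.\<close>
    case False
    then obtain y where y: "y \<in> P (n - 1)" "y \<notin> F" by blast
    have yc: "y \<in> carrier G" and zc: "\<phi> z \<in> carrier G"
      using y z Z1 P1_c \<phi>_c by blast+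
    let ?K = "centr_mod G {\<phi> z} {\<one>}"
    have comm: "cmt G a b = \<one> \<longleftrightarrow> cmt G b a = \<one>" if "a \<in> carrier G" "b \<in> carrier G" for a b
      using that by (auto simp: cmt_eq_one_iff)
    have "carrier G \<subseteq> ?K"
    proof (rule subset_of_prime_index[OF prime_p F_subgroup subgroup_self fin _ _ _ _ yc y(2)])
      show "card (carrier G) = p * card F"
        unfolding cardF using n_pos order_G card_P[of 1] by (simp add: order_def power_eq_if)
      show "subgroup ?K G" using zc by (intro centr_mod_subgroup one_is_normal) auto
      show "F \<subseteq> ?K"
      proof
        fix f assume f: "f \<in> F"
        then have "f \<in> carrier G" using \<phi>_c by blast
        then show "f \<in> ?K" using zF[OF z(1) f] comm[OF _ zc] by (simp add: centr_mod_def)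
      qed
      show "F \<subseteq> carrier G" using \<phi>_c by blast
      show "y \<in> ?K" using P_last_central[OF y(1) zc] yc by (simp add: centr_mod_def)
    qed
    then have "cmt G (\<phi> z) g = \<one>" if "g \<in> carrier G" for g
      using that comm zc by (auto simp: centr_mod_def)
    then have "\<phi> z \<in> P (n - 1)" using zc n3 by (intro central_in_P_last)
    then show False using z by blast
  qed
qed

text \<open>\<open>s\<close> and \<open>f\<close> generate \<open>G\<close> modulo
  \<open>P 2\<close>, and \<open>P 2\<close> consists of non-generators. The induction removes one
  level at a time: it ends at \<open>P n\<close>, which is trivial and so contained in every
  \<open>K\<close>.\<close>

lemma frattini:
  assumes "subgroup K G" and s: "s \<notin> P 1" and f: "f \<in> P 1" "f \<notin> P 2" and "s \<in> K" "f \<in> K"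
  shows "K = carrier G"
proof -
  have base_case: "K = carrier G" if K: "subgroup K G" "s \<in> K" "f \<in> K" "P 2 \<subseteq> K" for K
  proof -
    have "P 1 \<subseteq> K" using K f by (intro P_le_if_new[of 1 f K]) (auto simp: numeral_2_eq_2)
    then show ?thesis
      using subgroup.mem_carrier[OF K(1,2)] s K by (intro carrier_if_new[of s K]) auto
  qed
  have "K = carrier G" if "2 \<le> i" "subgroup K G" "s \<in> K" "f \<in> K" "P i \<subseteq> K" for i K
    using that
  proof (induction i arbitrary: K rule: dec_induct)
    case base
    then show ?case using base_case by blast
  next
    case (step i)
    \<comment> \<open>By induction \<open>P i\<close> and \<open>K\<close> generate
      \<open>G\<close>. Commuting with an element of \<open>P i\<close> changes things only by
      elements of \<open>P (i + 1) \<subseteq> K\<close>, so \<open>K\<close> contains all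
      commutators of \<open>G\<close>, in particular \<open>P 2\<close>.\<close>
    let ?M = "P i <#> K"
    have i1: "1 \<le> i" using step by simp
    have Kc: "k \<in> carrier G" if "k \<in> K" for k using that step.prems(1) by (rule subgroup.mem_carrier[rotated])
    have Pic: "x \<in> carrier G" if "x \<in> P i" for x using that P_in_carrier[OF i1] by simp
    have M: "subgroup ?M G" using P_normal[OF i1] step.prems(1) by (rule mult_norm_subgroup)
    have KM: "K \<subseteq> ?M"
    proof
      fix k assume "k \<in> K"
      moreover from this have "k = \<one> \<otimes> k" using Kc by simp
      ultimately show "k \<in> ?M" using subgroup.one_closed[OF P_subgroup[OF i1]] unfolding set_mult_def by blast
    qed
    have "P i \<subseteq> ?M"
    proof
      fix x assume "x \<in> P i"
      moreover from this have "x = x \<otimes> \<one>" using Pic by simp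
      ultimately show "x \<in> ?M" using subgroup.one_closed[OF step.prems(1)] unfolding set_mult_def by blast
    qed
    then have MG: "?M = carrier G" using step.IH[OF M] KM step.prems by blast
    have left: "cmt G (x \<otimes> k) g \<in> K" if "x \<in> P i" "k \<in> K" "g \<in> carrier G" "cmt G k g \<in> K" for x k g
    proof -
      have "inv k \<otimes> cmt G x g \<otimes> k \<in> P (Suc i)"
        using that Kc by (intro normal_conj(1)[OF P_normal] cmt_P i1) auto
      then have "inv k \<otimes> cmt G x g \<otimes> k \<in> K" using step.prems by blast
      then have "(inv k \<otimes> cmt G x g \<otimes> k) \<otimes> cmt G k g \<in> K"
        using that(4) by (rule subgroup.m_closed[OF step.prems(1)])
      then show ?thesis using that Pic Kc by (simp add: cmt_mult_left)
    qed
    have KK: "cmt G k k' \<in> K" if "k \<in> K" "k' \<in> K" for k k'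
      unfolding cmt_def using that step.prems(1) by (intro subgroup.m_closed subgroup.m_inv_closed)
    have "cmt G g g' \<in> K" if g: "g \<in> carrier G" "g' \<in> carrier G" for g g'
    proof -
      obtain x k x' k' where x: "g = x \<otimes> k" "x \<in> P i" "k \<in> K" "g' = x' \<otimes> k'" "x' \<in> P i" "k' \<in> K"
        using g unfolding MG[symmetric] set_mult_def by blast
      have "cmt G g' k \<in> K" unfolding x(4) using x Kc KK by (intro left) auto
      then have "inv (cmt G g' k) \<in> K" using step.prems(1) by (simp add: subgroup.m_inv_closed)
      then have "cmt G k g' \<in> K" using g x Kc by (simp add: inv_cmt)
      then show ?thesis unfolding x(1) using x g by (intro left) auto
    qed
    then have "com_in G (P 1) (carrier G) K" using P1_c by (simp add: com_in_def)
    then have "P 2 \<subseteq> K"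
      using P_Suc[of 1] commutator_subgroup_subset_iff[OF P_carrier[of 1] subset_refl step.prems(1)]
      by (simp add: numeral_2_eq_2)
    then show ?case using base_case step.prems by blast
  qed
  from this[of n K] show ?thesis
    using assms n2 P_trivial[of n] subgroup.one_closed[OF assms(1)] by simp
qed

text \<open>If the claim fails for \<open>n \<ge> 5\<close>, then \<open>P 1'\<close> contains
  \<open>P 3\<close>. On the other hand \<open>F\<close> is too small to generate \<open>G\<close>,
  which confines it to \<open><s> P 2\<close>, where all commutators fall into \<open>P 3\<close>.
  So \<open>\<phi>\<close> maps \<open>P 1'\<close> into \<open>P 3\<close>, hence into itself,
  against simplicity. For \<open>n \<le> 4\<close> the level \<open>2\<close> is central or the last
  one already treated.\<close>

lemma com_in_P2:
  assumes n3: "3 \<le> n"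
  shows "com_in G (P 2) (P 1) (P 4)"
proof (cases "n \<le> 4")
  case True
  show ?thesis
  proof (cases "n = 3")
    case True
    then show ?thesis
      using P_last_central[of _ _] P1_c subgroup.one_closed[OF P_subgroup[of 4]]
      by (auto simp: com_in_def)
  next
    case False
    then have "n - 2 = 2" using True n3 by simp
    then show ?thesis
      using com_in_P_last2[OF n3] subgroup.one_closed[OF P_subgroup[of 4]] by (auto simp: com_in_def)
  qed
next
  case False
  show ?thesis
  proof (rule ccontr)
    assume "\<not> ?thesis"
    then obtain x h where xh: "x \<in> P 2" "h \<in> P 1" "cmt G x h \<notin> P 4" by (auto simp: com_in_def)
    let ?D = "commutator_subgroup G (P 1) (P 1)"
    have D: "?D \<lhd> G" by (intro commutator_subgroup_normal P_normal) auto
    have P21: "P 2 \<subseteq> P 1" "P 3 \<subseteq> P 1" by (rule P_antimono; simp)+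
    have "cmt G x h \<in> P 3" using cmt_P[of 2 x h] xh P1_c by (simp add: numeral_3_eq_3 numeral_2_eq_2)
    moreover have "cmt G x h \<in> ?D" using xh P21 by (intro cmt_in_commutator_subgroup) auto
    ultimately have P3D: "P 3 \<subseteq> ?D"
      using xh by (intro normal_contains_P[OF D, of "cmt G x h" 3]) (auto simp: eval_nat_numeral)
    obtain y where y: "y \<in> P 1" "\<phi> y \<notin> P 1" using F_new by blast
    define s where "s = \<phi> y"
    have s: "s \<in> F" "s \<in> carrier G" "s \<notin> P 1" using y \<phi>_c by (auto simp: s_def)
    \<comment> \<open>An element of \<open>F\<close> in \<open>P 1\<close> but not in
      \<open>P 2\<close> would generate \<open>G\<close> together with \<open>s\<close>, but
      \<open>F\<close> has at most as many elements as \<open>P 1\<close>.\<close>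
    have FP2: "f \<in> P 2" if f: "f \<in> F" "f \<in> P 1" for f
    proof (rule ccontr)
      assume "f \<notin> P 2"
      then have "F = carrier G" using frattini[OF F_subgroup s(3) f(2) _ s(1) f(1)] by blast
      moreover have "card F \<le> card (P 1)" using P_finite[of 1] by (intro card_image_le) simp
      ultimately have "card (carrier G) \<le> card (P 1)" by simp
      then have "P 1 = carrier G" using fin P_carrier[of 1] by (intro card_seteq) auto
      then show False using carrier_new by blast
    qed
    have decomp: "F \<subseteq> K" if K: "subgroup K G" "s \<in> K" "P 2 \<subseteq> K" for K
    proof
      fix f assume f: "f \<in> F"
      then have fc: "f \<in> carrier G" using \<phi>_c by blast
      obtain a z where az: "z \<in> P 1" "f = (s [^] (a::nat)) \<otimes> z"
        using pow_coset_decomp[OF s(2,3) fc] by blast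
      have "z = inv (s [^] a) \<otimes> f" using az s P1_c by simp
      also have "\<dots> \<in> F"
        using F_subgroup f s subgroup_pow_closed by (intro subgroup.m_closed subgroup.m_inv_closed)
      finally have "z \<in> P 2" using az FP2 by blast
      then show "f \<in> K" unfolding az(2)
        using K subgroup_pow_closed[OF K(1,2)] by (intro subgroup.m_closed) auto
    qed
    have P3n: "P 3 \<lhd> G" by (simp add: P_normal)
    have one3: "\<one> \<in> P 3" using subgroup.one_closed[OF P_subgroup[of 3]] by simp
    have com23: "com_in G (P 2) (carrier G) (P 3)"
      using com_in_P_carrier[of 2] by (simp add: numeral_3_eq_3)
    have Fc: "F \<subseteq> carrier G" using \<phi>_c by blast
    have P2c: "P 2 \<subseteq> carrier G" by (simp add: P_carrier)
    have "F \<subseteq> centr_mod G {s} (P 3)"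
    proof (rule decomp)
      show "subgroup (centr_mod G {s} (P 3)) G" using s by (intro centr_mod_subgroup P3n) auto
    qed (use s com23 P2c one3 in \<open>auto simp: centr_mod_def com_in_def\<close>)
    then have "com_in G F {s} (P 3)" by (simp add: centr_mod_subset_iff)
    then have "com_in G {s} F (P 3)"
      by (rule com_in_sym) (use s Fc in \<open>auto simp: P_subgroup\<close>)
    moreover have "com_in G (P 2) F (P 3)" using com23 Fc by (rule com_in_mono[OF _ subset_refl _ subset_refl])
    ultimately have "F \<subseteq> centr_mod G F (P 3)"
      using s P2c by (intro decomp[OF centr_mod_subgroup[OF P3n Fc]]) (auto simp: centr_mod_def com_in_def)
    then have FF: "com_in G F F (P 3)" by (simp add: centr_mod_subset_iff)
    have "subgroup {x \<in> P 1. \<phi> x \<in> P 3} G"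
    proof (rule subgroupI)
      show "{x \<in> P 1. \<phi> x \<in> P 3} \<noteq> {}" using P1_closed(1) \<phi>_one one3 by auto
    qed (use P_subgroup[of 3] in \<open>auto simp: P1_c P1_closed_simps \<phi>_inv \<phi>_mult subgroup.m_closed subgroup.m_inv_closed\<close>)
    then have "?D \<subseteq> {x \<in> P 1. \<phi> x \<in> P 3}"
      using FF by (subst commutator_subgroup_subset_iff)
        (auto simp: com_in_def \<phi>_cmt P1_cmt[simplified] P_carrier)
    then have "?D \<subseteq> P 1" "\<phi> ` ?D \<subseteq> ?D" using P3D by auto
    then have "?D = {\<one>}" by (intro invariant_trivial D)
    then have "P 3 \<subseteq> {\<one>}" using P3D by simp
    then show False using P_new[of 3] False subgroup.one_closed[OF P_subgroup[of "Suc 3"]] by auto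
  qed
qed

lemma simple_imp_elementary:
  obtains s where "s \<in> carrier G" "s \<notin> P 1" "s [^] p = \<one>"
    and "com_in G (P 1) (P 1) {\<one>}" and "\<And>x. x \<in> P 1 \<Longrightarrow> x [^] p = \<one>"
proof (cases "n = 2")
  case True
  have pow: "x [^] p = \<one>" if x: "x \<in> P 1" for x
  proof -
    have "order (G\<lparr>carrier := P 1\<rparr>) = p" using card_P[of 1] True by (simp add: order_def)
    then show ?thesis
      using \<phi>.G.pow_order_eq_1[of x] x nat_pow_consistent[of x p "P 1"] by simp
  qed
  obtain x where x: "x \<in> P 1" "\<phi> x \<notin> P 1" using F_new by blast
  have "\<phi> x [^] p = \<one>" using \<phi>_pow[OF x(1), of p] pow[OF x(1)] \<phi>_one by simp
  moreover have "com_in G (P 1) (P 1) {\<one>}" using com_in_P1_P1 P_trivial[of 3] True by simp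
  ultimately show thesis using \<phi>_c[OF x(1)] x(2) pow by (intro that[of "\<phi> x"]) auto
next
  case False
  then have n3: "3 \<le> n" using n2 by simp
  have nn: "1 \<le> n - 1" "n - 1 < n" using n3 by auto
  have com: "com_in G (P i) (P 1) (P (i + 2))" if "1 \<le> i" "i + 2 \<le> n" for i
    using that by (intro com_in_P_P1 com_in_P2 com_in_P_last2 n3)
  obtain y where y: "y \<in> P 1" "\<phi> y \<notin> P 1" using F_new by blast
  define s where "s = \<phi> y"
  have s: "s \<in> F" "s \<in> carrier G" "s \<notin> P 1" using y \<phi>_c by (auto simp: s_def)
  \<comment> \<open>The \<open>P 1\<close>-part of \<open>f\<close> commutes with \<open>s\<close>,
    and by uniseriality only elements of \<open>P (n - 1)\<close> do.\<close>
  have cent: "\<exists>a x. x \<in> P (n - 1) \<and> f = (s [^] (a::nat)) \<otimes> x \<and> a < p" if f: "f \<in> carrier G" "s \<otimes> f = f \<otimes> s" for f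
  proof -
    obtain a x where ax: "a < p" "x \<in> P 1" "f = (s [^] (a::nat)) \<otimes> x"
      using pow_coset_decomp[OF s(2,3) f(1)] by blast
    have xc: "x \<in> carrier G" using ax P1_c by blast
    have "(s [^] a) \<otimes> (s \<otimes> x) = s \<otimes> f"
      using ax(3) s xc nat_pow_Suc2[OF s(2), of a] by (simp add: m_assoc[symmetric])
    also have "\<dots> = (s [^] a) \<otimes> (x \<otimes> s)" using f ax(3) s xc by (simp add: m_assoc)
    finally have sx: "s \<otimes> x = x \<otimes> s" using s xc by simp
    have "x \<in> P (n - 1)"
    proof (rule ccontr)
      assume no: "x \<notin> P (n - 1)"
      then have "x \<noteq> \<one>" using subgroup.one_closed[OF P_subgroup[OF nn(1)]] by auto
      then obtain i where i: "1 \<le> i" "i < n" "x \<in> P i" "x \<notin> P (Suc i)"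
        using level_exists[OF ax(2)] by blast
      have "i \<noteq> n - 1" using i no by blast
      then have i2: "i + 2 \<le> n" using i by simp
      have "cmt G x s \<notin> P (i + 2)" using i i2 s com by (intro uniserial_step) auto
      moreover have "cmt G x s = \<one>" using sx s xc by (simp add: cmt_eq_one_iff)
      ultimately show False using subgroup.one_closed[OF P_subgroup[of "i + 2"]] by simp
    qed
    then show ?thesis using ax by blast
  qed
  have Zc: "x \<in> carrier G" if "x \<in> P (n - 1)" for x using that P_in_carrier[OF nn(1)] by blast
  have Z1: "P (n - 1) \<subseteq> P 1" using P_antimono[OF order_refl nn(1)] .
  have central: "x \<otimes> g = g \<otimes> x" if "x \<in> P (n - 1)" "g \<in> carrier G" for x g
    using P_last_central[OF that] Zc that by (simp add: cmt_eq_one_iff)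
  have Zpow: "x [^] p = \<one>" if x: "x \<in> P (n - 1)" for x
  proof -
    interpret Z: group "G\<lparr>carrier := P (n - 1)\<rparr>" using P_subgroup[OF nn(1)] by (rule subgroup_imp_group)
    have "n - (n - 1) = 1" using n2 by simp
    then have "order (G\<lparr>carrier := P (n - 1)\<rparr>) = p" using card_P[OF nn(1)] by (simp add: order_def)
    then show ?thesis
      using Z.pow_order_eq_1[of x] x nat_pow_consistent[of x p "P (n - 1)"] by simp
  qed
  obtain z where z: "z \<in> P (n - 1)" "\<phi> z \<notin> P (n - 1)" using P_last_new by blast
  have z1: "z \<in> P 1" using z Z1 by blast
  have zF: "\<phi> z \<otimes> f = f \<otimes> \<phi> z" if "f \<in> F" for f
  proof -
    obtain h where h: "h \<in> P 1" "f = \<phi> h" using \<open>f \<in> F\<close> by blast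
    then show ?thesis using \<phi>_mult[OF z1 h(1)] \<phi>_mult[OF h(1) z1] central[OF z(1) P1_c[OF h(1)]] by simp
  qed
  \<comment> \<open>\<open>z\<close> is central, so \<open>\<phi> z\<close> commutes with
    \<open>F\<close> and in particular with \<open>s\<close>. It is not in \<open>P (n - 1)\<close>,
    which makes the exponent \<open>a\<close> nonzero and so invertible modulo
    \<open>p\<close>.\<close>
  obtain a x where ax: "x \<in> P (n - 1)" "\<phi> z = (s [^] (a::nat)) \<otimes> x" "a < p"
    using cent[OF \<phi>_c[OF z1]] zF[OF s(1)] by auto
  have a0: "0 < a"
  proof (rule ccontr)
    assume "\<not> 0 < a"
    then have "\<phi> z = x" using ax Zc by simp
    then show False using ax z by blast
  qed
  have cop: "coprime a (order G)"
    using a0 ax(3) by (intro coprime_order) (auto dest: dvd_imp_le)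
  \<comment> \<open>\<open>F\<close> commutes with \<open>\<phi> z\<close> and with its central
    factor \<open>x\<close>, hence with \<open>s [^] a\<close>, and \<open>s\<close> is a power of
    \<open>s [^] a\<close>.\<close>
  have sF: "s \<otimes> f = f \<otimes> s" if f: "f \<in> F" for f
  proof -
    have fc: "f \<in> carrier G" using f \<phi>_c by blast
    have "((s [^] a) \<otimes> f) \<otimes> x = (f \<otimes> (s [^] a)) \<otimes> x"
      using zF[OF f] central[OF ax(1) fc] fc s Zc[OF ax(1)] unfolding ax(2) by (simp add: m_assoc)
    then have "(s [^] a) \<otimes> f = f \<otimes> (s [^] a)" using fc s Zc[OF ax(1)] by simp
    then have "s [^] a \<in> centr_mod G {f} {\<one>}" using fc s by (simp add: centr_mod_def cmt_eq_one_iff)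
    moreover have "subgroup (centr_mod G {f} {\<one>}) G" using fc by (intro centr_mod_subgroup one_is_normal) auto
    ultimately have "s \<in> centr_mod G {f} {\<one>}" using mem_of_pow_coprime[OF cop a0] s by blast
    then show ?thesis using fc s by (simp add: centr_mod_def cmt_eq_one_iff)
  qed
  have pow_p: "((s [^] (b::nat)) \<otimes> w) [^] p = (s [^] p) [^] b" if w: "w \<in> P (n - 1)" for b w
  proof -
    have "((s [^] b) \<otimes> w) [^] p = ((s [^] b) [^] p) \<otimes> (w [^] p)"
      using w Zc s central[OF w, of "s [^] b"] by (intro pow_mult_distrib) auto
    then show ?thesis using Zpow[OF w] s by (simp add: nat_pow_pow mult.commute)
  qed
  have "\<phi> z [^] p = \<one>" using \<phi>_pow[OF z1, of p] Zpow[OF z(1)] \<phi>_one by simp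
  then have "(s [^] p) [^] a = \<one>" using pow_p[OF ax(1), of a] ax(2) by simp
  then have sp: "s [^] p = \<one>"
    using mem_of_pow_coprime[OF cop a0 triv_subgroup, of "s [^] p"] s by simp
  have F_form: "\<exists>b w. w \<in> P (n - 1) \<and> f = (s [^] (b::nat)) \<otimes> w" if "f \<in> F" for f
    using cent[of f] sF[OF that] that \<phi>_c by blast
  have Fpow: "f [^] p = \<one>" if "f \<in> F" for f
    using F_form[OF that] pow_p sp by auto
  have Fcomm: "f \<otimes> g = g \<otimes> f" if f: "f \<in> F" "g \<in> F" for f g
  proof -
    have gc: "g \<in> carrier G" using f \<phi>_c by blast
    obtain b w where bw: "w \<in> P (n - 1)" "f = (s [^] (b::nat)) \<otimes> w" using F_form[OF f(1)] by blast
    have "(s [^] b) \<otimes> g = g \<otimes> (s [^] b)"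
      using group_commutes_pow[OF sF[OF f(2)] s(2) gc] .
    then have "f \<otimes> g = g \<otimes> (s [^] b) \<otimes> w"
      using bw s gc Zc central[OF bw(1) gc] by (simp add: m_assoc) (simp add: m_assoc[symmetric])
    then show ?thesis using bw s gc Zc by (simp add: m_assoc)
  qed
  let ?D = "commutator_subgroup G (P 1) (P 1)"
  have D: "?D \<lhd> G" by (intro commutator_subgroup_normal P_normal) auto
  have "subgroup {x \<in> P 1. \<phi> x = \<one>} G"
  proof (rule subgroupI)
    show "{x \<in> P 1. \<phi> x = \<one>} \<noteq> {}" using P1_closed(1) \<phi>_one by blast
  qed (auto simp: P1_c P1_closed_simps \<phi>_inv \<phi>_mult)
  moreover have "com_in G (P 1) (P 1) {x \<in> P 1. \<phi> x = \<one>}"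
    using Fcomm \<phi>_c by (auto simp: com_in_def \<phi>_cmt P1_cmt[simplified] cmt_eq_one_iff)
  ultimately have Dker: "?D \<subseteq> {x \<in> P 1. \<phi> x = \<one>}"
    using commutator_subgroup_subset_iff[OF P_carrier[of 1] P_carrier[of 1]] by simp
  have "?D = {\<one>}"
    by (rule invariant_trivial[OF D]) (use Dker subgroup.one_closed[OF normal_imp_subgroup[OF D]] in auto)
  then have ab: "com_in G (P 1) (P 1) {\<one>}"
    using commutator_subgroup_subset_iff[OF P_carrier[of 1] P_carrier[of 1] triv_subgroup] by simp
  have comm: "x \<otimes> y = y \<otimes> x" if "x \<in> P 1" "y \<in> P 1" for x y
    using ab that P1_c by (auto simp: com_in_def cmt_eq_one_iff)
  \<comment> \<open>\<open>P 1\<close> is abelian by now, so its p-th powers form a normal subgroup.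
    It is killed by \<open>\<phi>\<close> because \<open>F\<close> has exponent \<open>p\<close>,
    and simplicity makes it trivial.\<close>
  let ?E = "(\<lambda>x. x [^] p) ` P 1"
  have Epow: "x [^] p \<in> P 1" if "x \<in> P 1" for x
    using subgroup_pow_closed[OF P_subgroup[of 1]] that by simp
  have E: "?E \<lhd> G"
    unfolding normal_inv_iff
  proof (intro conjI ballI)
    show "subgroup ?E G"
    proof (rule subgroupI)
      show "?E \<subseteq> carrier G" using P1_c by auto
      show "?E \<noteq> {}" using P1_closed(1) by blast
      show "inv e \<in> ?E" if e: "e \<in> ?E" for e
      proof -
        obtain x where x: "x \<in> P 1" "e = x [^] p" using e by blast
        then have "inv e = (inv x) [^] p" using P1_c by (simp add: nat_pow_inv)
        then show ?thesis using P1_closed(2)[OF x(1)] by blast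
      qed
      show "e \<otimes> e' \<in> ?E" if e: "e \<in> ?E" "e' \<in> ?E" for e e'
      proof -
        obtain x y where x: "x \<in> P 1" "e = x [^] p" "y \<in> P 1" "e' = y [^] p" using e by blast
        then have "e \<otimes> e' = (x \<otimes> y) [^] p" using P1_c comm by (simp add: pow_mult_distrib)
        then show ?thesis using P1_closed(3)[OF x(1,3)] by blast
      qed
    qed
    fix g e assume g: "g \<in> carrier G" and e: "e \<in> ?E"
    obtain x where x: "x \<in> P 1" "e = x [^] p" using e by blast
    have "g \<otimes> e \<otimes> inv g = (g \<otimes> x \<otimes> inv g) [^] p"
      using conj_nat_pow[of x "inv g" p] x g P1_c by simp
    then show "g \<otimes> e \<otimes> inv g \<in> ?E"
      using normal_conj(2)[OF P_normal[of 1] x(1) g] by blast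
  qed
  have "?E = {\<one>}"
  proof (rule invariant_trivial[OF E])
    show "?E \<subseteq> P 1" using Epow by blast
    show "\<phi> ` ?E \<subseteq> ?E"
    proof
      fix y assume "y \<in> \<phi> ` ?E"
      then obtain x where x: "x \<in> P 1" "y = \<phi> (x [^] p)" by (elim imageE) simp
      then have "y = \<one>" using \<phi>_pow[OF x(1), of p] Fpow[OF imageI[OF x(1)]] by simp
      then show "y \<in> ?E" using subgroup.one_closed[OF normal_imp_subgroup[OF E]] by simp
    qed
  qed
  then have "x [^] p = \<one>" if "x \<in> P 1" for x using imageI[OF that, of "\<lambda>x. x [^] p"] by simp
  with s(2,3) sp ab show thesis by (rule that)
qed

end

section \<open>Assembling the equivalence and the bound\<close>

lemma self_similar_maximal_class_pchain:
  fixes G :: "('a, 'b) monoid_scheme"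
  assumes p: "Factorial_Ring.prime (p::nat)" and mc: "maximal_class p G" and ss: "self_similar p G"
  obtains n P \<phi> where "simple_pchain G p n P \<phi>"
proof -
  obtain n where G: "group G" and n: "2 \<le> n" "order G = p ^ n" "has_nilpotency_class G (n - 1)"
    using mc by (auto simp: maximal_class_def)
  have n1: "1 \<le> n" using n(1) by simp
  obtain H \<phi> where H: "H \<lhd> G" "order G = p * card H" "simple_endo G H \<phi>"
    by (rule simple_endo_of_self_similar[OF G p n(2) n1 ss]) (rule that)
  have "p ^ n = p * p ^ (n - 1)" using n1 by (cases n) auto
  then have "p * card H = p * p ^ (n - 1)" using H(2) n(2) by metis
  then have "card H = p ^ (n - 1)" using prime_gt_0_nat[OF p] by simp
  then have "pchain G p n (\<lambda>i. if i \<le> 1 then H else lower_central G (i - 1))"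
    using group.pchain_of_maximal_class[OF G p n(2,1,3) H(1)] by simp
  then have "simple_pchain G p n (\<lambda>i. if i \<le> 1 then H else lower_central G (i - 1)) \<phi>"
    using H(3) n(1) by (intro simple_pchain.intro simple_pchain_axioms.intro) auto
  then show thesis by (rule that)
qed

lemma (in group) exists_prime_order:
  assumes p: "Factorial_Ring.prime (p::nat)" and ord: "order G = p ^ n" and x: "x \<in> carrier G" "x \<noteq> \<one>"
  obtains k :: nat where "x [^] k \<noteq> \<one>" "(x [^] k) [^] p = \<one>"
proof -
  let ?Q = "\<lambda>j::nat. x [^] (p ^ j) = \<one>"
  define j where "j = (LEAST j. ?Q j)"
  have "?Q n" using pow_order_eq_1[OF x(1)] ord by simp
  then have j: "?Q j" unfolding j_def by (rule LeastI)
  have "j \<noteq> 0"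
  proof
    assume "j = 0"
    then show False using j x by simp
  qed
  then obtain i where i: "j = Suc i" by (cases j) auto
  have "\<not> ?Q i" using not_less_Least[of i ?Q] i by (simp add: j_def)
  moreover have "(x [^] (p ^ i)) [^] p = \<one>" using j i x by (simp add: nat_pow_pow mult.commute)
  ultimately show thesis using that by blast
qed

text \<open>An element \<open>s\<close> of order \<open>p\<close> in the complement generates with
  \<open>M\<close> a subgroup larger than \<open>M\<close>, hence \<open>G\<close> by maximality. So
  the index of \<open>M\<close> is \<open>p\<close>.\<close>

lemma (in group) maximal_split_complement:
  assumes p: "Factorial_Ring.prime (p::nat)" and ord: "order G = p ^ n"
    and max: "maximal_subgroup M G" and split: "splits_over G M"
  obtains s where "s \<in> carrier G" "s \<notin> M" "s [^] p = \<one>" "order G = p * card M" "M \<lhd> G"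
proof -
  have M: "M \<lhd> G" using split by (simp add: splits_over_def)
  obtain K where K: "subgroup K G" "M \<inter> K = {\<one>}" "M <#> K = carrier G"
    using split by (auto simp: splits_over_def)
  have Ms: "subgroup M G" "M \<noteq> carrier G" using max by (auto simp: maximal_subgroup_def)
  have Mc: "m \<in> carrier G" if "m \<in> M" for m using that Ms(1) by (rule subgroup.mem_carrier[rotated])
  have fin: "finite (carrier G)"
    using ord prime_gt_0_nat[OF p] by (metis order_gt_0_iff_finite zero_less_power)
  have "K \<noteq> {\<one>}"
  proof
    assume "K = {\<one>}"
    then have "M <#> K = M" using Mc by (auto simp: set_mult_def)
    then show False using K Ms by simp
  qed
  then obtain x where x: "x \<in> K" "x \<noteq> \<one>" using subgroup.one_closed[OF K(1)] by blast
  obtain k :: nat where k: "x [^] k \<noteq> \<one>" "(x [^] k) [^] p = \<one>"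
    using exists_prime_order[OF p ord subgroup.mem_carrier[OF K(1) x(1)] x(2)] by blast
  define s where "s = x [^] k"
  have sK: "s \<in> K" unfolding s_def by (rule subgroup_pow_closed[OF K(1) x(1)])
  have s: "s \<in> carrier G" using subgroup.mem_carrier[OF K(1) sK] .
  have sp: "s [^] p = \<one>" and s1: "s \<noteq> \<one>" using k by (simp_all add: s_def)
  have sM: "s \<notin> M" using sK s1 K(2) by blast
  let ?N = "{(s [^] (a::nat)) \<otimes> y | a y. y \<in> M}"
  have N: "subgroup ?N G" by (rule subgroup_pow_mult_normal[OF fin M s])
  have "M \<subseteq> ?N"
  proof
    fix y assume y: "y \<in> M"
    then have "y = (s [^] (0::nat)) \<otimes> y" using Mc by simp
    then show "y \<in> ?N" using y by blast
  qed
  moreover have sN: "s \<in> ?N"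
  proof -
    have "s = (s [^] (1::nat)) \<otimes> \<one>" using s by simp
    then show ?thesis using subgroup.one_closed[OF Ms(1)] by blast
  qed
  moreover have "?N = M \<or> ?N = carrier G" using max N \<open>M \<subseteq> ?N\<close> unfolding maximal_subgroup_def by blast
  ultimately have NG: "?N = carrier G" using sM by blast
  \<comment> \<open>Counts \<open>G\<close> as \<open>p\<close> copies of \<open>M\<close>: a
    coincidence puts a power of \<open>s\<close> into \<open>M \<inter> K\<close>, which is trivial,
    and \<open>s\<close> has order exactly \<open>p\<close>.\<close>
  let ?f = "\<lambda>(a::nat, y). (s [^] a) \<otimes> y"
  have "inj_on ?f ({..<p} \<times> M)"
  proof -
    have le: "a = b \<and> y = w"
      if eq: "(s [^] a) \<otimes> y = (s [^] b) \<otimes> w" and ab: "a \<le> b" "b < p" and yw: "y \<in> M" "w \<in> M" for a b :: nat and y w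
    proof -
      have "s [^] b = (s [^] a) \<otimes> (s [^] (b - a))" using ab s by (simp add: nat_pow_mult)
      then have "y = (s [^] (b - a)) \<otimes> w" using eq s Mc yw by (simp add: m_assoc)
      then have "s [^] (b - a) \<in> M"
        using subgroup_mult_cancel(1)[OF Ms(1), of "s [^] (b - a)" w] yw s Mc by simp
      then have "s [^] (b - a) = \<one>" using K subgroup_pow_closed[OF K(1) sK] by blast
      then have o: "ord s dvd b - a" using pow_eq_id[OF s] by simp
      have "ord s dvd p" using pow_eq_id[OF s] sp by simp
      then have "ord s = p" using p s1 ord_eq_1[OF s] by (auto simp: prime_nat_iff)
      then have ba: "b = a" using o ab by (metis dvd_imp_le diff_is_0_eq le_antisym less_imp_diff_less not_le gr0I)
      then show ?thesis using eq s Mc yw by simp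
    qed
    show ?thesis
    proof (rule inj_onI)
      fix u v assume uv: "u \<in> {..<p} \<times> M" "v \<in> {..<p} \<times> M" "?f u = ?f v"
      obtain a y b w where "u = (a, y)" "v = (b, w)" by (cases u, cases v)
      then show "u = v"
        using uv le[of a y b w] le[of b w a y] nat_le_linear[of a b] by auto
    qed
  qed
  moreover have "?f ` ({..<p} \<times> M) = carrier G"
  proof
    show "?f ` ({..<p} \<times> M) \<subseteq> carrier G" using s Mc by auto
    show "carrier G \<subseteq> ?f ` ({..<p} \<times> M)"
    proof
      fix g assume "g \<in> carrier G"
      then obtain a y where ay: "g = (s [^] (a::nat)) \<otimes> y" "y \<in> M" using NG by blast
      have "s [^] a = s [^] (a mod p + p * (a div p))" by simp
      also have "\<dots> = (s [^] (a mod p)) \<otimes> ((s [^] p) [^] (a div p))"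
        using s by (simp only: nat_pow_mult[symmetric] nat_pow_pow)
      also have "\<dots> = s [^] (a mod p)" using sp s by simp
      finally have "g = ?f (a mod p, y)" using ay by simp
      moreover have "(a mod p, y) \<in> {..<p} \<times> M" using ay prime_gt_0_nat[OF p] by simp
      ultimately show "g \<in> ?f ` ({..<p} \<times> M)" by (rule image_eqI)
    qed
  qed
  ultimately have "card (carrier G) = card ({..<p} \<times> M)" using card_image by metis
  then have "order G = p * card M" by (simp add: order_def card_cartesian_product)
  then show thesis using that s sM sp M by blast
qed

theorem self_similar_iff_split:
  fixes G :: "('a, 'b) monoid_scheme" (structure)
  assumes p: "Factorial_Ring.prime (p::nat)" and mc: "maximal_class p G"
  shows "self_similar p G \<longleftrightarrow>
    (\<exists>M. maximal_subgroup M G \<and> elementary_abelian p (G\<lparr>carrier := M\<rparr>) \<and> splits_over G M)" (is "_ \<longleftrightarrow> ?R")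
    and "self_similar p G \<Longrightarrow> order G \<le> p ^ (p + 1)"
proof -
  obtain n where G: "group G" and n: "2 \<le> n" "order G = p ^ n" "has_nilpotency_class G (n - 1)"
    using mc by (auto simp: maximal_class_def)
  interpret group G by (rule G)
  have p1: "p > 1" using p by (rule prime_gt_1_nat)
  have fwd: "?R \<and> order G \<le> p ^ (p + 1)" if ss: "self_similar p G"
  proof -
    obtain n' P \<phi> where "simple_pchain G p n' P \<phi>"
      by (rule self_similar_maximal_class_pchain[OF p mc ss])
    then interpret simple_pchain G p n' P \<phi> .
    obtain s where s: "s \<in> carrier G" "s \<notin> P 1" "s [^] p = \<one>"
      and ab: "com_in G (P 1) (P 1) {\<one>}" and exp: "\<And>x. x \<in> P 1 \<Longrightarrow> x [^] p = \<one>"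
      by (rule simple_imp_elementary) (rule that; assumption)
    have "n' \<le> p + 1" by (rule level_bound[OF ab exp n2])
    then have "order G \<le> p ^ (p + 1)" unfolding order_G using p1 by (intro power_increasing) auto
    then show ?thesis
      using maximal_subgroup_P1 elementary_abelian_P1[OF ab exp] splits_over_P1[OF s] by blast
  qed
  have bwd: "self_similar p G" if R: ?R
  proof -
    obtain M where M: "maximal_subgroup M G" "elementary_abelian p (G\<lparr>carrier := M\<rparr>)" "splits_over G M"
      using R by blast
    obtain s where s: "s \<in> carrier G" "s \<notin> M" "s [^] p = \<one>" and ord: "order G = p * card M" and MG: "M \<lhd> G"
      by (rule maximal_split_complement[OF p n(2) M(1,3)]) (rule that; assumption)
    have "p ^ n = p * p ^ (n - 1)" using n(1) by (cases n) auto
    then have "p * card M = p * p ^ (n - 1)" using ord n(2) by metis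
    then have "card M = p ^ (n - 1)" using p1 by simp
    then interpret pchain G p n "\<lambda>i. if i \<le> 1 then M else lower_central G (i - 1)"
      using pchain_of_maximal_class[OF p n(2,1,3) MG] by simp
    interpret M: comm_group "G\<lparr>carrier := M\<rparr>" using M(2) by (simp add: elementary_abelian_def)
    have Ms: "subgroup M G" using MG by (rule normal_imp_subgroup)
    have "com_in G M M {\<one>}"
      using M.m_comm subgroup.mem_carrier[OF Ms] by (auto simp: com_in_def cmt_eq_one_iff)
    moreover have "x [^] p = \<one>" if "x \<in> M" for x
      using M(2) that nat_pow_consistent[of x p M] by (auto simp: elementary_abelian_def)
    ultimately show ?thesis using s n(1) by (intro self_similar_of_split[of s]) auto
  qed
  show "self_similar p G \<longleftrightarrow> ?R" using fwd bwd by blast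
  show "self_similar p G \<Longrightarrow> order G \<le> p ^ (p + 1)" using fwd by blast
qed

section \<open>Sharpness of the bound\<close>

text \<open>On \<open>B\<close> the map \<open>D = [-, t]\<close> is an endomorphism with
  \<open>D^p = 1\<close>, so the kernels of its powers form a central series of length
  \<open>p\<close>, and the class is at most \<open>p\<close>. It is not smaller because the term of
  index \<open>p - 1\<close> contains the nontrivial iterated commutator of
  \<open>e\<close>.\<close>

lemma (in group) cyclic_extension_class:
  assumes p: "Factorial_Ring.prime (p::nat)" and fin: "finite (carrier G)"
    and B: "B \<lhd> G" and index: "order G = p * card B"
    and comm: "\<And>x y. x \<in> B \<Longrightarrow> y \<in> B \<Longrightarrow> x \<otimes> y = y \<otimes> x"
    and exp: "\<And>x. x \<in> B \<Longrightarrow> x [^] p = \<one>"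
    and t: "t \<in> carrier G" "t \<notin> B" "t [^] p = \<one>"
    and e: "e \<in> B" "((\<lambda>x. cmt G x t) ^^ (p - 1)) e \<noteq> \<one>"
  shows "has_nilpotency_class G p"
proof -
  define D where "D = (\<lambda>x. cmt G x t)"
  have p0: "0 < p" using prime_gt_0_nat[OF p] .
  have Bs: "subgroup B G" using B by (rule normal_imp_subgroup)
  have Bc: "x \<in> carrier G" if "x \<in> B" for x using that Bs by (rule subgroup.mem_carrier[rotated])
  have DB: "D x \<in> B" if "x \<in> B" for x
    using com_in_normal(1)[OF B] that t by (simp add: com_in_def D_def)
  have DkB: "(D ^^ k) x \<in> B" if "x \<in> B" for x k
    by (induction k) (use that DB in auto)
  have D_mult: "D (x \<otimes> y) = D x \<otimes> D y" if "x \<in> B" "y \<in> B" for x y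
  proof -
    have "D (x \<otimes> y) = inv y \<otimes> (D x \<otimes> y) \<otimes> D y"
      using that Bc t by (simp add: D_def cmt_mult_left m_assoc)
    also have "D x \<otimes> y = y \<otimes> D x" using that DB comm by blast
    finally show ?thesis using that Bc DB by simp
  qed
  have Dk_mult: "(D ^^ k) (x \<otimes> y) = (D ^^ k) x \<otimes> (D ^^ k) y" if "x \<in> B" "y \<in> B" for x y k
    by (induction k) (use that DkB D_mult in auto)
  have D_one: "(D ^^ k) \<one> = \<one>" for k
    by (induction k) (use t in \<open>auto simp: D_def\<close>)
  have Dk_inv: "(D ^^ k) (inv x) = inv ((D ^^ k) x)" if "x \<in> B" for x k
  proof -
    have "inv x \<in> B" using that Bs by (simp add: subgroup.m_inv_closed)
    then have "(D ^^ k) (inv x) \<otimes> (D ^^ k) x = \<one>"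
      using Dk_mult[of "inv x" x k] that Bc D_one by simp
    then show ?thesis using that \<open>inv x \<in> B\<close> DkB Bc by (metis inv_equality)
  qed
  \<comment> \<open>The kernel of \<open>D^(p - i)\<close>: \<open>U 0\<close> is \<open>B\<close>,
    \<open>U p\<close> is trivial, and \<open>D\<close> maps each term into the next.\<close>
  define U where "U i = {x \<in> B. (D ^^ (p - i)) x = \<one>}" for i
  have U_sub: "subgroup (U i) G" for i
  proof (rule subgroupI)
    have "\<one> \<in> U i" using D_one subgroup.one_closed[OF Bs] by (simp add: U_def)
    then show "U i \<noteq> {}" by blast
  qed (use Bc Bs Dk_mult Dk_inv in \<open>auto simp: U_def subgroup.m_closed subgroup.m_inv_closed\<close>)
  have DU: "D x \<in> U (Suc i)" if "x \<in> U i" "i < p" for x i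
  proof -
    have "p - i = Suc (p - Suc i)" using that by simp
    then have "(D ^^ (p - Suc i)) (D x) = (D ^^ (p - i)) x" by (simp add: funpow_swap1)
    then show ?thesis using that DB by (simp add: U_def)
  qed
  have DU': "D x \<in> U i" if "x \<in> U i" for x i
  proof -
    have "(D ^^ (p - i)) (D x) = D ((D ^^ (p - i)) x)" by (simp add: funpow_swap1)
    then show ?thesis using that DB D_one[of 1] by (simp add: U_def)
  qed
  have B_U0: "x \<in> U 0" if x: "x \<in> B" for x
  proof -
    define Q where "Q = G\<lparr>carrier := B\<rparr>"
    interpret Q: comm_group Q
      unfolding Q_def by (rule group.group_comm_groupI[OF subgroup_imp_group[OF Bs]]) (use comm in simp)
    define \<sigma> where "\<sigma> y = inv t \<otimes> y \<otimes> t" for y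
    have \<sigma>: "\<sigma> \<in> hom Q Q"
      by (rule homI) (use t Bc normal_conj(1)[OF B] in \<open>auto simp: \<sigma>_def Q_def m_assoc\<close>)
    define \<delta> where "\<delta> y = inv\<^bsub>Q\<^esub> y \<otimes>\<^bsub>Q\<^esub> \<sigma> y" for y
    have \<delta>D: "\<delta> y = D y" if "y \<in> B" for y
      using that Bc t m_inv_consistent[OF Bs that] by (simp add: \<delta>_def D_def Q_def \<sigma>_def cmt_def m_assoc)
    have \<delta>k: "(\<delta> ^^ k) x = (D ^^ k) x" for k
      by (induction k) (use x DkB \<delta>D in auto)
    have \<sigma>k: "(\<sigma> ^^ k) x = inv (t [^] k) \<otimes> x \<otimes> (t [^] k)" for k
      by (induction k) (use x Bc t in \<open>auto simp: \<sigma>_def m_assoc inv_mult_group\<close>)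
    have powQ: "y [^]\<^bsub>Q\<^esub> (m::nat) = y [^] m" for y m by (simp add: Q_def nat_pow_def)
    have "(\<delta> x [^]\<^bsub>Q\<^esub> p) \<otimes>\<^bsub>Q\<^esub> (\<delta> ^^ p) x \<in> {\<one>\<^bsub>Q\<^esub>}"
      unfolding \<delta>_def
    proof (rule Q.pow_prime_relation[OF \<sigma> _ p])
      show "x \<in> carrier Q" using x by (simp add: Q_def)
      show "(\<sigma> ^^ p) x = x" using \<sigma>k[of p] t x Bc by simp
      show "subgroup {\<one>\<^bsub>Q\<^esub>} Q" by (rule Q.triv_subgroup)
      show "((\<lambda>y. inv\<^bsub>Q\<^esub> y \<otimes>\<^bsub>Q\<^esub> \<sigma> y) ^^ i) x [^]\<^bsub>Q\<^esub> p \<in> {\<one>\<^bsub>Q\<^esub>}" for i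
        using exp[OF DkB[OF x, of i]] \<delta>k[of i] unfolding \<delta>_def[abs_def] powQ by (simp add: Q_def)
    qed
    then have "(D ^^ p) x = \<one>"
      using exp[OF DB[OF x]] DkB[OF x, of p] Bc unfolding \<delta>k \<delta>D[OF x] powQ by (simp add: Q_def)
    then show ?thesis using x by (simp add: U_def)
  qed
  have cmt_U: "cmt G x g \<in> U (Suc i)" if x: "x \<in> U i" "i < p" and g: "g \<in> carrier G" for x g i
  proof -
    let ?N = "{(t [^] (a::nat)) \<otimes> y | a y. y \<in> B}"
    have "carrier G \<subseteq> ?N"
    proof (rule subset_of_prime_index[OF p Bs subgroup_self fin _ _ _ _ t(1,2)])
      show "card (carrier G) = p * card B" using index by (simp add: order_def)
      show "subgroup ?N G" by (rule subgroup_pow_mult_normal[OF fin B t(1)])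
      show "B \<subseteq> ?N"
      proof
        fix y assume y: "y \<in> B"
        then have "y = (t [^] (0::nat)) \<otimes> y" using Bc by simp
        then show "y \<in> ?N" using y by blast
      qed
      have "t = (t [^] (1::nat)) \<otimes> \<one>" using t by simp
      then show "t \<in> ?N" using subgroup.one_closed[OF Bs] by blast
    qed (use Bc in auto)
    then obtain a b where ab: "g = (t [^] (a::nat)) \<otimes> b" "b \<in> B" using g by blast
    have xB: "x \<in> B" using x by (simp add: U_def)
    \<comment> \<open>\<open>g = t^a b\<close> and \<open>b\<close> commutes with \<open>B\<close>,
      so only conjugation by powers of \<open>t\<close> has to be followed.\<close>
    have conj: "\<exists>u \<in> U (Suc i). inv (t [^] k) \<otimes> x \<otimes> (t [^] k) = x \<otimes> u" for k :: nat
    proof (induction k)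
      case 0
      then show ?case using subgroup.one_closed[OF U_sub[of "Suc i"]] xB Bc by (intro bexI[of _ \<one>]) auto
    next
      case (Suc k)
      then obtain u where u: "u \<in> U (Suc i)" "inv (t [^] k) \<otimes> x \<otimes> (t [^] k) = x \<otimes> u" by blast
      have uB: "u \<in> B" using u by (simp add: U_def)
      have "inv (t [^] Suc k) \<otimes> x \<otimes> (t [^] Suc k) = inv t \<otimes> (x \<otimes> u) \<otimes> t"
        using xB Bc t by (simp add: u(2)[symmetric] m_assoc inv_mult_group)
      also have "\<dots> = (x \<otimes> u) \<otimes> (D x \<otimes> D u)"
        using conj_eq_cmt[of "x \<otimes> u" t] D_mult[OF xB uB] xB uB Bc t by (simp add: D_def)
      also have "\<dots> = x \<otimes> (u \<otimes> (D x \<otimes> D u))" using xB uB Bc DB by (simp add: m_assoc)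
      finally show ?case
        using u x DU[OF x] DU'[OF u(1)] U_sub[of "Suc i"] by (auto intro!: subgroup.m_closed)
    qed
    obtain u where u: "u \<in> U (Suc i)" "inv (t [^] a) \<otimes> x \<otimes> (t [^] a) = x \<otimes> u" using conj by blast
    have uB: "u \<in> B" using u by (simp add: U_def)
    have "x \<otimes> cmt G x g = inv b \<otimes> ((inv (t [^] a) \<otimes> x \<otimes> (t [^] a)) \<otimes> b)"
      using ab xB Bc t by (simp add: conj_eq_cmt[symmetric] m_assoc inv_mult_group)
    also have "\<dots> = inv b \<otimes> (b \<otimes> (x \<otimes> u))"
      unfolding u(2) using comm[of "x \<otimes> u" b] xB uB ab Bs by (simp add: subgroup.m_closed)
    also have "\<dots> = x \<otimes> u" using ab xB uB Bc by simp
    finally have "cmt G x g = u" using xB uB Bc g by simp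
    then show ?thesis using u by simp
  qed
  have LU: "lower_central G i \<subseteq> U i" if "1 \<le> i" "i \<le> p" for i
    using that
  proof (induction i rule: dec_induct)
    case base
    have "lower_central G 1 \<subseteq> commutator_subgroup G B (carrier G)"
      using commutator_subgroup_prime_index[OF p B fin index] by simp
    also have "\<dots> \<subseteq> U 1"
      using cmt_U[of _ 0] B_U0 p0
      by (subst commutator_subgroup_subset_iff) (auto simp: com_in_def Bc U_sub[simplified])
    finally show ?case .
  next
    case (step i)
    have "com_in G (lower_central G i) (carrier G) (U (Suc i))"
      using step cmt_U[of _ i] by (auto simp: com_in_def)
    then show ?case
      using commutator_subgroup_subset_iff[OF subgroup.subset[OF lower_central_subgroup] subset_refl U_sub]
      by simp
  qed
  have "lower_central G p \<subseteq> {\<one>}" using LU[of p] p0 by (auto simp: U_def)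
  then have "lower_central G p = {\<one>}"
    using subgroup.one_closed[OF lower_central_subgroup[of p]] by blast
  moreover have "lower_central G i \<noteq> {\<one>}" if i: "i < p" for i
  proof
    assume triv: "lower_central G i = {\<one>}"
    have "(D ^^ k) e \<in> lower_central G k" for k
      by (induction k) (use e Bc t in \<open>auto simp: D_def intro: cmt_in_commutator_subgroup\<close>)
    then have "(D ^^ i) e = \<one>" using triv by blast
    then have "(D ^^ (p - 1 - i)) ((D ^^ i) e) = \<one>" using D_one by simp
    moreover have "p - 1 - i + i = p - 1" using i by simp
    ultimately have "(D ^^ (p - 1)) e = \<one>" by (metis comp_apply funpow_add)
    then show False using e by (simp add: D_def)
  qed
  ultimately show ?thesis by (simp add: has_nilpotency_class_def)
qed

section \<open>The wreath product of two cyclic groups of order p\<close>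

text \<open>An element is a base vector with entries modulo \<open>p\<close> and a rotation
  \<open>k\<close>, which shifts the coordinates of the second factor. Vectors are extensional, so
  that the carrier is finite and equality is coordinatewise.\<close>

definition wreath :: "nat \<Rightarrow> ((nat \<Rightarrow> nat) \<times> nat) monoid"
  where "wreath p = \<lparr>carrier = ({..<p} \<rightarrow>\<^sub>E {..<p}) \<times> {..<p},
    monoid.mult = (\<lambda>(a, k) (b, l). (\<lambda>j\<in>{..<p}. (a j + b ((j + k) mod p)) mod p, (k + l) mod p)),
    one = (\<lambda>j\<in>{..<p}. 0, 0)\<rparr>"

lemma carrier_wreath: "carrier (wreath p) = ({..<p} \<rightarrow>\<^sub>E {..<p}) \<times> {..<p}"
  and one_wreath: "\<one>\<^bsub>wreath p\<^esub> = (\<lambda>j\<in>{..<p}. 0, 0)"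
  and mult_wreath: "(a, k) \<otimes>\<^bsub>wreath p\<^esub> (b, l) =
    (\<lambda>j\<in>{..<p}. (a j + b ((j + k) mod p)) mod p, (k + l) mod p)"
  by (simp_all add: wreath_def)

lemma group_wreath:
  assumes p: "0 < p"
  shows "group (wreath p)"
proof (rule groupI)
  fix x y z assume "x \<in> carrier (wreath p)" "y \<in> carrier (wreath p)" "z \<in> carrier (wreath p)"
  then obtain a k b l c m where x: "x = (a, k)" "k < p" "a \<in> {..<p} \<rightarrow>\<^sub>E {..<p}"
    and y: "y = (b, l)" "l < p" "b \<in> {..<p} \<rightarrow>\<^sub>E {..<p}"
    and z: "z = (c, m)" "m < p" "c \<in> {..<p} \<rightarrow>\<^sub>E {..<p}"
    by (auto simp: carrier_wreath)
  show "x \<otimes>\<^bsub>wreath p\<^esub> y \<in> carrier (wreath p)"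
    using p by (auto simp: x y mult_wreath carrier_wreath)
  show "(x \<otimes>\<^bsub>wreath p\<^esub> y) \<otimes>\<^bsub>wreath p\<^esub> z = x \<otimes>\<^bsub>wreath p\<^esub> (y \<otimes>\<^bsub>wreath p\<^esub> z)"
    using p by (auto simp: x y z mult_wreath mod_simps add.assoc intro!: restrict_ext)
next
  show "\<one>\<^bsub>wreath p\<^esub> \<in> carrier (wreath p)" using p by (auto simp: one_wreath carrier_wreath)
next
  fix x assume "x \<in> carrier (wreath p)"
  then obtain a k where x: "x = (a, k)" "k < p" "a \<in> {..<p} \<rightarrow>\<^sub>E {..<p}"
    by (auto simp: carrier_wreath)
  have a: "a j < p" if "j < p" for j using x(3) that by auto
  have "(\<lambda>j\<in>{..<p}. a j mod p) = a"
    using x(3) a by (intro extensionalityI[of _ "{..<p}"]) (auto simp: PiE_def)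
  then show "\<one>\<^bsub>wreath p\<^esub> \<otimes>\<^bsub>wreath p\<^esub> x = x"
    using x by (auto simp: one_wreath mult_wreath cong: restrict_cong)
  \<comment> \<open>The inverse is the negated and back-shifted vector; adding \<open>p\<close>
    first keeps the subtraction within the naturals.\<close>
  let ?y = "(\<lambda>j\<in>{..<p}. (p - a ((j + (p - k)) mod p)) mod p, (p - k) mod p)"
  have "?y \<in> carrier (wreath p)" using p by (auto simp: carrier_wreath)
  moreover have "?y \<otimes>\<^bsub>wreath p\<^esub> x = \<one>\<^bsub>wreath p\<^esub>"
    using x p a by (auto simp: one_wreath mult_wreath mod_simps less_imp_le intro!: restrict_ext)
  ultimately show "\<exists>y\<in>carrier (wreath p). y \<otimes>\<^bsub>wreath p\<^esub> x = \<one>\<^bsub>wreath p\<^esub>" by blast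
qed

lemma order_wreath: "order (wreath p) = p ^ (p + 1)"
  by (simp add: order_def carrier_wreath card_cartesian_product card_PiE mult.commute)

lemma wreath_facts:
  assumes p: "Factorial_Ring.prime p"
  shows "maximal_class p (wreath p)" and "self_similar p (wreath p)"
proof -
  let ?W = "wreath p" and ?A = "{..<p} \<rightarrow>\<^sub>E {..<p}"
  have p1: "1 < p" using p by (rule prime_gt_1_nat)
  then have p0: "0 < p" by simp
  interpret group ?W using p0 by (rule group_wreath)
  have fin: "finite (carrier ?W)" by (simp add: carrier_wreath finite_PiE)
  define B where "B = ?A \<times> {0::nat}"
  define t where "t = ((\<lambda>j\<in>{..<p}. 0::nat), 1::nat)"
  define e where "e = ((\<lambda>j\<in>{..<p}. if j = 0 then 1 else 0::nat), 0::nat)"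
  have snd_mult: "snd (x \<otimes>\<^bsub>?W\<^esub> y) = (snd x + snd y) mod p" for x y
    by (cases x, cases y) (simp add: mult_wreath)
  have B_iff: "x \<in> B \<longleftrightarrow> x \<in> carrier ?W \<and> snd x = 0" for x
    using p0 by (cases x) (auto simp: B_def carrier_wreath)
  have snd_inv: "(snd x + snd (inv\<^bsub>?W\<^esub> x)) mod p = 0" if "x \<in> carrier ?W" for x
  proof -
    have "snd (x \<otimes>\<^bsub>?W\<^esub> inv\<^bsub>?W\<^esub> x) = 0" unfolding r_inv[OF that] one_wreath by simp
    then show ?thesis unfolding snd_mult .
  qed
  have snd_lt: "snd x < p" if "x \<in> carrier ?W" for x
    using that unfolding carrier_wreath by (simp add: mem_Times_iff)
  have Bs: "subgroup B ?W"
  proof (rule subgroupI)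
    have "\<one>\<^bsub>?W\<^esub> \<in> B" unfolding B_iff by (simp add: one_wreath[symmetric]) (simp add: one_wreath)
    then show "B \<noteq> {}" by blast
    show "inv\<^bsub>?W\<^esub> x \<in> B" if x: "x \<in> B" for x
      using x snd_inv[of x] snd_lt[of "inv\<^bsub>?W\<^esub> x"] by (simp add: B_iff)
  qed (auto simp: B_iff snd_mult)
  have B: "B \<lhd> ?W"
    unfolding normal_inv_iff
  proof (intro conjI ballI Bs)
    fix g x assume gx: "g \<in> carrier ?W" "x \<in> B"
    then have x: "x \<in> carrier ?W" "snd x = 0" by (simp_all add: B_iff)
    have "snd (g \<otimes>\<^bsub>?W\<^esub> x \<otimes>\<^bsub>?W\<^esub> inv\<^bsub>?W\<^esub> g) = (snd g + snd (inv\<^bsub>?W\<^esub> g)) mod p"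
      unfolding snd_mult x(2) add_0_right by (rule mod_add_left_eq)
    also have "\<dots> = 0" by (rule snd_inv[OF gx(1)])
    finally show "g \<otimes>\<^bsub>?W\<^esub> x \<otimes>\<^bsub>?W\<^esub> inv\<^bsub>?W\<^esub> g \<in> B"
      using gx(1) x(1) by (simp add: B_iff)
  qed
  have comm: "x \<otimes>\<^bsub>?W\<^esub> y = y \<otimes>\<^bsub>?W\<^esub> x" if xy: "x \<in> B" "y \<in> B" for x y
  proof -
    obtain a b where "x = (a, 0)" "y = (b, 0)" using xy unfolding B_def by blast
    then show ?thesis by (simp add: mult_wreath add.commute cong: restrict_cong)
  qed
  have exp: "x [^]\<^bsub>?W\<^esub> p = \<one>\<^bsub>?W\<^esub>" if x: "x \<in> B" for x
  proof -
    obtain a where a: "x = (a, 0)" using x by (auto simp: B_def)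
    have "x [^]\<^bsub>?W\<^esub> k = (\<lambda>j\<in>{..<p}. (k * a j) mod p, 0)" for k :: nat
    proof (induction k)
      case 0
      then show ?case by (simp add: one_wreath restrict_def)
    next
      case (Suc k)
      then show ?case
        by (auto simp: a mult_wreath mod_simps add.commute intro!: restrict_ext)
    qed
    then show ?thesis by (simp add: one_wreath restrict_def fun_eq_iff)
  qed
  have t: "t \<in> carrier ?W" "t \<notin> B" using p1 by (auto simp: t_def carrier_wreath B_def)
  have "t [^]\<^bsub>?W\<^esub> k = ((\<lambda>j\<in>{..<p}. 0), k mod p)" for k :: nat
  proof (induction k)
    case 0
    then show ?case by (simp add: one_wreath restrict_def)
  next
    case (Suc k)
    then show ?case
      using p1 by (auto simp: t_def mult_wreath mod_simps intro!: restrict_ext)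
  qed
  then have tp: "t [^]\<^bsub>?W\<^esub> p = \<one>\<^bsub>?W\<^esub>" by (simp add: one_wreath restrict_def)
  have e: "e \<in> B" using p1 by (auto simp: e_def B_def)
  define D where "D = (\<lambda>x. cmt ?W x t)"
  have DB: "D x \<in> B" if "x \<in> B" for x
    using com_in_normal(1)[OF B] that t by (simp add: com_in_def D_def)
  \<comment> \<open>Conjugation by \<open>t\<close> shifts coordinates, so \<open>D x\<close> has
    entry \<open>x (j - 1) - x j\<close>, stated additively. The coordinate \<open>0\<close>, where
    the shift wraps around, is left out.\<close>
  have D_coord: "(fst x j + fst (D x) j) mod p = fst x (j - 1)" if x: "x \<in> B" and j: "0 < j" "j < p" for x j
  proof -
    obtain a where a: "x = (a, 0)" "a \<in> ?A" using x by (auto simp: B_def)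
    have DxB: "D x \<in> B" by (rule DB[OF x])
    then obtain c where c: "D x = (c, 0)" "c \<in> ?A" unfolding B_def by blast
    have xc: "x \<in> carrier ?W" "D x \<in> carrier ?W" using x DxB unfolding B_iff by blast+
    have "x \<otimes>\<^bsub>?W\<^esub> D x = inv\<^bsub>?W\<^esub> t \<otimes>\<^bsub>?W\<^esub> x \<otimes>\<^bsub>?W\<^esub> t"
      unfolding D_def by (rule conj_eq_cmt[OF xc(1) t(1), symmetric])
    then have "t \<otimes>\<^bsub>?W\<^esub> (x \<otimes>\<^bsub>?W\<^esub> D x) = x \<otimes>\<^bsub>?W\<^esub> t"
      using xc(1) t(1) by (simp add: m_assoc)
    then have "fst (t \<otimes>\<^bsub>?W\<^esub> (x \<otimes>\<^bsub>?W\<^esub> D x)) (j - 1) = fst (x \<otimes>\<^bsub>?W\<^esub> t) (j - 1)" by simp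
    moreover have "a (j - 1) < p" using PiE_mem[OF a(2), of "j - 1"] j by simp
    ultimately show ?thesis
      using j by (cases j) (simp_all add: a(1) c(1)[unfolded a(1)] t_def mult_wreath)
  qed
  \<comment> \<open>The leading 1 of the unit vector \<open>e\<close> moves one place to the right
    with each application of \<open>D\<close> and reaches the last coordinate after
    \<open>p - 1\<close> steps.\<close>
  have De: "(D ^^ i) e \<in> B \<and> fst ((D ^^ i) e) i = 1 \<and> (\<forall>j. i < j \<and> j < p \<longrightarrow> fst ((D ^^ i) e) j = 0)"
    if "i < p" for i
    using that
  proof (induction i)
    case 0
    then show ?case using e by (auto simp: e_def)
  next
    case (Suc i)
    let ?x = "(D ^^ i) e"
    have x: "?x \<in> B" "fst ?x i = 1" "\<And>j. i < j \<Longrightarrow> j < p \<Longrightarrow> fst ?x j = 0" using Suc by auto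
    have lt: "fst (D ?x) j < p" if "j < p" for j
    proof -
      have "fst (D ?x) \<in> ?A" using DB[OF x(1)] unfolding B_def by (simp add: mem_Times_iff)
      then show ?thesis using PiE_mem[of "fst (D ?x)" "{..<p}" "\<lambda>_. {..<p}" j] that by simp
    qed
    have "fst (D ?x) j = fst ?x (j - 1)" if "i < j" "j < p" for j
      using D_coord[OF x(1), of j] x(3)[of j] that lt[of j] by simp
    then show ?case using DB[OF x(1)] x Suc.prems by auto
  qed
  have "fst ((D ^^ (p - 1)) e) (p - 1) = 1" using De[of "p - 1"] p0 by simp
  then have e1: "((\<lambda>x. cmt ?W x t) ^^ (p - 1)) e \<noteq> \<one>\<^bsub>?W\<^esub>"
    using p0 by (auto simp: D_def one_wreath)
  have card_B: "card B = p ^ p" by (simp add: B_def card_cartesian_product card_PiE)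
  have index: "order ?W = p * card B" by (simp add: order_wreath card_B)
  have cl: "has_nilpotency_class ?W p"
    by (rule cyclic_extension_class[OF p fin B index comm exp t tp e e1])
  then show "maximal_class p ?W"
    unfolding maximal_class_def using is_group order_wreath[of p] p0
    by (intro conjI exI[of _ "p + 1"]) auto
  interpret pchain ?W p "p + 1" "\<lambda>i. if i \<le> 1 then B else lower_central ?W (i - 1)"
    using pchain_of_maximal_class[OF p order_wreath _ _ B] cl card_B p0 by simp
  have "com_in ?W B B {\<one>\<^bsub>?W\<^esub>}" using comm by (auto simp: com_in_def B_iff cmt_eq_one_iff)
  then show "self_similar p ?W"
    using exp t tp p0 by (intro self_similar_of_split[of t]) auto
qed

lemma has_nilpotency_class_iso:
  assumes G: "group G" and H: "group H" and h: "h \<in> iso G H" and cl: "has_nilpotency_class G c"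
  shows "has_nilpotency_class H c"
proof -
  interpret group_hom G H h
    using G H h by (auto simp: group_hom_def group_hom_axioms_def iso_def)
  have bij: "bij_betw h (carrier G) (carrier H)" using h by (simp add: iso_def)
  have eq: "lower_central H i = h ` lower_central G i" for i
    using lower_central_img bij by (simp add: bij_betw_def)
  have "h ` K = {\<one>\<^bsub>H\<^esub>} \<longleftrightarrow> K = {\<one>\<^bsub>G\<^esub>}" if "subgroup K G" for K
  proof
    assume K: "h ` K = {\<one>\<^bsub>H\<^esub>}"
    have "x = \<one>\<^bsub>G\<^esub>" if x: "x \<in> K" for x
    proof -
      have "h x = h \<one>\<^bsub>G\<^esub>" using K x hom_one by auto
      then show ?thesis
        by (rule inj_onD[OF bij_betw_imp_inj_on[OF bij] _ subgroup.mem_carrier[OF \<open>subgroup K G\<close> x] G.one_closed])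
    qed
    then show "K = {\<one>\<^bsub>G\<^esub>}" using subgroup.one_closed[OF that] by blast
  qed (use hom_one in simp)
  then show ?thesis
    using cl by (simp add: has_nilpotency_class_def eq G.lower_central_subgroup)
qed

lemma self_similar_iso:
  assumes "group G" "G \<cong> H" "self_similar p G"
  shows "self_similar p H"
  using assms group.iso_sym iso_trans unfolding self_similar_def by blast

text \<open>The witness for sharpness is stated as a group on natural numbers, so the wreath product
  is carried over along an enumeration of its elements.\<close>

lemma iso_nat_monoid:
  fixes G :: "('a, 'b) monoid_scheme"
  assumes "group G" "finite (carrier G)"
  obtains N :: "nat monoid" and h where "group N" "h \<in> iso G N"
proof -
  obtain h :: "'a \<Rightarrow> nat" where inj: "inj_on h (carrier G)"
    using finite_imp_inj_to_nat_seg[OF assms(2)] by blast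
  define N where "N = \<lparr>carrier = h ` carrier G,
    monoid.mult = (\<lambda>x y. h (inv_into (carrier G) h x \<otimes>\<^bsub>G\<^esub> inv_into (carrier G) h y)),
    one = h \<one>\<^bsub>G\<^esub>\<rparr>"
  have iso: "h \<in> iso G N"
    using inj by (auto simp: iso_def hom_def N_def bij_betw_def)
  then have "group (N\<lparr>one := h \<one>\<^bsub>G\<^esub>\<rparr>)" by (rule group.iso_imp_img_group[OF assms(1)])
  then have "group N" by (simp add: N_def)
  then show thesis using that iso by blast
qed

theorem theoremB:
  fixes p :: nat
  assumes "Factorial_Ring.prime p"
  shows "(\<forall>G :: ('a, 'b) monoid_scheme. maximal_class p G \<longrightarrow>
           (self_similar p G \<longleftrightarrow>
             (\<exists>M. maximal_subgroup M G \<and> elementary_abelian p (G\<lparr>carrier := M\<rparr>) \<and> splits_over G M)) \<and>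
           (self_similar p G \<longrightarrow> order G \<le> p ^ (p + 1))) \<and>
         (\<exists>G :: nat monoid. maximal_class p G \<and> self_similar p G \<and> order G = p ^ (p + 1))"
proof (intro conjI allI impI)
  fix G :: "('a, 'b) monoid_scheme"
  assume mc: "maximal_class p G"
  show "self_similar p G \<longleftrightarrow>
      (\<exists>M. maximal_subgroup M G \<and> elementary_abelian p (G\<lparr>carrier := M\<rparr>) \<and> splits_over G M)"
    by (rule self_similar_iff_split(1)[OF assms mc])
  show "order G \<le> p ^ (p + 1)" if "self_similar p G"
    by (rule self_similar_iff_split(2)[OF assms mc that])
next
  let ?W = "wreath p"
  have W: "group ?W" using assms by (intro group_wreath prime_gt_0_nat)
  have fin: "finite (carrier ?W)" by (simp add: carrier_wreath finite_PiE)
  obtain N :: "nat monoid" and h where N: "group N" and h: "h \<in> iso ?W N"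
    by (rule iso_nat_monoid[OF W fin])
  have iso: "?W \<cong> N" using h by (auto simp: is_iso_def)
  have order: "order N = p ^ (p + 1)"
    using iso_same_order[OF h] order_wreath[of p] by simp
  obtain n where "order ?W = p ^ n" "n \<ge> 2" "has_nilpotency_class ?W (n - 1)"
    using wreath_facts(1)[OF assms] by (auto simp: maximal_class_def)
  then have "maximal_class p N"
    unfolding maximal_class_def
    using N has_nilpotency_class_iso[OF W N h] iso_same_order[OF h] by auto
  moreover have "self_similar p N"
    by (rule self_similar_iso[OF W iso wreath_facts(2)[OF assms]])
  ultimately show "\<exists>G :: nat monoid. maximal_class p G \<and> self_similar p G \<and> order G = p ^ (p + 1)"
    using order by blast
qed

end
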